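(* Let $p$ be a probability density on $\mathbb{R}^d$ such that $\ln p$ is $C^1$, $\nabla\ln p$ is $L$-Lipschitz with $L\ge1$, and $p$ satisfies a log-Sobolev inequality with constant $C_{\mathrm{LS}}\ge1$. Let $s:\mathbb{R}^d\to\mathbb{R}^d$ satisfy, for some $\varepsilon_1\le\sqrt{\frac{1}{48C_{\mathrm{LS}}}}$, $\sup_{x\in\mathbb{R}^d}\|\nabla\ln p(x)-s(x)\|\le\varepsilon_1.$ Let $N\in\mathbb{N}_0$ and $0<h\le\frac{1}{4392\,dC_{\mathrm{LS}}L^2}$. Let $q_{nh}$ be the law of the $n$th iterate of Langevin Monte Carlo with step size $h$ and score estimate $s$, started from $q_0$. Then for every $k$, $$\chi^2(q_{(k+1)h}\|p)\le\exp\Big(-\frac{h}{4C_{\mathrm{LS}}}\Big)\chi^2(q_{kh}\|p)+170\,dL^2h^2+5\varepsilon_1^2h,$$ and $$\chi^2(q_{Nh}\|p)\le\exp\Big(-\frac{Nh}{4C_{\mathrm{LS}}}\Big)\chi^2(q_0\|p)+680\,dL^2hC_{\mathrm{LS}}+20\varepsilon_1^2C_{\mathrm{LS}}\le\exp\Big(-\frac{Nh}{4C_{\mathrm{LS}}}\Big)\chi^2(q_0\|p)+1.$$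
   Context: Langevin Monte Carlo with score estimate $s$ and step size $h$: $x_{(k+1)h}=x_{kh}+h\,s(x_{kh})+\sqrt{2h}\,\xi_{kh}$, $\xi_{kh}\sim N(0,I_d)$ i.i.d. independent of $x_0\sim q_0$. Log-Sobolev inequality with constant $C$: $\mathrm{KL}(q\|p)\le\frac C2\mathbb{E}_q\|\nabla\ln(q/p)\|^2$ for all $q$. $\chi^2(q\|p)=\int q^2/p-1$. *)

theory Defs
  imports "HOL-Probability.Probability"
begin

definition gauss_density :: "'a::euclidean_space \<Rightarrow> real \<Rightarrow> 'a \<Rightarrow> real" where
  "gauss_density m v y =
     (1 / (2 * pi * v)) powr (real DIM('a) / 2) * exp (- (norm (y - m))\<^sup>2 / (2 * v))"

text \<open>One LMC step from x: law of x + h s(x) + sqrt(2h) xi, xi ~ N(0,I), i.e. N(x + h s(x), 2h I).\<close>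
definition lmc_kernel :: "('a::euclidean_space \<Rightarrow> 'a) \<Rightarrow> real \<Rightarrow> 'a \<Rightarrow> 'a measure" where
  "lmc_kernel s h x = density lborel (\<lambda>y. ennreal (gauss_density (x + h *\<^sub>R s x) (2 * h) y))"

primrec lmc_law :: "'a measure \<Rightarrow> ('a::euclidean_space \<Rightarrow> 'a) \<Rightarrow> real \<Rightarrow> nat \<Rightarrow> 'a measure" where
  "lmc_law q0 s h 0 = q0"
| "lmc_law q0 s h (Suc n) = bind (lmc_law q0 s h n) (lmc_kernel s h)"

definition chi_sq :: "'a::euclidean_space measure \<Rightarrow> ('a \<Rightarrow> real) \<Rightarrow> ennreal" where
  "chi_sq q p =
     (if absolutely_continuous lborel q
      then (\<integral>\<^sup>+ x. (RN_deriv lborel q x)\<^sup>2 / ennreal (p x) \<partial>lborel) - 1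
      else \<infinity>)"

definition prob_density :: "('a::euclidean_space \<Rightarrow> real) \<Rightarrow> bool" where
  "prob_density p \<longleftrightarrow> p \<in> borel_measurable borel \<and> (\<forall>x. 0 \<le> p x)
     \<and> integrable lborel p \<and> (\<integral>x. p x \<partial>lborel) = 1"

text \<open>Log-Sobolev inequality with constant C for the positive density p with
  score gp = grad ln p: KL(q||p) \<le> C/2 E_q |grad ln (q/p)|^2 for every positive probability
  density q with differentiable ln q (gradient gq). KL is finite whenever the right side is.\<close>
definition log_sobolev :: "real \<Rightarrow> ('a::euclidean_space \<Rightarrow> real) \<Rightarrow> ('a \<Rightarrow> 'a) \<Rightarrow> bool" where
  "log_sobolev C p gp \<longleftrightarrow>
     (\<forall>q gq. prob_density q \<and> (\<forall>x. 0 < q x) \<and> (\<forall>x. GDERIV (\<lambda>y. ln (q y)) x :> gq x)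
       \<and> (\<integral>\<^sup>+ x. ennreal (q x * (norm (gq x - gp x))\<^sup>2) \<partial>lborel) < \<infinity>
       \<longrightarrow> integrable lborel (\<lambda>x. q x * ln (q x / p x))
           \<and> (\<integral>x. q x * ln (q x / p x) \<partial>lborel)
               \<le> C / 2 * (\<integral>x. q x * (norm (gq x - gp x))\<^sup>2 \<partial>lborel))"

end

theory Submission
  imports Defs
begin

text \<open>
  Interpolate one step by the law \<open>q t\<close> of \<open>X + t s(X) + sqrt (2 t) \<xi>\<close>, and let \<open>\<psi> = q t / p\<close>,
  \<open>F = E_p \<psi>^2\<close> and \<open>D = E_p |grad \<psi>|^2\<close>. The Fokker--Planck equation gives
  \<open>F' = - 2 D + 2 E[grad \<psi>(X_t) \<bullet> (s(X) - grad ln p (X_t))]\<close>, so Young's inequality leaves the error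
  \<open>E[\<psi>(X_t) |s(X) - grad ln p (X_t)|^2]\<close>. By the Lipschitz bound it is controlled by \<open>\<epsilon>^2 F\<close> and by
  \<open>L^2\<close> times the weighted second moment of the Gaussian increment \<open>z\<close>. Gaussian integration by parts
  bounds that moment by \<open>4 t d F + 4 t^2 D\<close>, and no change of measure is needed. Hence
  \<open>F' \<le> - 0.99 D + (2.5 \<epsilon>^2 + 30 L^2 t d) F\<close>. The log-Sobolev inequality enters only through the
  Poincare inequality \<open>F - 1 \<le> C D\<close>, and Gronwall's argument finishes the step. All integrals converge
  when the initial law has bounded support; the general case follows by monotone convergence. The error
  obtained for one step is smaller than the stated one, which is what makes the geometric series over
  the steps fit the stated constants, since \<open>1 / (1 - exp (- x))\<close> exceeds \<open>1 / x\<close>.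
\<close>

subsection \<open>Differentiation under the integral and Gaussian integrals\<close>

text \<open>The transition density solves a continuity equation with velocity
  \<open>(y - (X - t V)) / (2 t)\<close>, a radial field about \<open>X - t V\<close>. All
  integrations by parts therefore involve radial fields \<open>y - c\<close> only, and these follow
  by differentiating the invariance of the Lebesgue integral under dilations about \<open>c\<close>.
  Second derivatives and boundary terms never occur.

  All energies are integrals against one weight, \<open>\<psi>\<close> times the joint density of
  starting and current point. Two identities for it suffice: parts in the current point with the
  starting point fixed, and the conditional mean of the Gaussian increment given the current point.
  The choice of \<open>c\<close> decides what the first one yields: \<open>X - t V\<close> gives the
  derivative of \<open>F\<close>, and \<open>X + t V\<close> gives the second moment of the
  increment.

  The obstacle is the factor \<open>1 / p\<close>: a Lipschitz score allows it to grow like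
  \<open>exp (2 * L * |y|^2)\<close> up to a constant. Short times compensate: if
  \<open>240 * L * T \<le> 1\<close>, the transition density decays like
  \<open>exp (- 30 * L * |y|^2)\<close>. Convergence of every integral is then a matter of adding
  exponents.\<close>

lemma GDERIV_integral:
  fixes f :: "'a::euclidean_space \<Rightarrow> 'b \<Rightarrow> real"
  assumes e: "0 < e"
    and f_int: "\<And>y. y \<in> ball a e \<Longrightarrow> integrable M (f y)"
    and der: "\<And>x y. x \<in> space M \<Longrightarrow> y \<in> ball a e \<Longrightarrow> GDERIV (\<lambda>y. f y x) y :> g y x"
    and g_meas [measurable]: "g a \<in> borel_measurable M"
    and bd: "\<And>x y. x \<in> space M \<Longrightarrow> y \<in> ball a e \<Longrightarrow> norm (g y x) \<le> w x"
    and w_int: "integrable M w"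
  shows "GDERIV (\<lambda>y. \<integral>x. f y x \<partial>M) a :> (\<integral>x. g a x \<partial>M)"
proof -
  have a_in: "a \<in> ball a e" using e by simp
  have g_int: "integrable M (g a)"
    by (rule Bochner_Integration.integrable_bound[OF w_int]) (use bd[OF _ a_in] in \<open>auto intro!: AE_I2 intro: order_trans[OF _ abs_ge_self]\<close>)
  define I where "I = (\<lambda>y. \<integral>x. f y x \<partial>M)"
  \<comment> \<open>Only the gradients are assumed to be dominated. The mean value inequality on the
    convex ball turns this into a bound on increments, hence on the difference quotients.\<close>
  have lip: "\<bar>f (a + v) x - f a x\<bar> \<le> w x * norm v" if x: "x \<in> space M" and v: "norm v < e" for x v
  proof -
    have "norm (f (a + v) x - f a x) \<le> w x * norm (a + v - a)"
    proof (rule differentiable_bound[where S="ball a e" and f'="\<lambda>y h. h \<bullet> g y x"])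
      show "convex (ball a e)" by simp
      show "((\<lambda>y. f y x) has_derivative (\<lambda>h. h \<bullet> g y x)) (at y within ball a e)" if "y \<in> ball a e" for y
        using der[OF x that] unfolding gderiv_def by (rule has_derivative_at_withinI)
      show "onorm (\<lambda>h. h \<bullet> g y x) \<le> w x" if "y \<in> ball a e" for y
      proof (rule onorm_le)
        fix h show "norm (h \<bullet> g y x) \<le> w x * norm h"
          using Cauchy_Schwarz_ineq2[of h "g y x"] mult_left_mono[OF bd[OF x that], of "norm h"]
          by (simp add: mult.commute)
      qed
    qed (use v e in \<open>auto simp: dist_norm\<close>)
    thus ?thesis by simp
  qed
  have "((\<lambda>v. norm (I (a + v) - I a - v \<bullet> (\<integral>x. g a x \<partial>M)) / norm v) \<longlongrightarrow> 0) (at 0)"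
    unfolding tendsto_at_iff_sequentially
  proof (intro allI impI)
    fix X :: "nat \<Rightarrow> 'a" assume X: "\<forall>i. X i \<in> UNIV - {0}" and X0: "X \<longlonglongrightarrow> 0"
    \<comment> \<open>\<open>f (a + X i)\<close> is known to be integrable only inside the ball, so
      the quotient is set to zero while \<open>X i\<close> is too long; this happens only finitely
      often.\<close>
    define u where "u = (\<lambda>i x. if norm (X i) < e then (f (a + X i) x - f a x - X i \<bullet> g a x) / norm (X i) else 0)"
    have ev: "\<forall>\<^sub>F i in sequentially. norm (X i) < e"
      using tendstoD[OF X0 e] by simp
    have fX: "integrable M (f (a + X i))" if "norm (X i) < e" for i
      using that by (intro f_int) (simp add: dist_norm)
    have u_meas: "u i \<in> borel_measurable M" for i
    proof (cases "norm (X i) < e")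
      case True
      note [measurable] = borel_measurable_integrable[OF fX[OF True]] borel_measurable_integrable[OF f_int[OF a_in]]
      show ?thesis using True unfolding u_def by simp
    qed (simp add: u_def)
    have lim: "(\<lambda>i. \<integral>x. u i x \<partial>M) \<longlonglongrightarrow> (\<integral>x. 0 \<partial>M)"
    proof (rule integral_dominated_convergence[where w="\<lambda>x. 2 * w x"])
      show "AE x in M. (\<lambda>i. u i x) \<longlonglongrightarrow> 0"
      proof (rule AE_I2)
        fix x assume x: "x \<in> space M"
        have "((\<lambda>v. norm (f (a + v) x - f a x - v \<bullet> g a x) / norm v) \<longlongrightarrow> 0) (at 0)"
          using der[OF x a_in] unfolding gderiv_def has_derivative_at by simp
        hence "(\<lambda>i. norm (f (a + X i) x - f a x - X i \<bullet> g a x) / norm (X i)) \<longlonglongrightarrow> 0"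
          using X X0 unfolding tendsto_at_iff_sequentially comp_def by blast
        hence "(\<lambda>i. norm ((f (a + X i) x - f a x - X i \<bullet> g a x) / norm (X i))) \<longlonglongrightarrow> 0" by simp
        hence "(\<lambda>i. (f (a + X i) x - f a x - X i \<bullet> g a x) / norm (X i)) \<longlonglongrightarrow> 0"
          by (simp only: tendsto_norm_zero_iff)
        thus "(\<lambda>i. u i x) \<longlonglongrightarrow> 0"
          by (rule Lim_transform_eventually) (use ev in eventually_elim, simp add: u_def)
      qed
      show "AE x in M. norm (u i x) \<le> 2 * w x" for i
      proof (rule AE_I2)
        fix x assume x: "x \<in> space M"
        have w0: "0 \<le> w x" using bd[OF x a_in] norm_ge_zero order_trans by blast
        show "norm (u i x) \<le> 2 * w x"
        proof (cases "norm (X i) < e")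
          case True
          have "\<bar>X i \<bullet> g a x\<bar> \<le> norm (X i) * w x"
            using Cauchy_Schwarz_ineq2[of "X i" "g a x"] mult_left_mono[OF bd[OF x a_in], of "norm (X i)"] by simp
          hence "\<bar>f (a + X i) x - f a x - X i \<bullet> g a x\<bar> \<le> 2 * w x * norm (X i)"
            using lip[OF x True] by (simp only: mult.commute[of "norm (X i)"])
          thus ?thesis using True X w0 by (simp add: u_def field_simps)
        qed (use w0 in \<open>simp add: u_def\<close>)
      qed
    qed (use u_meas w_int in auto)
    have eq: "\<forall>\<^sub>F i in sequentially. norm (\<integral>x. u i x \<partial>M) = norm (I (a + X i) - I a - X i \<bullet> (\<integral>x. g a x \<partial>M)) / norm (X i)"
      using ev
    proof eventually_elim
      fix i assume i: "norm (X i) < e"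
      have "(\<integral>x. u i x \<partial>M) = (\<integral>x. (f (a + X i) x - f a x - X i \<bullet> g a x) / norm (X i) \<partial>M)"
        using i by (simp add: u_def)
      also have "\<dots> = (I (a + X i) - I a - X i \<bullet> (\<integral>x. g a x \<partial>M)) / norm (X i)"
        unfolding I_def using fX[OF i] f_int[OF a_in] g_int by simp
      finally show "norm (\<integral>x. u i x \<partial>M) = norm (I (a + X i) - I a - X i \<bullet> (\<integral>x. g a x \<partial>M)) / norm (X i)"
        by simp
    qed
    have "(\<lambda>i. norm (\<integral>x. u i x \<partial>M)) \<longlonglongrightarrow> 0" using tendsto_norm[OF lim] by simp
    hence "(\<lambda>i. norm (I (a + X i) - I a - X i \<bullet> (\<integral>x. g a x \<partial>M)) / norm (X i)) \<longlonglongrightarrow> 0"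
      by (rule Lim_transform_eventually) (use eq in simp)
    thus "((\<lambda>v. norm (I (a + v) - I a - v \<bullet> (\<integral>x. g a x \<partial>M)) / norm v) \<circ> X) \<longlonglongrightarrow> 0"
      by (simp add: comp_def)
  qed
  thus ?thesis
    unfolding gderiv_def has_derivative_at I_def
    by (simp add: bounded_linear_inner_left)
qed

section \<open>Dilations of Lebesgue measure and Gaussian normalisation\<close>

lemma lborel_integral_scale:
  fixes v :: "'a::euclidean_space \<Rightarrow> real"
  assumes [measurable]: "v \<in> borel_measurable borel" and r: "0 < r"
  shows "(\<integral>y. v y \<partial>lborel) = r ^ DIM('a) * (\<integral>y. v (c + r *\<^sub>R (y - c)) \<partial>lborel)"
proof -
  have "(\<integral>y. v y \<partial>lborel) = (\<integral>y. v y \<partial>density (distr lborel borel (\<lambda>x. (c - r *\<^sub>R c) + r *\<^sub>R x)) (\<lambda>_. \<bar>r\<bar> ^ DIM('a)))"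
    using lborel_affine[of r "c - r *\<^sub>R c"] r by simp
  also have "\<dots> = (\<integral>y. r ^ DIM('a) * v y \<partial>distr lborel borel (\<lambda>x. (c - r *\<^sub>R c) + r *\<^sub>R x))"
    using r by (subst integral_density) auto
  also have "\<dots> = (\<integral>y. r ^ DIM('a) * v ((c - r *\<^sub>R c) + r *\<^sub>R y) \<partial>lborel)"
    by (subst integral_distr) auto
  also have "\<dots> = r ^ DIM('a) * (\<integral>y. v (c + r *\<^sub>R (y - c)) \<partial>lborel)"
    by (simp add: algebra_simps)
  finally show ?thesis .
qed

lemma nn_integral_lborel_scale:
  fixes v :: "'a::euclidean_space \<Rightarrow> ennreal"
  assumes [measurable]: "v \<in> borel_measurable borel" and r: "0 < r"
  shows "(\<integral>\<^sup>+y. v y \<partial>lborel) = ennreal (r ^ DIM('a)) * (\<integral>\<^sup>+y. v (c + r *\<^sub>R y) \<partial>lborel)"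
proof -
  have "(\<integral>\<^sup>+y. v y \<partial>lborel) = (\<integral>\<^sup>+y. v y \<partial>density (distr lborel borel (\<lambda>x. c + r *\<^sub>R x)) (\<lambda>_. \<bar>r\<bar> ^ DIM('a)))"
    using lborel_affine[of r c] r by simp
  also have "\<dots> = (\<integral>\<^sup>+y. ennreal (r ^ DIM('a)) * v y \<partial>distr lborel borel (\<lambda>x. c + r *\<^sub>R x))"
    using r by (subst nn_integral_density) auto
  also have "\<dots> = (\<integral>\<^sup>+y. ennreal (r ^ DIM('a)) * v (c + r *\<^sub>R y) \<partial>lborel)"
    by (subst nn_integral_distr) auto
  also have "\<dots> = ennreal (r ^ DIM('a)) * (\<integral>\<^sup>+y. v (c + r *\<^sub>R y) \<partial>lborel)"
    by (simp add: nn_integral_cmult)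
  finally show ?thesis .
qed

lemma gauss_density_nonneg: "0 \<le> gauss_density m v y"
  by (simp add: gauss_density_def)

lemma gauss_density_pos: "0 < v \<Longrightarrow> 0 < gauss_density m v y"
  by (simp add: gauss_density_def)

lemma borel_measurable_gauss_density [measurable (raw)]:
  fixes m y :: "'b \<Rightarrow> 'a::euclidean_space"
  assumes [measurable]: "m \<in> borel_measurable M" "v \<in> borel_measurable M" "y \<in> borel_measurable M"
  shows "(\<lambda>x. gauss_density (m x) (v x) (y x)) \<in> borel_measurable M"
  unfolding gauss_density_def by measurable

text \<open>In coordinates the density is a product of one-dimensional normal densities, so
  Tonelli's theorem gives a product of ones.\<close>

lemma nn_integral_gauss_density:
  fixes m :: "'a::euclidean_space"
  assumes v: "0 < v"
  shows "(\<integral>\<^sup>+y. gauss_density m v y \<partial>lborel) = 1"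
proof -
  have eq: "gauss_density m v y = (\<Prod>b\<in>Basis. normal_density (m \<bullet> b) (sqrt v) (y \<bullet> b))" for y
  proof -
    have nrm: "(norm (y - m))\<^sup>2 = (\<Sum>b\<in>Basis. (y \<bullet> b - m \<bullet> b)\<^sup>2)"
      by (subst power2_norm_eq_inner, subst euclidean_inner) (simp add: power2_eq_square inner_diff_left)
    have "(1 / (2 * pi * v)) powr (real DIM('a) / 2) = ((1 / (2 * pi * v)) powr (1/2)) powr (real DIM('a))"
      by (simp add: powr_powr)
    also have "\<dots> = (1 / sqrt (2 * pi * v)) ^ DIM('a)"
      using v by (simp add: powr_half_sqrt real_sqrt_divide powr_realpow)
    finally have "(1 / (2 * pi * v)) powr (real DIM('a) / 2) = (1 / sqrt (2 * pi * v)) ^ DIM('a)" .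
    thus ?thesis using v unfolding gauss_density_def normal_density_def
      by (simp add: prod.distrib nrm exp_sum[symmetric] sum_divide_distrib sum_negf[symmetric] power_one_over prod_dividef)
  qed
  have "(\<integral>\<^sup>+y. gauss_density m v y \<partial>lborel) = (\<integral>\<^sup>+y. (\<Prod>b\<in>Basis. ennreal (normal_density (m \<bullet> b) (sqrt v) (y \<bullet> b))) \<partial>lborel)"
    unfolding eq by (simp add: prod_ennreal)
  also have "\<dots> = (\<Prod>b\<in>(Basis::'a set). (\<integral>\<^sup>+x. normal_density (m \<bullet> b) (sqrt v) x \<partial>lborel))"
    by (rule nn_integral_lborel_prod) auto
  also have "\<dots> = 1"
    using v by (simp add: nn_integral_eq_integral)
  finally show ?thesis .
qed

text \<open>Up to a constant factor this is the Gaussian density of variance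
  \<open>1 / (2 * a)\<close>.\<close>

lemma integrable_exp_neg_norm_sq:
  assumes a: "0 < a"
  shows "integrable lborel (\<lambda>y::'a::euclidean_space. exp (- a * (norm y)\<^sup>2))"
proof -
  have "integrable lborel (gauss_density (0::'a) (1 / (2 * a)))"
    unfolding integrable_iff_bounded
    using nn_integral_gauss_density[of "1 / (2 * a)" "0::'a"] a
    by (simp add: gauss_density_nonneg)
  hence "integrable lborel (\<lambda>y::'a. (1 / (2 * pi * (1 / (2 * a)))) powr (real DIM('a) / 2) * exp (- (norm y)\<^sup>2 / (2 * (1 / (2 * a)))))"
    by (simp add: gauss_density_def[abs_def])
  hence "integrable lborel (\<lambda>y::'a. exp (- (norm y)\<^sup>2 / (2 * (1 / (2 * a)))))"
    by (rule integrable_mult_left_iff[THEN iffD1, THEN disjE]) (use a in auto)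
  moreover have "- (norm y)\<^sup>2 / (2 * (1 / (2 * a))) = - a * (norm y)\<^sup>2" for y :: 'a
    using a by simp
  ultimately show ?thesis by (simp only:)
qed

subsection \<open>Functions dominated by Gaussian weights\<close>

lemma GDERIV_gauss_density:
  "GDERIV (gauss_density m v) y :> - (gauss_density m v y / v) *\<^sub>R (y - m)"
proof -
  have 1: "((\<lambda>y. - (norm (y - m))\<^sup>2 / (2 * v)) has_derivative (\<lambda>h. - (2 * (h \<bullet> (y - m))) / (2 * v))) (at y)"
  proof -
    have "((\<lambda>y. (- 1 / (2 * v)) * ((y - m) \<bullet> (y - m))) has_derivative
        (\<lambda>h. (- 1 / (2 * v)) * ((y - m) \<bullet> h + h \<bullet> (y - m)))) (at y)"
      by (intro has_derivative_mult_right) (rule derivative_eq_intros | simp)+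
    thus ?thesis by (simp add: power2_norm_eq_inner inner_commute)
  qed
  have "((\<lambda>y. (1 / (2 * pi * v)) powr (real DIM('a) / 2) * exp (- (norm (y - m))\<^sup>2 / (2 * v))) has_derivative
      (\<lambda>h. h \<bullet> (- (gauss_density m v y / v) *\<^sub>R (y - m)))) (at y)"
    by (rule has_derivative_eq_rhs[OF has_derivative_mult_right[OF has_derivative_exp[OF 1]]])
       (simp add: gauss_density_def fun_eq_iff)
  thus ?thesis unfolding gderiv_def by (simp add: gauss_density_def[abs_def])
qed

text \<open>The right side is \<open>- 1 / (2 * t)\<close> times the divergence in \<open>y\<close>
  of the density multiplied by \<open>y - (x - t *\<^sub>R w)\<close>: the Fokker--Planck equation
  as a continuity equation with a radial velocity about \<open>x - t *\<^sub>R w\<close>. For the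
  proof the square is expanded, so that time enters the exponent only through \<open>ln t\<close>,
  \<open>1 / t\<close> and \<open>t\<close>.\<close>

lemma DERIV_gauss_density_time:
  fixes x w y :: "'a::euclidean_space"
  assumes t: "0 < t"
  shows "((\<lambda>t. gauss_density (x + t *\<^sub>R w) (2 * t) y) has_real_derivative
     gauss_density (x + t *\<^sub>R w) (2 * t) y / (2 * t) *
       ((y - (x + t *\<^sub>R w)) \<bullet> (y - (x - t *\<^sub>R w)) / (2 * t) - DIM('a))) (at t)"
proof -
  let ?u = "y - x"
  have nrm: "(norm (y - (x + t *\<^sub>R w)))\<^sup>2 = ?u \<bullet> ?u - 2 * t * (?u \<bullet> w) + t\<^sup>2 * (w \<bullet> w)" for t
    unfolding power2_norm_eq_inner power2_eq_square[of t]
    by (simp add: inner_diff_left inner_diff_right inner_add_left inner_add_right inner_commute algebra_simps)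
  have inn: "(y - (x + t *\<^sub>R w)) \<bullet> (y - (x - t *\<^sub>R w)) = ?u \<bullet> ?u - t\<^sup>2 * (w \<bullet> w)"
    by (simp add: inner_diff_left inner_diff_right inner_add_left inner_add_right inner_commute algebra_simps power2_eq_square)
  define a where "a = real DIM('a) / 2"
  define g where "g = (\<lambda>t. - (a * ln (4 * pi)) - a * ln t - (?u \<bullet> ?u) / 4 * inverse t + (?u \<bullet> w) / 2 - t * ((w \<bullet> w) / 4))"
  have eq: "gauss_density (x + t *\<^sub>R w) (2 * t) y = exp (g t)" if t: "0 < t" for t
  proof -
    have "(1 / (2 * pi * (2 * t))) powr a = exp (- (a * ln (4 * pi)) - a * ln t)"
      using t by (simp add: powr_def ln_div ln_mult algebra_simps)
    moreover have "- (?u \<bullet> ?u - 2 * t * (?u \<bullet> w) + t\<^sup>2 * (w \<bullet> w)) / (2 * (2 * t))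
        = - (?u \<bullet> ?u) / 4 * inverse t + (?u \<bullet> w) / 2 - t * ((w \<bullet> w) / 4)"
      using t by (simp add: field_simps power2_eq_square)
    ultimately show ?thesis
      unfolding gauss_density_def nrm a_def[symmetric] g_def by (simp add: exp_add[symmetric])
  qed
  have D0: "((\<lambda>t. exp (g t)) has_real_derivative exp (g t) * (- a * inverse t + (?u \<bullet> ?u) / 4 * (inverse t * inverse t) - (w \<bullet> w) / 4)) (at t)"
  proof (rule DERIV_fun_exp)
    have "(g has_real_derivative (0 - a * inverse t - (?u \<bullet> ?u) / 4 * (- (inverse t ^ Suc (Suc 0))) + 0 - 1 * ((w \<bullet> w) / 4))) (at t)"
      unfolding g_def
      by (rule DERIV_diff DERIV_add DERIV_const DERIV_cmult DERIV_cmult_right DERIV_ln DERIV_inverse DERIV_ident | use t in simp)+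
    thus "(g has_real_derivative (- a * inverse t + (?u \<bullet> ?u) / 4 * (inverse t * inverse t) - (w \<bullet> w) / 4)) (at t)"
      by simp
  qed
  have "exp (g t) * (- a * inverse t + (?u \<bullet> ?u) / 4 * (inverse t * inverse t) - (w \<bullet> w) / 4)
     = gauss_density (x + t *\<^sub>R w) (2 * t) y / (2 * t) *
       ((y - (x + t *\<^sub>R w)) \<bullet> (y - (x - t *\<^sub>R w)) / (2 * t) - DIM('a))"
  proof -
    have "e * (- (n / 2) * inverse t + u / 4 * (inverse t * inverse t) - w / 4)
        = e / (2 * t) * ((u - t\<^sup>2 * w) / (2 * t) - n)" for e n u w
      using t by (simp add: divide_simps power2_eq_square)
    thus ?thesis unfolding eq[OF t] inn a_def by simp
  qed
  from DERIV_cong[OF D0 this] have D: "((\<lambda>t. exp (g t)) has_real_derivative gauss_density (x + t *\<^sub>R w) (2 * t) y / (2 * t) *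
       ((y - (x + t *\<^sub>R w)) \<bullet> (y - (x - t *\<^sub>R w)) / (2 * t) - DIM('a))) (at t)" .
  have "\<forall>\<^sub>F t in nhds t. 0 < t" using t by (intro eventually_nhds_in_open[of "{0<..}", simplified]) auto
  hence ev: "\<forall>\<^sub>F t in nhds t. exp (g t) = gauss_density (x + t *\<^sub>R w) (2 * t) y"
    by eventually_elim (simp add: eq)
  show ?thesis by (rule iffD1[OF DERIV_cong_ev[OF refl ev refl] D])
qed

text \<open>Growth is measured in multiples \<open>n\<close> of \<open>L * |y|^2\<close>, and a
  negative \<open>n\<close> means Gaussian decay. Exponents add under products, which reduces
  integrability to arithmetic. The constant is uniform over \<open>I\<close>, so that one bound can
  serve as dominating function for a whole range of times and starting points.\<close>

definition expdom :: "real \<Rightarrow> 'i set \<Rightarrow> real \<Rightarrow> ('i \<Rightarrow> 'a::euclidean_space \<Rightarrow> 'c::real_normed_vector) \<Rightarrow> bool" where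
  "expdom L I n g \<longleftrightarrow> (\<exists>c. \<forall>i\<in>I. \<forall>y. norm (g i y) \<le> c * exp (n * L * (norm y)\<^sup>2))"

lemma expdomI: "(\<And>i y. i \<in> I \<Longrightarrow> norm (g i y) \<le> c * exp (n * L * (norm y)\<^sup>2)) \<Longrightarrow> expdom L I n g"
  unfolding expdom_def by blast

lemma expdomE:
  fixes g :: "'i \<Rightarrow> 'a::euclidean_space \<Rightarrow> 'c::real_normed_vector"
  assumes "expdom L I n g"
  obtains c where "0 \<le> c" "\<And>i y. i \<in> I \<Longrightarrow> norm (g i y) \<le> c * exp (n * L * (norm y)\<^sup>2)"
proof -
  from assms obtain c where c: "\<And>i y. i \<in> I \<Longrightarrow> norm (g i y) \<le> c * exp (n * L * (norm y)\<^sup>2)"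
    unfolding expdom_def by blast
  show ?thesis
  proof (rule that[of "\<bar>c\<bar>"])
    fix i and y :: 'a assume "i \<in> I"
    have "c * exp (n * L * (norm y)\<^sup>2) \<le> \<bar>c\<bar> * exp (n * L * (norm y)\<^sup>2)"
      by (rule mult_right_mono) auto
    thus "norm (g i y) \<le> \<bar>c\<bar> * exp (n * L * (norm y)\<^sup>2)" using c[OF \<open>i \<in> I\<close>, of y] by linarith
  qed simp
qed

lemma expdom_bound:
  assumes f: "expdom L I n f" and le: "\<And>i y. i \<in> I \<Longrightarrow> norm (g i y) \<le> norm (f i y)"
  shows "expdom L I n g"
  using f le unfolding expdom_def by (meson order_trans)

lemma expdom_mono:
  fixes g :: "'i \<Rightarrow> 'a::euclidean_space \<Rightarrow> 'c::real_normed_vector"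
  assumes "expdom L I n g" "n \<le> n'" "0 \<le> L"
  shows "expdom L I n' g"
proof -
  from assms(1) obtain c where c: "0 \<le> c" "\<And>i y. i \<in> I \<Longrightarrow> norm (g i y) \<le> c * exp (n * L * (norm y)\<^sup>2)"
    by (rule expdomE) blast
  show ?thesis
  proof (rule expdomI)
    fix i and y :: 'a assume "i \<in> I"
    have "c * exp (n * L * (norm y)\<^sup>2) \<le> c * exp (n' * L * (norm y)\<^sup>2)"
      using c(1) assms by (intro mult_left_mono) (auto intro!: mult_right_mono)
    thus "norm (g i y) \<le> c * exp (n' * L * (norm y)\<^sup>2)" using c(2)[OF \<open>i \<in> I\<close>, of y] by linarith
  qed
qed

lemma expdom_add:
  fixes f g :: "'i \<Rightarrow> 'a::euclidean_space \<Rightarrow> 'c::real_normed_vector"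
  assumes "expdom L I n f" "expdom L I m g" "0 \<le> L" 
  shows "expdom L I (max n m) (\<lambda>i y. f i y + g i y)"
proof -
  obtain c where c: "\<And>i y. i \<in> I \<Longrightarrow> norm (f i y) \<le> c * exp (max n m * L * (norm y)\<^sup>2)"
    using expdom_mono[OF assms(1) _ assms(3), of "max n m"] by (auto elim!: expdomE)
  obtain d where d: "\<And>i y. i \<in> I \<Longrightarrow> norm (g i y) \<le> d * exp (max n m * L * (norm y)\<^sup>2)"
    using expdom_mono[OF assms(2) _ assms(3), of "max n m"] by (auto elim!: expdomE)
  show ?thesis
  proof (rule expdomI)
    fix i and y :: 'a assume "i \<in> I"
    thus "norm (f i y + g i y) \<le> (c + d) * exp (max n m * L * (norm y)\<^sup>2)"
      using c[of i y] d[of i y] norm_triangle_ineq[of "f i y" "g i y"] by (simp add: algebra_simps)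
  qed
qed

lemma expdom_minus: "expdom L I n f \<Longrightarrow> expdom L I n (\<lambda>i y. - f i y)"
  by (simp add: expdom_def)

lemma expdom_diff:
  assumes "expdom L I n f" "expdom L I m g" "0 \<le> L" 
  shows "expdom L I (max n m) (\<lambda>i y. f i y - g i y)"
  using expdom_add[OF assms(1) expdom_minus[OF assms(2)] assms(3)] by simp

lemma expdom_prod:
  fixes f :: "'i \<Rightarrow> 'a::euclidean_space \<Rightarrow> 'c::real_normed_vector"
    and g :: "'i \<Rightarrow> 'a \<Rightarrow> 'd::real_normed_vector" and k :: "'i \<Rightarrow> 'a \<Rightarrow> 'e::real_normed_vector"
  assumes "expdom L I n f" "expdom L I m g"
    and le: "\<And>i y. i \<in> I \<Longrightarrow> norm (k i y) \<le> norm (f i y) * norm (g i y)"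
  shows "expdom L I (n + m) k"
proof -
  from assms(1) obtain c where c: "0 \<le> c" "\<And>i y. i \<in> I \<Longrightarrow> norm (f i y) \<le> c * exp (n * L * (norm y)\<^sup>2)"
    by (rule expdomE) blast
  from assms(2) obtain d where d: "0 \<le> d" "\<And>i y. i \<in> I \<Longrightarrow> norm (g i y) \<le> d * exp (m * L * (norm y)\<^sup>2)"
    by (rule expdomE) blast
  show ?thesis
  proof (rule expdomI)
    fix i and y :: 'a assume i: "i \<in> I"
    have "norm (k i y) \<le> norm (f i y) * norm (g i y)" by (rule le[OF i])
    also have "\<dots> \<le> (c * exp (n * L * (norm y)\<^sup>2)) * (d * exp (m * L * (norm y)\<^sup>2))"
      using c(2)[OF i, of y] d(2)[OF i, of y] c(1) d(1) by (intro mult_mono) auto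
    also have "\<dots> = (c * d) * exp ((n + m) * L * (norm y)\<^sup>2)"
      by (simp add: exp_add[symmetric] algebra_simps)
    finally show "norm (k i y) \<le> (c * d) * exp ((n + m) * L * (norm y)\<^sup>2)" .
  qed
qed

lemma expdom_mult:
  fixes f g :: "'i \<Rightarrow> 'a::euclidean_space \<Rightarrow> real"
  assumes "expdom L I n f" "expdom L I m g"
  shows "expdom L I (n + m) (\<lambda>i y. f i y * g i y)"
  by (rule expdom_prod[OF assms]) (simp add: abs_mult)

lemma expdom_scaleR:
  assumes "expdom L I n f" "expdom L I m g"
  shows "expdom L I (n + m) (\<lambda>i y. f i y *\<^sub>R g i y)"
  by (rule expdom_prod[OF assms]) simp

lemma expdom_inner:
  assumes "expdom L I n f" "expdom L I m g"
  shows "expdom L I (n + m) (\<lambda>i y. f i y \<bullet> g i y)"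
  by (rule expdom_prod[OF assms]) (simp add: Cauchy_Schwarz_ineq2)

lemma expdom_norm_sq:
  assumes "expdom L I n f"
  shows "expdom L I (n + n) (\<lambda>i y. (norm (f i y))\<^sup>2)"
  by (rule expdom_prod[OF assms assms]) (simp add: power2_eq_square)

lemma expdom_cmult:
  fixes f :: "'i \<Rightarrow> 'a::euclidean_space \<Rightarrow> real"
  assumes "expdom L I n f"
  shows "expdom L I n (\<lambda>i y. a * f i y)"
proof -
  have "expdom L I 0 (\<lambda>i (y::'a). a)" by (rule expdomI[where c="\<bar>a\<bar>"]) simp
  from expdom_mult[OF this assms] show ?thesis by simp
qed

lemma expdom_bounded:
  assumes "\<And>i. i \<in> I \<Longrightarrow> norm (f i) \<le> c"
  shows "expdom L I 0 (\<lambda>i y. f i)"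
  by (rule expdomI[where c=c]) (use assms in simp)

text \<open>Linear growth is charged a full unit of exponent. This is coarse, but polynomial factors
  then obey the same arithmetic as all the others; \<open>1 \<le> L\<close> allows
  \<open>|y|^2\<close> to be measured in units of \<open>L\<close>.\<close>

lemma expdom_ident:
  assumes "1 \<le> L" shows "expdom L I 1 (\<lambda>i (y::'a::euclidean_space). y)"
proof (rule expdomI[where c=1])
  fix i and y :: 'a
  have "0 \<le> (norm y - 1)\<^sup>2" by simp
  hence "2 * norm y \<le> 1 + (norm y)\<^sup>2" by (simp add: power2_diff)
  hence "norm y \<le> 1 + (norm y)\<^sup>2" using norm_ge_zero[of y] by linarith
  also have "\<dots> \<le> exp ((norm y)\<^sup>2)" by simp
  also have "\<dots> \<le> exp (1 * L * (norm y)\<^sup>2)" using assms mult_right_mono[of 1 L "(norm y)\<^sup>2"] by simp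
  finally show "norm y \<le> 1 * exp (1 * L * (norm y)\<^sup>2)" by simp
qed

lemma expdom_integrable:
  fixes f :: "'a::euclidean_space \<Rightarrow> real"
  assumes "expdom L {()} n (\<lambda>_. f)" "n < 0" "0 < L" and [measurable]: "f \<in> borel_measurable borel"
  shows "integrable lborel f"
proof -
  from assms(1) obtain c where c: "0 \<le> c" "\<And>y. norm (f y) \<le> c * exp (n * L * (norm y)\<^sup>2)"
    by (rule expdomE) blast
  have "integrable lborel (\<lambda>y::'a. c * exp (- (- n * L) * (norm y)\<^sup>2))"
    using assms by (intro integrable_mult_right integrable_exp_neg_norm_sq) (simp add: mult_neg_pos)
  thus ?thesis
    by (rule Bochner_Integration.integrable_bound) (use c in auto)
qed

lemma (in finite_measure) expdom_integrable_pair: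
  fixes f :: "'a \<Rightarrow> 'b::euclidean_space \<Rightarrow> real"
  assumes "expdom L (space M) n f" "n < 0" "0 < L" and meas: "case_prod f \<in> borel_measurable (M \<Otimes>\<^sub>M lborel)"
  shows "integrable (M \<Otimes>\<^sub>M lborel) (case_prod f)"
proof -
  interpret pair_sigma_finite M "lborel::'b measure" ..
  from assms(1) obtain c where c: "0 \<le> c" "\<And>x y. x \<in> space M \<Longrightarrow> norm (f x y) \<le> c * exp (n * L * (norm y)\<^sup>2)"
    by (rule expdomE) blast
  have "integrable lborel (\<lambda>y::'b. c * exp (- (- n * L) * (norm y)\<^sup>2))"
    using assms by (intro integrable_mult_right integrable_exp_neg_norm_sq) (simp add: mult_neg_pos)
  hence "integrable (M \<Otimes>\<^sub>M lborel) (\<lambda>(x::'a, y::'b). c * exp (- (- n * L) * (norm y)\<^sup>2))"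
    using c(1) by (intro Fubini_integrable) auto
  thus ?thesis
    by (rule Bochner_Integration.integrable_bound[OF _ meas])
      (use c in \<open>auto simp: space_pair_measure split_beta intro!: AE_I2 intro: order_trans[OF _ abs_ge_self]\<close>)
qed

text \<open>Differentiate the scaling identity for the Lebesgue integral at the ratio one.\<close>
lemma integral_radial_derivative:
  fixes v :: "'a::euclidean_space \<Rightarrow> real"
  assumes L: "1 \<le> L"
    and der: "\<And>y. GDERIV v y :> dv y"
    and v_dom: "expdom L {()} n (\<lambda>_. v)" and n: "n < 0"
    and dv_dom: "expdom L {()} m (\<lambda>_. dv)" and m: "m < -16"
    and dv_meas [measurable]: "dv \<in> borel_measurable borel"
  shows "(\<integral>y. dv y \<bullet> (y - c) + DIM('a) * v y \<partial>lborel) = 0"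
proof -
  have cont: "continuous_on UNIV v"
    using der unfolding gderiv_def by (meson continuous_at_imp_continuous_on has_derivative_continuous)
  have v_meas [measurable]: "v \<in> borel_measurable borel"
    using borel_measurable_continuous_onI[OF cont] by simp
  have v_int: "integrable lborel v"
    by (rule expdom_integrable[OF v_dom n]) (use L in auto)
  from dv_dom obtain K where K: "0 \<le> K" "\<And>y. norm (dv y) \<le> K * exp (m * L * (norm y)\<^sup>2)"
    by (rule expdomE) blast
  define S where "S = (\<lambda>r y. v (c + r *\<^sub>R (y - c)))"
  \<comment> \<open>Dilations by factors between 1/2 and 3/2 keep at least an eighth of
    \<open>|y|^2\<close>, up to a constant depending on the centre. This gives one dominating
    function for all of them.\<close>
  have lower: "(norm y)\<^sup>2 / 8 - (norm c)\<^sup>2 \<le> (norm (c + r *\<^sub>R (y - c)))\<^sup>2" if "r \<in> ball 1 (1/2)" for r and y :: 'a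
  proof -
    have r: "1/2 \<le> r" "r \<le> 3/2" using that unfolding mem_ball dist_real_def by linarith+
    have "r *\<^sub>R y = (c + r *\<^sub>R (y - c)) - (1 - r) *\<^sub>R c" by (simp add: algebra_simps)
    hence "norm (r *\<^sub>R y) \<le> norm (c + r *\<^sub>R (y - c)) + norm ((1 - r) *\<^sub>R c)"
      by (metis norm_triangle_ineq4)
    moreover have "norm ((1 - r) *\<^sub>R c) \<le> 1/2 * norm c"
      using r by (simp only: norm_scaleR) (intro mult_right_mono; simp add: abs_le_iff abs_if)
    moreover have "1/2 * norm y \<le> norm (r *\<^sub>R y)"
      using r by (simp only: norm_scaleR) (intro mult_right_mono; simp add: abs_le_iff abs_if)
    ultimately have "1/2 * norm y \<le> norm (c + r *\<^sub>R (y - c)) + 1/2 * norm c" by linarith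
    hence "(1/2 * norm y)\<^sup>2 \<le> (norm (c + r *\<^sub>R (y - c)) + 1/2 * norm c)\<^sup>2"
      by (intro power_mono) auto
    also have "\<dots> \<le> 2 * (norm (c + r *\<^sub>R (y - c)))\<^sup>2 + 2 * (1/2 * norm c)\<^sup>2"
      using sum_squares_bound[of "norm (c + r *\<^sub>R (y - c))" "1/2 * norm c"] by (simp add: power2_sum)
    finally have "(norm y)\<^sup>2 / 4 \<le> 2 * (norm (c + r *\<^sub>R (y - c)))\<^sup>2 + (norm c)\<^sup>2 / 2"
      by (simp add: power_mult_distrib power_divide)
    thus ?thesis using zero_le_power2[of "norm c"] by linarith
  qed
  \<comment> \<open>The exponent \<open>m\<close> shrinks to \<open>m / 8\<close> under the
    dilations, and the factor \<open>norm (y - c)\<close> costs one more unit. With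
    \<open>m < -16\<close> the sum is still negative.\<close>
  define W where "W = (\<lambda>y::'a. (K * exp (- m * L * (norm c)\<^sup>2)) * (exp (m / 8 * L * (norm y)\<^sup>2) * norm (y - c)))"
  have "expdom L {()} (m / 8 + max 1 0) (\<lambda>_. W)"
  proof -
    have "expdom L {()} (m / 8) (\<lambda>_ y::'a. exp (m / 8 * L * (norm y)\<^sup>2))"
      by (rule expdomI[where c=1]) simp
    moreover have "expdom L {()} (max 1 0) (\<lambda>_ y. norm (y - c))"
      using expdom_diff[OF expdom_ident[OF L] expdom_bounded[of "{()}" "\<lambda>_. c" "norm c"]] L
      by (auto simp: expdom_def)
    ultimately show ?thesis unfolding W_def
      by (rule expdom_cmult[OF expdom_mult])
  qed
  hence W_int: "integrable lborel W"
    by (rule expdom_integrable) (use L m in \<open>auto simp: W_def\<close>)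
  have W_bd: "norm (dv (c + r *\<^sub>R (y - c)) \<bullet> (y - c)) \<le> W y" if "r \<in> ball 1 (1/2)" for r y
  proof -
    have "norm (dv (c + r *\<^sub>R (y - c)) \<bullet> (y - c)) \<le> norm (dv (c + r *\<^sub>R (y - c))) * norm (y - c)"
      by (simp add: Cauchy_Schwarz_ineq2)
    also have "\<dots> \<le> (K * exp (m * L * (norm (c + r *\<^sub>R (y - c)))\<^sup>2)) * norm (y - c)"
      by (intro mult_right_mono K) auto
    also have "\<dots> \<le> (K * exp (m * L * ((norm y)\<^sup>2 / 8 - (norm c)\<^sup>2))) * norm (y - c)"
      using lower[OF that, of y] K(1) L m
      by (intro mult_right_mono mult_left_mono) (auto intro!: mult_left_mono_neg simp: mult_neg_pos mult_le_0_iff)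
    also have "exp (m * L * ((norm y)\<^sup>2 / 8 - (norm c)\<^sup>2)) = exp (- m * L * (norm c)\<^sup>2) * exp (m / 8 * L * (norm y)\<^sup>2)"
      unfolding exp_add[symmetric] by (rule arg_cong[of _ _ exp]) (simp add: algebra_simps)
    also have "K * (exp (- m * L * (norm c)\<^sup>2) * exp (m / 8 * L * (norm y)\<^sup>2)) * norm (y - c) = W y"
      by (simp add: W_def mult.assoc)
    finally show ?thesis .
  qed
  have "GDERIV (\<lambda>r. \<integral>y. S r y \<partial>lborel) 1 :> (\<integral>y. dv (c + 1 *\<^sub>R (y - c)) \<bullet> (y - c) \<partial>lborel)"
  proof (rule GDERIV_integral[where e="1/2" and w=W and g="\<lambda>r y. dv (c + r *\<^sub>R (y - c)) \<bullet> (y - c)"])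
    show "integrable lborel (S r)" if "r \<in> ball 1 (1/2)" for r
    proof -
      have r: "0 < r" using that unfolding mem_ball dist_real_def by linarith
      have "S r = (\<lambda>y. v (r *\<^sub>R y + (c - r *\<^sub>R c)))" by (simp add: S_def algebra_simps fun_eq_iff)
      moreover have "(\<integral>\<^sup>+y. norm (v (r *\<^sub>R y + (c - r *\<^sub>R c))) \<partial>lborel) < \<infinity>"
      proof -
        have "(\<integral>\<^sup>+y. norm (v y) \<partial>lborel) < \<infinity>" using v_int by (simp add: integrable_iff_bounded)
        also have "(\<integral>\<^sup>+y. norm (v y) \<partial>lborel) = ennreal (r ^ DIM('a)) * (\<integral>\<^sup>+y. norm (v (r *\<^sub>R y + (c - r *\<^sub>R c))) \<partial>lborel)"
          by (subst nn_integral_lborel_scale[OF _ r, of _ "c - r *\<^sub>R c"]) (auto simp: add.commute)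
        finally show ?thesis using r by (auto simp: ennreal_mult_less_top)
      qed
      ultimately show ?thesis by (simp add: integrable_iff_bounded)
    qed
    show "GDERIV (\<lambda>r. S r y) r :> dv (c + r *\<^sub>R (y - c)) \<bullet> (y - c)" for r y
    proof -
      have "((\<lambda>r. c + r *\<^sub>R (y - c)) has_derivative (\<lambda>h. h *\<^sub>R (y - c))) (at r)"
        by (rule derivative_eq_intros | simp)+
      moreover have "(v has_derivative (\<lambda>h. h \<bullet> dv (c + r *\<^sub>R (y - c)))) (at (c + r *\<^sub>R (y - c)))"
        using der unfolding gderiv_def .
      ultimately have "((\<lambda>r. S r y) has_derivative (\<lambda>h. (h *\<^sub>R (y - c)) \<bullet> dv (c + r *\<^sub>R (y - c)))) (at r)"
        unfolding S_def by (rule has_derivative_compose)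
      thus ?thesis unfolding gderiv_def
        by (rule has_derivative_eq_rhs) (simp add: fun_eq_iff inner_commute)
    qed
  qed (use W_int W_bd in auto)
  hence D1: "((\<lambda>r. \<integral>y. S r y \<partial>lborel) has_real_derivative (\<integral>y. dv y \<bullet> (y - c) \<partial>lborel)) (at 1)"
    by simp
  have "((\<lambda>r. r ^ DIM('a) * (\<integral>y. S r y \<partial>lborel)) has_real_derivative
      (DIM('a) * (\<integral>y. S 1 y \<partial>lborel) + (\<integral>y. dv y \<bullet> (y - c) \<partial>lborel))) (at 1)"
    by (rule derivative_eq_intros D1 refl | simp)+
  \<comment> \<open>By the scaling identity the product is constant in \<open>r\<close>, so the
    derivative just computed must vanish.\<close>
  moreover have "\<forall>\<^sub>F r in nhds 1. r ^ DIM('a) * (\<integral>y. S r y \<partial>lborel) = (\<integral>y. v y \<partial>lborel)"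
  proof -
    have "\<forall>\<^sub>F r::real in nhds 1. 0 < r" by (intro eventually_nhds_in_open[of "{0<..}", simplified]) auto
    thus ?thesis by eventually_elim (simp add: S_def lborel_integral_scale[symmetric])
  qed
  ultimately have "((\<lambda>r. \<integral>y. v y \<partial>lborel) has_real_derivative
      (DIM('a) * (\<integral>y. S 1 y \<partial>lborel) + (\<integral>y. dv y \<bullet> (y - c) \<partial>lborel))) (at 1)"
    by (subst (asm) DERIV_cong_ev[OF refl _ refl]) auto
  hence "DIM('a) * (\<integral>y. S 1 y \<partial>lborel) + (\<integral>y. dv y \<bullet> (y - c) \<partial>lborel) = 0"
    using DERIV_unique DERIV_const by blast
  moreover have "integrable lborel (\<lambda>y. dv y \<bullet> (y - c))"
    by (rule Bochner_Integration.integrable_bound[OF W_int])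
       (use W_bd[of 1] in \<open>auto intro: order_trans[OF _ abs_ge_self]\<close>)
  ultimately show ?thesis
    using v_int by (simp add: S_def add.commute)
qed

lemma expdom_reindex:
  assumes "expdom L I n f" "\<And>j. j \<in> J \<Longrightarrow> \<phi> j \<in> I"
  shows "expdom L J n (\<lambda>j. f (\<phi> j))"
  using assms unfolding expdom_def by meson

lemma (in finite_measure) expdom_integrable_slice:
  fixes f :: "'a \<Rightarrow> 'b::euclidean_space \<Rightarrow> 'c::{banach,second_countable_topology}"
  assumes "expdom L (space M) n f" "(\<lambda>x. f x y) \<in> borel_measurable M"
  shows "integrable M (\<lambda>x. f x y)"
proof -
  from assms(1) obtain c where c: "\<And>x. x \<in> space M \<Longrightarrow> norm (f x y) \<le> c * exp (n * L * (norm y)\<^sup>2)"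
    by (rule expdomE) blast
  show ?thesis by (rule integrable_const_bound[OF _ assms(2)]) (use c in auto)
qed

lemma (in prob_space) expdom_integral:
  fixes f :: "'i \<times> 'a \<Rightarrow> 'b::euclidean_space \<Rightarrow> 'c::{banach,second_countable_topology}"
  assumes dom: "expdom L (I \<times> space M) n f" and meas: "\<And>i y. i \<in> I \<Longrightarrow> (\<lambda>x. f (i, x) y) \<in> borel_measurable M"
  shows "expdom L I n (\<lambda>i y. \<integral>x. f (i, x) y \<partial>M)"
proof -
  from dom obtain c where c: "\<And>i x y. i \<in> I \<Longrightarrow> x \<in> space M \<Longrightarrow> norm (f (i, x) y) \<le> c * exp (n * L * (norm y)\<^sup>2)"
    by (rule expdomE) blast
  show ?thesis
  proof (rule expdomI)
    fix i y assume i: "i \<in> I"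
    have int: "integrable M (\<lambda>x. f (i, x) y)"
      by (rule integrable_const_bound[OF _ meas[OF i]]) (use c[OF i] in auto)
    have "norm (\<integral>x. f (i, x) y \<partial>M) \<le> (\<integral>x. norm (f (i, x) y) \<partial>M)" by (rule integral_norm_bound)
    also have "\<dots> \<le> (\<integral>x. c * exp (n * L * (norm y)\<^sup>2) \<partial>M)"
      using int c[OF i] by (intro integral_mono) auto
    also have "\<dots> = c * exp (n * L * (norm y)\<^sup>2)" by (simp add: prob_space)
    finally show "norm (\<integral>x. f (i, x) y \<partial>M) \<le> c * exp (n * L * (norm y)\<^sup>2)" .
  qed
qed

section \<open>Densities with Lipschitz score\<close>

locale lip_score =
  fixes p :: "'a::euclidean_space \<Rightarrow> real" and gp :: "'a \<Rightarrow> 'a" and L :: real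
  assumes p_dens: "prob_density p"
    and p_pos: "\<And>x. 0 < p x"
    and score: "\<And>x. GDERIV (\<lambda>y. ln (p y)) x :> gp x"
    and lip: "\<And>x y. norm (gp x - gp y) \<le> L * norm (x - y)"
    and L_ge: "1 \<le> L"
begin

lemma p_measurable [measurable]: "p \<in> borel_measurable borel"
  using p_dens by (simp add: prob_density_def)

lemma gp_measurable [measurable]: "gp \<in> borel_measurable borel"
proof -
  have "L-lipschitz_on UNIV gp"
    using lip L_ge by (intro lipschitz_onI) (auto simp: dist_norm)
  hence "continuous_on UNIV gp" by (rule lipschitz_on_continuous_on)
  thus ?thesis by (rule borel_measurable_continuous_onI)
qed

text \<open>Mean value inequality for \<open>ln p\<close> minus its linear part at \<open>x\<close>,
  on the ball around \<open>x\<close> through \<open>y\<close>, where the gradient of this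
  difference is at most \<open>L * norm (y - x)\<close>. The sharper constant \<open>L / 2\<close>
  would require integration along the segment.\<close>

lemma ln_p_diff: "\<bar>ln (p y) - ln (p x) - (y - x) \<bullet> gp x\<bar> \<le> L * (norm (y - x))\<^sup>2"
proof -
  define B where "B = cball x (norm (y - x))"
  have "norm ((ln (p y) - y \<bullet> gp x) - (ln (p x) - x \<bullet> gp x)) \<le> (L * norm (y - x)) * norm (y - x)"
  proof (rule differentiable_bound[where S=B and f'="\<lambda>u h. h \<bullet> gp u - h \<bullet> gp x"])
    show "((\<lambda>u. ln (p u) - u \<bullet> gp x) has_derivative (\<lambda>h. h \<bullet> gp u - h \<bullet> gp x)) (at u within B)" for u
      by (rule has_derivative_at_withinI)
        (rule has_derivative_diff[OF score[unfolded gderiv_def] has_derivative_inner_left[OF has_derivative_ident]])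
    show "onorm (\<lambda>h. h \<bullet> gp u - h \<bullet> gp x) \<le> L * norm (y - x)" if "u \<in> B" for u
    proof (rule onorm_le)
      fix h
      have "norm (h \<bullet> gp u - h \<bullet> gp x) \<le> norm h * norm (gp u - gp x)"
        using Cauchy_Schwarz_ineq2[of h "gp u - gp x"] by (simp add: inner_diff_right)
      also have "\<dots> \<le> norm h * (L * norm (y - x))"
      proof (rule mult_left_mono)
        have "norm (gp u - gp x) \<le> L * norm (u - x)" by (rule lip)
        also have "\<dots> \<le> L * norm (y - x)"
          using that L_ge by (intro mult_left_mono) (auto simp: B_def dist_norm norm_minus_commute)
        finally show "norm (gp u - gp x) \<le> L * norm (y - x)" .
      qed simp
      finally show "norm (h \<bullet> gp u - h \<bullet> gp x) \<le> L * norm (y - x) * norm h" by (simp add: mult.commute)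
    qed
  qed (auto simp: B_def dist_norm norm_minus_commute)
  thus ?thesis by (simp add: inner_diff_left power2_eq_square algebra_simps)
qed

text \<open>This serves twice: at \<open>x = 0\<close> it bounds the growth of \<open>1 / p\<close>
  at infinity, and for general \<open>x\<close> it compares the weights at the two ends of a short
  step.\<close>

lemma inverse_p_le: "1 / p y \<le> 1 / p x * exp (norm (gp x) * norm (y - x) + L * (norm (y - x))\<^sup>2)"
proof -
  have 1: "ln (p x) - ln (p y) \<le> - ((y - x) \<bullet> gp x) + L * (norm (y - x))\<^sup>2"
    using ln_p_diff[of y x] by linarith
  have "- ((y - x) \<bullet> gp x) \<le> norm (gp x) * norm (y - x)"
    using Cauchy_Schwarz_ineq2[of "y - x" "gp x"] by (simp add: mult.commute)
  with 1 have "exp (ln (p x) - ln (p y)) \<le> exp (norm (gp x) * norm (y - x) + L * (norm (y - x))\<^sup>2)" by simp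
  moreover have "exp (ln (p x) - ln (p y)) = p x / p y" by (simp add: exp_diff p_pos)
  ultimately show ?thesis using p_pos[of x] p_pos[of y] by (simp add: field_simps)
qed

lemma inverse_p_dom: "expdom L I 2 (\<lambda>i y. 1 / p y)"
proof (rule expdomI[where c="1 / p 0 * exp ((norm (gp 0))\<^sup>2)"])
  fix i and y :: 'a
  \<comment> \<open>The linear term is traded for a constant and one further multiple of
    \<open>|y|^2\<close>; hence the exponent 2 instead of 1.\<close>
  have gy: "norm (gp 0) * norm y \<le> (norm (gp 0))\<^sup>2 + (norm y)\<^sup>2"
    using sum_squares_bound[of "norm (gp 0)" "norm y"] mult_nonneg_nonneg[OF norm_ge_zero[of "gp 0"] norm_ge_zero[of y]]
    by linarith
  have "(norm y)\<^sup>2 \<le> L * (norm y)\<^sup>2" using L_ge mult_right_mono[of 1 L "(norm y)\<^sup>2"] by simp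
  with gy have le: "norm (gp 0) * norm y + L * (norm y)\<^sup>2 \<le> (norm (gp 0))\<^sup>2 + 2 * L * (norm y)\<^sup>2" by linarith
  have "1 / p y \<le> 1 / p 0 * exp (norm (gp 0) * norm y + L * (norm y)\<^sup>2)"
    using inverse_p_le[of y 0] by simp
  also have "\<dots> \<le> 1 / p 0 * exp ((norm (gp 0))\<^sup>2 + 2 * L * (norm y)\<^sup>2)"
    using le p_pos[of 0] by (intro mult_left_mono) auto
  finally show "norm (1 / p y) \<le> 1 / p 0 * exp ((norm (gp 0))\<^sup>2) * exp (2 * L * (norm y)\<^sup>2)"
    using p_pos[of y] by (simp add: exp_add)
qed

lemma gp_dom: "expdom L I 1 (\<lambda>i y. gp y)"
proof -
  have "expdom L I 1 (\<lambda>i (y::'a). L *\<^sub>R y)"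
    using expdom_scaleR[OF expdom_bounded[of I "\<lambda>_. L" L] expdom_ident[OF L_ge]] L_ge by simp
  hence "expdom L I 1 (\<lambda>i y. gp y - gp 0)"
    by (rule expdom_bound) (use lip[of _ 0] L_ge in auto)
  hence "expdom L I (max 1 0) (\<lambda>i y. (gp y - gp 0) + gp 0)"
    using L_ge by (intro expdom_add expdom_bounded[where c="norm (gp 0)"]) auto
  thus ?thesis by simp
qed

lemma GDERIV_p: "GDERIV p x :> p x *\<^sub>R gp x"
  using GDERIV_DERIV_compose[OF score[of x] DERIV_exp] p_pos by simp

lemma GDERIV_inverse_p: "GDERIV (\<lambda>y. 1 / p y) x :> - (1 / p x) *\<^sub>R gp x"
proof -
  have "GDERIV (\<lambda>y. inverse (p y)) x :> - (inverse (p x))\<^sup>2 *\<^sub>R (p x *\<^sub>R gp x)"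
    using GDERIV_inverse[OF GDERIV_p] p_pos[of x] by simp
  thus ?thesis using p_pos[of x] by (simp add: inverse_eq_divide power2_eq_square)
qed

end

text \<open>\<open>X\<close> is the position at the start of a step and \<open>V\<close> the drift frozen there; they are bounded because
  the initial law will be truncated. \<open>k t x\<close> is the transition density after time \<open>t\<close>, \<open>q t\<close> the resulting
  density with gradient \<open>dq t\<close>, and \<open>r t\<close> is the gradient of \<open>ln (\<psi> t)\<close>.\<close>
locale lmc_interp = lip_score p gp L + prob_space M
  for p :: "'a::euclidean_space \<Rightarrow> real" and gp L and M :: "'b measure" +
  fixes X V :: "'b \<Rightarrow> 'a" and R T :: real
  assumes X_meas [measurable]: "X \<in> borel_measurable M"
    and V_meas [measurable]: "V \<in> borel_measurable M"
    and X_bd: "\<And>x. norm (X x) \<le> R"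
    and V_bd: "\<And>x. norm (V x) \<le> R"
    and T_pos: "0 < T" and T_le: "T \<le> 1" and LT: "240 * L * T \<le> 1"
begin

sublocale P: pair_sigma_finite M "lborel :: 'a measure" ..

definition z where "z t x y = y - (X x + t *\<^sub>R V x)"
definition k where "k t x y = gauss_density (X x + t *\<^sub>R V x) (2 * t) y"
definition q where "q t y = (\<integral>x. k t x y \<partial>M)"
definition dq where "dq t y = (\<integral>x. - (k t x y / (2 * t)) *\<^sub>R z t x y \<partial>M)"
definition \<psi> where "\<psi> t y = q t y * (1 / p y)"
definition r where "r t y = dq t y /\<^sub>R q t y - gp y"
definition \<rho> where "\<rho> t x y = \<psi> t y * k t x y"

section \<open>Growth and derivatives of the interpolated density\<close>

lemma z_measurable [measurable (raw)]:
  assumes [measurable]: "f \<in> N \<rightarrow>\<^sub>M M" "g \<in> borel_measurable N"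
  shows "(\<lambda>w. z t (f w) (g w)) \<in> borel_measurable N"
  unfolding z_def by measurable

lemma k_measurable [measurable (raw)]:
  assumes [measurable]: "f \<in> N \<rightarrow>\<^sub>M M" "g \<in> borel_measurable N"
  shows "(\<lambda>w. k t (f w) (g w)) \<in> borel_measurable N"
  unfolding k_def by measurable

lemma q_measurable [measurable]: "q t \<in> borel_measurable borel"
  unfolding q_def[abs_def] by measurable

lemma dq_measurable [measurable]: "dq t \<in> borel_measurable borel"
  unfolding dq_def[abs_def] by measurable

lemma r_measurable [measurable]: "r t \<in> borel_measurable borel"
  unfolding r_def[abs_def] by measurable

lemma \<psi>_measurable [measurable]: "\<psi> t \<in> borel_measurable borel"
  unfolding \<psi>_def[abs_def] by measurable

lemma R_nonneg: "0 \<le> R" using X_bd norm_ge_zero order_trans by blast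

lemma m_bd: "norm (X x + t *\<^sub>R V x) \<le> 2 * R" if "0 \<le> t" "t \<le> T"
proof -
  have "norm (t *\<^sub>R V x) \<le> 1 * R"
    using that T_le V_bd[of x] by (simp only: norm_scaleR) (intro mult_mono; simp)
  thus ?thesis using norm_triangle_ineq[of "X x" "t *\<^sub>R V x"] X_bd[of x] by linarith
qed

lemma z_bd: "norm (z t x y) \<le> norm y + 2 * R" if "0 \<le> t" "t \<le> T"
  using norm_triangle_ineq4[of y "X x + t *\<^sub>R V x"] m_bd[OF that, of x] unfolding z_def by linarith

lemma z_dom: "expdom L ({0..T} \<times> UNIV) 1 (\<lambda>i y. z (fst i) (snd i) y)"
proof -
  have "expdom L ({0..T} \<times> UNIV) (max 1 0) (\<lambda>i y. y - (X (snd i) + fst i *\<^sub>R V (snd i)))"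
    using L_ge by (intro expdom_diff expdom_ident expdom_bounded[where c="2 * R"]) (auto intro: m_bd)
  thus ?thesis by (simp add: z_def)
qed

lemma k_nonneg: "0 \<le> k t x y" by (simp add: k_def gauss_density_nonneg)

lemma k_pos: "0 < t \<Longrightarrow> 0 < k t x y" by (simp add: k_def gauss_density_pos)

text \<open>From \<open>|y - m|^2 \<ge> |y|^2 / 2 - |m|^2\<close> the exponent
  \<open>- |y - m|^2 / (4 * t)\<close> is at most \<open>- |y|^2 / (8 * t)\<close> plus a constant,
  and \<open>240 * L * T \<le> 1\<close> is exactly \<open>1 / (8 * t) \<ge> 30 * L\<close> at the
  final time. Times are kept above \<open>t0\<close> because both the normalising factor and the
  constant \<open>R^2 / t\<close> blow up at zero.\<close>

lemma k_dom:
  assumes t0: "0 < t0"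
  shows "expdom L ({t0..T} \<times> UNIV) (-30) (\<lambda>i y. k (fst i) (snd i) y)"
proof (rule expdomI[where c="(1 / (2 * pi * (2 * t0))) powr (real DIM('a) / 2) * exp (R\<^sup>2 / t0)"])
  fix i and y :: 'a assume i: "i \<in> {t0..T} \<times> (UNIV :: 'b set)"
  obtain t x where tx: "i = (t, x)" by (cases i)
  have t: "t0 \<le> t" "t \<le> T" "0 < t" using i t0 by (auto simp: tx)
  define m where "m = X x + t *\<^sub>R V x"
  have m: "norm m \<le> 2 * R" unfolding m_def using m_bd[of t x] t by simp
  have "norm y \<le> norm (y - m) + norm m" by (metis diff_add_cancel norm_triangle_ineq)
  hence "(norm y)\<^sup>2 \<le> (norm (y - m) + norm m)\<^sup>2" by (intro power_mono) auto
  also have "\<dots> \<le> 2 * (norm (y - m))\<^sup>2 + 2 * (norm m)\<^sup>2"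
    using sum_squares_bound[of "norm (y - m)" "norm m"] by (simp add: power2_sum)
  finally have "(norm y)\<^sup>2 \<le> 2 * (norm (y - m))\<^sup>2 + 2 * (norm m)\<^sup>2" .
  moreover have "(norm m)\<^sup>2 \<le> 4 * R\<^sup>2" using power_mono[OF m, of 2] by (simp add: power_mult_distrib)
  ultimately have lower: "(norm y)\<^sup>2 / 2 - 4 * R\<^sup>2 \<le> (norm (y - m))\<^sup>2" by linarith
  have "30 * L * (norm y)\<^sup>2 * (8 * t) \<le> 1 * (norm y)\<^sup>2"
  proof -
    have "240 * L * t \<le> 240 * L * T" using t L_ge by (intro mult_left_mono) auto
    hence "240 * L * t \<le> 1" using LT by linarith
    from mult_right_mono[OF this, of "(norm y)\<^sup>2"] show ?thesis by (simp add: algebra_simps)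
  qed
  hence y1: "30 * L * (norm y)\<^sup>2 \<le> (norm y)\<^sup>2 / (8 * t)" using t by (simp add: field_simps)
  have R1: "R\<^sup>2 / t \<le> R\<^sup>2 / t0" using t t0 by (intro divide_left_mono) auto
  have "- (norm (y - m))\<^sup>2 / (2 * (2 * t)) \<le> - ((norm y)\<^sup>2 / 2 - 4 * R\<^sup>2) / (2 * (2 * t))"
    using lower t by (intro divide_right_mono) auto
  also have "\<dots> = - (norm y)\<^sup>2 / (8 * t) + R\<^sup>2 / t" using t by (simp add: field_simps)
  also have "\<dots> \<le> R\<^sup>2 / t0 + - 30 * L * (norm y)\<^sup>2" using y1 R1 by linarith
  finally have e: "exp (- (norm (y - m))\<^sup>2 / (2 * (2 * t))) \<le> exp (R\<^sup>2 / t0) * exp (- 30 * L * (norm y)\<^sup>2)"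
    unfolding exp_add[symmetric] by simp
  have pw: "(1 / (2 * pi * (2 * t))) powr (real DIM('a) / 2) \<le> (1 / (2 * pi * (2 * t0))) powr (real DIM('a) / 2)"
    using t t0 by (intro powr_mono2 divide_left_mono) auto
  have "norm (k (fst i) (snd i) y) = (1 / (2 * pi * (2 * t))) powr (real DIM('a) / 2) * exp (- (norm (y - m))\<^sup>2 / (2 * (2 * t)))"
    using t by (simp add: tx k_def gauss_density_def m_def abs_mult)
  also have "\<dots> \<le> (1 / (2 * pi * (2 * t0))) powr (real DIM('a) / 2) * (exp (R\<^sup>2 / t0) * exp (- 30 * L * (norm y)\<^sup>2))"
    using pw e by (intro mult_mono) auto
  finally show "norm (k (fst i) (snd i) y) \<le> (1 / (2 * pi * (2 * t0))) powr (real DIM('a) / 2) * exp (R\<^sup>2 / t0) * exp (- 30 * L * (norm y)\<^sup>2)"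
    by (simp add: mult.assoc)
qed

lemma q_dom: assumes t0: "0 < t0" shows "expdom L {t0..T} (-30) q"
  unfolding q_def[abs_def]
  using expdom_integral[OF expdom_reindex[OF k_dom[OF t0], of "{t0..T} \<times> space M" "\<lambda>i. i"]] by auto

lemma dk_dom:
  assumes t0: "0 < t0"
  shows "expdom L ({t0..T} \<times> UNIV) (-29) (\<lambda>i y. - (k (fst i) (snd i) y / (2 * fst i)) *\<^sub>R z (fst i) (snd i) y)"
proof -
  have 1: "expdom L ({t0..T} \<times> UNIV) 0 (\<lambda>i (y::'a). - 1 / (2 * fst (i :: real \<times> 'b)))"
    by (rule expdom_bounded[where c="1 / (2 * t0)"]) (use t0 in \<open>auto simp: field_simps\<close>)
  have 2: "expdom L ({t0..T} \<times> UNIV) 1 (\<lambda>i y. z (fst i) (snd i) y)"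
    by (rule expdom_reindex[OF z_dom]) (use t0 in auto)
  show ?thesis
    using expdom_scaleR[OF expdom_mult[OF 1 k_dom[OF t0]] 2] by simp
qed

lemma k_integrable: "0 < t \<Longrightarrow> t \<le> T \<Longrightarrow> integrable M (\<lambda>x. k t x y)"
  by (rule expdom_integrable_slice[OF expdom_reindex[OF k_dom[of t], of "space M" "\<lambda>x. (t, x)", simplified]]) auto

lemma dk_integrable: "0 < t \<Longrightarrow> t \<le> T \<Longrightarrow> integrable M (\<lambda>x. - (k t x y / (2 * t)) *\<^sub>R z t x y)"
  by (rule expdom_integrable_slice[OF expdom_reindex[OF dk_dom[of t], of "space M" "\<lambda>x. (t, x)", unfolded fst_conv snd_conv]]) auto

lemma q_pos:
  assumes t: "0 < t" "t \<le> T" shows "0 < q t y"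
proof -
  have "q t y \<noteq> 0"
  proof
    assume "q t y = 0"
    hence "AE x in M. k t x y = 0"
      unfolding q_def using integral_nonneg_eq_0_iff_AE[OF k_integrable[OF t]] k_nonneg by auto
    hence "AE x in M. False" by eventually_elim (use k_pos[OF t(1)] in \<open>simp add: less_imp_neq[symmetric]\<close>)
    thus False by simp
  qed
  moreover have "0 \<le> q t y" unfolding q_def by (simp add: k_nonneg)
  ultimately show ?thesis by simp
qed

lemma GDERIV_q:
  assumes t: "0 < t" "t \<le> T" shows "GDERIV (q t) y :> dq t y"
proof -
  from dk_dom[OF t(1)] obtain c where c: "0 \<le> c" "\<And>i y. i \<in> {t..T} \<times> UNIV \<Longrightarrow>
      norm (- (k (fst i) (snd i) y / (2 * fst i)) *\<^sub>R z (fst i) (snd i) y) \<le> c * exp (- 29 * L * (norm y)\<^sup>2)"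
    by (rule expdomE) blast
  show ?thesis
    unfolding q_def[abs_def] dq_def
  proof (rule GDERIV_integral[where e=1 and w="\<lambda>_. c"])
    show "GDERIV (\<lambda>y. k t x y) y :> - (k t x y / (2 * t)) *\<^sub>R z t x y" for x y
      unfolding k_def z_def by (rule GDERIV_gauss_density)
    show "norm (- (k t x y / (2 * t)) *\<^sub>R z t x y) \<le> c" for x y
    proof -
      have "c * exp (- 29 * L * (norm y)\<^sup>2) \<le> c * 1"
        using c(1) L_ge by (intro mult_left_mono) auto
      thus ?thesis using c(2)[of "(t, x)" y] t by simp
    qed
  qed (use k_integrable[OF t] in auto)
qed

text \<open>\<open>dq / q\<close> is the mean of \<open>- z / (2 * t)\<close> over starting points
  weighted by \<open>k\<close>, and \<open>z\<close> grows linearly in \<open>y\<close> uniformly in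
  the starting point. The quotient is thus controlled although \<open>q\<close> has no convenient
  lower bound.\<close>

lemma r_dom:
  assumes t: "0 < t" "t \<le> T" shows "expdom L I 1 (\<lambda>i y. r t y)"
proof -
  have dq_le: "norm (dq t y) \<le> ((norm y + 2 * R) / (2 * t)) * q t y" for y
  proof -
    have "norm (dq t y) \<le> (\<integral>x. norm (- (k t x y / (2 * t)) *\<^sub>R z t x y) \<partial>M)"
      unfolding dq_def by (rule integral_norm_bound)
    also have "\<dots> \<le> (\<integral>x. ((norm y + 2 * R) / (2 * t)) * k t x y \<partial>M)"
    proof (rule integral_mono)
      show "integrable M (\<lambda>x. norm (- (k t x y / (2 * t)) *\<^sub>R z t x y))"
        by (rule integrable_norm[OF dk_integrable[OF t]])
      show "norm (- (k t x y / (2 * t)) *\<^sub>R z t x y) \<le> ((norm y + 2 * R) / (2 * t)) * k t x y" for x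
        using mult_left_mono[OF z_bd[of t x y], of "k t x y / (2 * t)"] k_nonneg[of t x y] t
        by (simp add: abs_mult field_simps)
    qed (use k_integrable[OF t] in simp)
    also have "\<dots> = ((norm y + 2 * R) / (2 * t)) * q t y"
      unfolding q_def using k_integrable[OF t] by simp
    finally show ?thesis .
  qed
  have "expdom L I (0 + max 1 0) (\<lambda>i (y::'a). (1 / (2 * t)) * (norm y + 2 * R))"
    using L_ge expdom_ident[OF L_ge, of I] R_nonneg
    by (intro expdom_mult expdom_add expdom_bounded[where c="1 / (2 * t)"] expdom_bounded[where c="2 * R"])
       (auto simp: expdom_def t less_imp_le)
  hence "expdom L I 1 (\<lambda>i (y::'a). (1 / (2 * t)) * (norm y + 2 * R))" by simp
  hence "expdom L I 1 (\<lambda>i y. dq t y /\<^sub>R q t y)"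
  proof (rule expdom_bound)
    fix y
    have "norm (dq t y /\<^sub>R q t y) = norm (dq t y) / q t y"
      using q_pos[OF t, of y] by (simp add: divide_inverse)
    also have "\<dots> \<le> (norm y + 2 * R) / (2 * t)"
      using dq_le[of y] q_pos[OF t, of y] by (simp add: pos_divide_le_eq)
    finally show "norm (dq t y /\<^sub>R q t y) \<le> norm ((1 / (2 * t)) * (norm y + 2 * R))"
      using t R_nonneg by simp
  qed
  hence "expdom L I (max 1 1) (\<lambda>i y. r t y)"
    unfolding r_def using L_ge by (intro expdom_diff gp_dom) auto
  thus ?thesis by simp
qed

lemma \<psi>_pos: "0 < t \<Longrightarrow> t \<le> T \<Longrightarrow> 0 < \<psi> t y"
  using q_pos p_pos by (simp add: \<psi>_def)

lemma GDERIV_\<psi>: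
  assumes t: "0 < t" "t \<le> T" shows "GDERIV (\<psi> t) y :> \<psi> t y *\<^sub>R r t y"
proof -
  have "GDERIV (\<psi> t) y :> q t y *\<^sub>R (- (1 / p y) *\<^sub>R gp y) + (1 / p y) *\<^sub>R dq t y"
    unfolding \<psi>_def[abs_def] by (rule GDERIV_mult[OF GDERIV_q[OF t] GDERIV_inverse_p])
  moreover have "q t y *\<^sub>R (- (1 / p y) *\<^sub>R gp y) + (1 / p y) *\<^sub>R dq t y = \<psi> t y *\<^sub>R r t y"
    unfolding \<psi>_def r_def using q_pos[OF t, of y] by (simp add: algebra_simps)
  ultimately show ?thesis by simp
qed

lemma \<psi>_dom: "0 < t \<Longrightarrow> t \<le> T \<Longrightarrow> expdom L I (-28) (\<lambda>i y. \<psi> t y)"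
  using expdom_mult[OF expdom_reindex[OF q_dom[of t], of I "\<lambda>_. t"] inverse_p_dom] by (simp add: \<psi>_def)

lemma \<rho>_dom: 
  assumes t: "0 < t" "t \<le> T" shows "expdom L UNIV (-58) (\<rho> t)"
  using expdom_mult[OF \<psi>_dom[OF t] expdom_reindex[OF k_dom[OF t(1)], of UNIV "\<lambda>x. (t, x)", simplified]] t
  by (simp add: \<rho>_def[abs_def])

lemma \<rho>_nonneg: "0 < t \<Longrightarrow> t \<le> T \<Longrightarrow> 0 \<le> \<rho> t x y"
  unfolding \<rho>_def using \<psi>_pos k_nonneg by (simp add: less_imp_le)

lemma \<rho>_measurable [measurable (raw)]:
  assumes [measurable]: "f \<in> N \<rightarrow>\<^sub>M M" "g \<in> borel_measurable N"
  shows "(\<lambda>w. \<rho> t (f w) (g w)) \<in> borel_measurable N"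
  unfolding \<rho>_def by measurable

text \<open>For a fixed starting point the logarithmic gradient of \<open>\<rho>\<close> is
  \<open>r - z / (2 * t)\<close>; the claim is the radial identity for \<open>\<rho>\<close> about
  \<open>c\<close>.\<close>

lemma \<rho>_parts:
  assumes t: "0 < t" "t \<le> T"
  shows "(\<integral>y. \<rho> t x y * (r t y \<bullet> (y - c) - (z t x y \<bullet> (y - c)) / (2 * t) + DIM('a)) \<partial>lborel) = 0"
proof -
  have der: "GDERIV (\<rho> t x) y :> \<rho> t x y *\<^sub>R (r t y - (1 / (2 * t)) *\<^sub>R z t x y)" for y
  proof -
    have "GDERIV (k t x) y :> - (k t x y / (2 * t)) *\<^sub>R z t x y"
      unfolding k_def[abs_def] z_def by (rule GDERIV_gauss_density)
    from GDERIV_mult[OF GDERIV_\<psi>[OF t] this]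
    show ?thesis unfolding \<rho>_def[abs_def] by (simp add: algebra_simps)
  qed
  have kx: "expdom L {()} (-58) (\<lambda>_. \<rho> t x)" by (rule expdom_reindex[OF \<rho>_dom[OF t]]) simp
  have zx: "expdom L {()} 1 (\<lambda>_ y. z t x y)"
    using expdom_reindex[OF z_dom, of "{()}" "\<lambda>_. (t, x)"] t by simp
  have "expdom L {()} (- 58 + max 1 (0 + 1)) (\<lambda>_ y. \<rho> t x y *\<^sub>R (r t y - (1 / (2 * t)) *\<^sub>R z t x y))"
    using L_ge t by (intro expdom_scaleR expdom_diff kx r_dom zx expdom_bounded[where c="1 / (2 * t)"]) auto
  hence dom: "expdom L {()} (-57) (\<lambda>_ y. \<rho> t x y *\<^sub>R (r t y - (1 / (2 * t)) *\<^sub>R z t x y))" by simp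
  have [measurable]: "z t x \<in> borel_measurable borel" "\<rho> t x \<in> borel_measurable borel"
    unfolding z_def[abs_def] \<rho>_def[abs_def] k_def by measurable
  have "(\<integral>y. (\<rho> t x y *\<^sub>R (r t y - (1 / (2 * t)) *\<^sub>R z t x y)) \<bullet> (y - c) + DIM('a) * \<rho> t x y \<partial>lborel) = 0"
    by (rule integral_radial_derivative[OF L_ge der kx _ dom]) auto
  moreover have "(\<rho> t x y *\<^sub>R (r t y - (1 / (2 * t)) *\<^sub>R z t x y)) \<bullet> (y - c) + DIM('a) * \<rho> t x y
      = \<rho> t x y * (r t y \<bullet> (y - c) - (z t x y \<bullet> (y - c)) / (2 * t) + DIM('a))" for y
    by (simp add: inner_diff_left distrib_left right_diff_distrib)
  ultimately show ?thesis by (simp only:)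
qed

end

subsection \<open>Energy identities for the interpolated law\<close>

context lmc_interp
begin

text \<open>The weight \<open>\<rho>\<close> has exponent -58, so integrands of growth 2 are
  harmless. This covers the inner product of any two vector fields of growth 1, the class
  \<open>vadm\<close> defined next, which contains \<open>gp\<close>, \<open>r\<close>,
  \<open>z\<close>, \<open>X\<close> and \<open>V\<close>.\<close>

definition adm :: "('b \<Rightarrow> 'a \<Rightarrow> real) \<Rightarrow> bool" where
  "adm f \<longleftrightarrow> case_prod f \<in> borel_measurable (M \<Otimes>\<^sub>M lborel) \<and> expdom L UNIV 2 f"

definition vadm :: "('b \<Rightarrow> 'a \<Rightarrow> 'a) \<Rightarrow> bool" where
  "vadm f \<longleftrightarrow> case_prod f \<in> borel_measurable (M \<Otimes>\<^sub>M lborel) \<and> expdom L UNIV 1 f"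

definition J :: "real \<Rightarrow> ('b \<Rightarrow> 'a \<Rightarrow> real) \<Rightarrow> real" where
  "J t f = (\<integral>(x, y). \<rho> t x y * f x y \<partial>(M \<Otimes>\<^sub>M lborel))"

lemma J_integrable:
  assumes t: "0 < t" "t \<le> T" and f: "adm f"
  shows "integrable (M \<Otimes>\<^sub>M lborel) (\<lambda>(x, y). \<rho> t x y * f x y)"
proof -
  have [measurable]: "case_prod f \<in> borel_measurable (M \<Otimes>\<^sub>M lborel)" using f by (simp add: adm_def)
  have "expdom L UNIV (- 58 + 2) (\<lambda>x y. \<rho> t x y * f x y)"
    using f by (intro expdom_mult \<rho>_dom[OF t]) (simp add: adm_def)
  hence "expdom L (space M) (- 56) (\<lambda>x y. \<rho> t x y * f x y)"
    using expdom_reindex[of L UNIV "- 56" _ "space M" "\<lambda>x. x"] by simp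
  thus ?thesis
    by (rule expdom_integrable_pair) (use L_ge in \<open>auto simp: split_beta\<close>)
qed

lemma J_fst: "0 < t \<Longrightarrow> t \<le> T \<Longrightarrow> adm f \<Longrightarrow> J t f = (\<integral>x. \<integral>y. \<rho> t x y * f x y \<partial>lborel \<partial>M)"
  unfolding J_def by (rule P.integral_fst[symmetric, OF J_integrable])

lemma J_snd: "0 < t \<Longrightarrow> t \<le> T \<Longrightarrow> adm f \<Longrightarrow> J t f = (\<integral>y. \<integral>x. \<rho> t x y * f x y \<partial>M \<partial>lborel)"
  unfolding J_def by (rule P.integral_snd[symmetric, OF J_integrable])

lemma J_add: "0 < t \<Longrightarrow> t \<le> T \<Longrightarrow> adm f \<Longrightarrow> adm g \<Longrightarrow> J t (\<lambda>x y. f x y + g x y) = J t f + J t g"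
  using Bochner_Integration.integral_add[OF J_integrable[of t f] J_integrable[of t g]]
  by (simp add: J_def case_prod_beta' distrib_left)

lemma J_diff: "0 < t \<Longrightarrow> t \<le> T \<Longrightarrow> adm f \<Longrightarrow> adm g \<Longrightarrow> J t (\<lambda>x y. f x y - g x y) = J t f - J t g"
  using Bochner_Integration.integral_diff[OF J_integrable[of t f] J_integrable[of t g]]
  by (simp add: J_def case_prod_beta' right_diff_distrib)

lemma J_cmult: "J t (\<lambda>x y. c * f x y) = c * J t f"
  unfolding J_def integral_mult_right_zero[symmetric] by (rule Bochner_Integration.integral_cong) auto

lemma J_mono:
  assumes t: "0 < t" "t \<le> T" and "adm f" "adm g" and le: "\<And>x y. f x y \<le> g x y"
  shows "J t f \<le> J t g"
  unfolding J_def
  by (rule integral_mono[OF J_integrable[OF t] J_integrable[OF t]])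
     (use assms \<rho>_nonneg[OF t] in \<open>auto intro!: mult_left_mono\<close>)

lemma adm_inner: assumes "vadm f" "vadm g" shows "adm (\<lambda>x y. f x y \<bullet> g x y)"
proof -
  have [measurable]: "case_prod f \<in> borel_measurable (M \<Otimes>\<^sub>M lborel)" "case_prod g \<in> borel_measurable (M \<Otimes>\<^sub>M lborel)"
    using assms by (auto simp: vadm_def)
  show ?thesis using assms expdom_inner[of L UNIV 1 f 1 g] by (auto simp: adm_def vadm_def split_beta)
qed

lemma adm_norm_sq: "vadm f \<Longrightarrow> adm (\<lambda>x y. (norm (f x y))\<^sup>2)"
  unfolding power2_norm_eq_inner by (rule adm_inner)

lemma adm_const: "adm (\<lambda>x y. c)"
  unfolding adm_def using L_ge expdom_mono[OF expdom_bounded[of UNIV "\<lambda>_. c" "\<bar>c\<bar>" L], of 2] by auto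

lemma adm_add: assumes "adm f" "adm g" shows "adm (\<lambda>x y. f x y + g x y)"
proof -
  have [measurable]: "case_prod f \<in> borel_measurable (M \<Otimes>\<^sub>M lborel)" "case_prod g \<in> borel_measurable (M \<Otimes>\<^sub>M lborel)"
    using assms by (auto simp: adm_def)
  show ?thesis using assms L_ge expdom_add[of L UNIV 2 f 2 g] by (auto simp: adm_def split_beta)
qed

lemma adm_cmult: assumes "adm f" shows "adm (\<lambda>x y. c * f x y)"
proof -
  have [measurable]: "case_prod f \<in> borel_measurable (M \<Otimes>\<^sub>M lborel)"
    using assms by (auto simp: adm_def)
  show ?thesis using assms expdom_cmult[of L UNIV 2 f c] by (auto simp: adm_def split_beta)
qed

lemma adm_diff: "adm f \<Longrightarrow> adm g \<Longrightarrow> adm (\<lambda>x y. f x y - g x y)"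
  using adm_add[OF _ adm_cmult[of g "-1"]] by simp

lemma vadm_add: assumes "vadm f" "vadm g" shows "vadm (\<lambda>x y. f x y + g x y)"
proof -
  have [measurable]: "case_prod f \<in> borel_measurable (M \<Otimes>\<^sub>M lborel)" "case_prod g \<in> borel_measurable (M \<Otimes>\<^sub>M lborel)"
    using assms by (auto simp: vadm_def)
  show ?thesis using assms L_ge expdom_add[of L UNIV 1 f 1 g] by (auto simp: vadm_def split_beta)
qed

lemma vadm_scaleR: assumes "vadm f" shows "vadm (\<lambda>x y. c *\<^sub>R f x y)"
proof -
  have [measurable]: "case_prod f \<in> borel_measurable (M \<Otimes>\<^sub>M lborel)"
    using assms by (auto simp: vadm_def)
  show ?thesis using assms expdom_scaleR[OF expdom_bounded[of UNIV "\<lambda>_. c" "\<bar>c\<bar>"], of L 1 f] by (auto simp: vadm_def split_beta)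
qed

lemma vadm_diff: "vadm f \<Longrightarrow> vadm g \<Longrightarrow> vadm (\<lambda>x y. f x y - g x y)"
  using vadm_add[OF _ vadm_scaleR[of g "-1"]] by simp

lemma vadm_bounded:
  assumes [measurable]: "f \<in> borel_measurable M" and "\<And>x. norm (f x) \<le> c"
  shows "vadm (\<lambda>x y. f x)"
  unfolding vadm_def using L_ge expdom_mono[OF expdom_bounded[of UNIV f c L], of 1] assms by (auto simp: split_beta)

lemma vadm_ident: "vadm (\<lambda>x y. y)"
  unfolding vadm_def using expdom_ident[OF L_ge] by (auto simp: split_beta)

lemma vadm_gp: "vadm (\<lambda>x y. gp y)"
  unfolding vadm_def using gp_dom by (auto simp: split_beta)

lemma vadm_r: "0 < t \<Longrightarrow> t \<le> T \<Longrightarrow> vadm (\<lambda>x y. r t y)"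
  unfolding vadm_def using r_dom by (auto simp: split_beta)

lemma vadm_X: "vadm (\<lambda>x y. X x)" by (rule vadm_bounded[OF X_meas X_bd])

lemma vadm_V: "vadm (\<lambda>x y. V x)" by (rule vadm_bounded[OF V_meas V_bd])

lemma vadm_z: "vadm (z t)"
  unfolding z_def[abs_def] by (intro vadm_diff vadm_add vadm_scaleR vadm_X vadm_V vadm_ident)

lemmas adms = adm_inner adm_norm_sq adm_const adm_add adm_diff adm_cmult vadm_add vadm_diff vadm_scaleR
  vadm_ident vadm_gp vadm_r vadm_X vadm_V vadm_z

text \<open>Parts in the current point are done separately for each starting point, so the centre
  \<open>c\<close> may depend on the latter; this freedom is what later arguments exploit.\<close>

lemma J_parts:
  assumes t: "0 < t" "t \<le> T" and c: "vadm (\<lambda>x y. c x)"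
  shows "J t (\<lambda>x y. r t y \<bullet> (y - c x)) = J t (\<lambda>x y. (1 / (2 * t)) * (z t x y \<bullet> (y - c x)) - DIM('a))"
proof -
  have "J t (\<lambda>x y. r t y \<bullet> (y - c x) - ((1 / (2 * t)) * (z t x y \<bullet> (y - c x)) - DIM('a))) = 0"
  proof (subst J_fst[OF t])
    show "adm (\<lambda>x y. r t y \<bullet> (y - c x) - ((1 / (2 * t)) * (z t x y \<bullet> (y - c x)) - DIM('a)))"
      by (intro adms t c)
    show "(\<integral>x. \<integral>y. \<rho> t x y * (r t y \<bullet> (y - c x) - ((1 / (2 * t)) * (z t x y \<bullet> (y - c x)) - DIM('a))) \<partial>lborel \<partial>M) = 0"
      using \<rho>_parts[OF t] by (simp add: diff_diff_eq2 diff_add_eq)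
  qed
  moreover have "J t (\<lambda>x y. r t y \<bullet> (y - c x) - ((1 / (2 * t)) * (z t x y \<bullet> (y - c x)) - DIM('a)))
      = J t (\<lambda>x y. r t y \<bullet> (y - c x)) - J t (\<lambda>x y. (1 / (2 * t)) * (z t x y \<bullet> (y - c x)) - DIM('a))"
    by (rule J_diff[OF t]) (intro adms t c)+
  ultimately show ?thesis by simp
qed

text \<open>Tweedie's formula: given the current position, \<open>z\<close> has mean \<open>- 2 * t\<close> times the score of the
  current law, and that score is \<open>gp + r\<close>.\<close>
lemma J_conditional_mean:
  assumes t: "0 < t" "t \<le> T" and \<phi>: "vadm (\<lambda>x y. \<phi> y)"
  shows "J t (\<lambda>x y. \<phi> y \<bullet> ((1 / (2 * t)) *\<^sub>R z t x y + (gp y + r t y))) = 0"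
proof (subst J_snd[OF t])
  show "adm (\<lambda>x y. \<phi> y \<bullet> ((1 / (2 * t)) *\<^sub>R z t x y + (gp y + r t y)))"
    by (intro adms t \<phi>)
  have "(\<integral>x. \<rho> t x y * (\<phi> y \<bullet> ((1 / (2 * t)) *\<^sub>R z t x y + (gp y + r t y))) \<partial>M) = 0" for y
  proof -
    have eq: "\<rho> t x y * (\<phi> y \<bullet> ((1 / (2 * t)) *\<^sub>R z t x y + (gp y + r t y)))
      = \<psi> t y * (\<phi> y \<bullet> (k t x y *\<^sub>R (gp y + r t y) - (- (k t x y / (2 * t)) *\<^sub>R z t x y)))" for x
      by (simp add: \<rho>_def inner_add_right algebra_simps)
    have "(\<integral>x. k t x y *\<^sub>R (gp y + r t y) - (- (k t x y / (2 * t)) *\<^sub>R z t x y) \<partial>M)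
      = q t y *\<^sub>R (gp y + r t y) - dq t y"
      unfolding q_def dq_def using k_integrable[OF t] dk_integrable[OF t]
      by (subst Bochner_Integration.integral_diff) auto
    also have "\<dots> = 0" using q_pos[OF t, of y] by (simp add: r_def)
    finally have 0: "(\<integral>x. k t x y *\<^sub>R (gp y + r t y) - (- (k t x y / (2 * t)) *\<^sub>R z t x y) \<partial>M) = 0" .
    show ?thesis
      unfolding eq integral_mult_right_zero
      using k_integrable[OF t] dk_integrable[OF t] 0
      by (subst integral_inner_right) auto
  qed
  thus "(\<integral>y. \<integral>x. \<rho> t x y * (\<phi> y \<bullet> ((1 / (2 * t)) *\<^sub>R z t x y + (gp y + r t y))) \<partial>M \<partial>lborel) = 0"
    by simp
qed

definition F where "F t = (\<integral>y. q t y * q t y * (1 / p y) \<partial>lborel)"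

text \<open>When the integrand ignores the starting point, averaging \<open>k\<close> turns the
  joint weight into \<open>\<psi> * q\<close>, which is \<open>q * q / p\<close>.\<close>

lemma J_weight:
  assumes t: "0 < t" "t \<le> T" and f: "adm (\<lambda>x y. f y)"
  shows "J t (\<lambda>x y. f y) = (\<integral>y. q t y * q t y * (1 / p y) * f y \<partial>lborel)"
proof -
  have "(\<integral>x. \<rho> t x y * f y \<partial>M) = q t y * q t y * (1 / p y) * f y" for y
    unfolding \<rho>_def using k_integrable[OF t, of y] by (simp add: \<psi>_def q_def mult.commute mult.left_commute)
  thus ?thesis by (subst J_snd[OF t f]) simp
qed

lemma F_eq_J: "0 < t \<Longrightarrow> t \<le> T \<Longrightarrow> F t = J t (\<lambda>x y. 1)"
  using J_weight[of t "\<lambda>_. 1"] adm_const by (simp add: F_def)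

section \<open>Time derivative of the second moment\<close>

definition kdot where
  "kdot t x y = k t x y / (2 * t) * ((z t x y \<bullet> (y - (X x - t *\<^sub>R V x))) / (2 * t) - DIM('a))"

definition qdot where "qdot t y = (\<integral>x. kdot t x y \<partial>M)"

lemma kdot_measurable [measurable (raw)]:
  assumes [measurable]: "f \<in> N \<rightarrow>\<^sub>M M" "g \<in> borel_measurable N"
  shows "(\<lambda>w. kdot t (f w) (g w)) \<in> borel_measurable N"
  unfolding kdot_def by measurable

lemma qdot_measurable [measurable]: "qdot t \<in> borel_measurable borel"
  unfolding qdot_def[abs_def] by measurable

lemma kdot_dom:
  assumes t0: "0 < t0"
  shows "expdom L ({t0..T} \<times> UNIV) (-28) (\<lambda>i y. kdot (fst i) (snd i) y)"
proof -
  let ?I = "{t0..T} \<times> (UNIV :: 'b set)"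
  have 1: "expdom L ?I 0 (\<lambda>i (y::'a). 1 / (2 * fst i))"
    by (rule expdom_bounded[where c="1 / (2 * t0)"]) (use t0 in \<open>auto simp: field_simps\<close>)
  have 2: "expdom L ?I 1 (\<lambda>i y. z (fst i) (snd i) y)"
    by (rule expdom_reindex[OF z_dom]) (use t0 in auto)
  have 3: "expdom L ?I (max 1 0) (\<lambda>i y. y - (X (snd i) - fst i *\<^sub>R V (snd i)))"
  proof (intro expdom_diff expdom_ident expdom_bounded[where c="2 * R"])
    fix i assume i: "i \<in> ?I"
    have "norm (fst i *\<^sub>R V (snd i)) \<le> 1 * R"
      using i t0 T_le V_bd[of "snd i"] by (simp only: norm_scaleR) (intro mult_mono; auto)
    thus "norm (X (snd i) - fst i *\<^sub>R V (snd i)) \<le> 2 * R"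
      using norm_triangle_ineq4[of "X (snd i)" "fst i *\<^sub>R V (snd i)"] X_bd[of "snd i"] by linarith
  qed (use L_ge in auto)
  have "expdom L ?I ((- 30 + 0) + max (0 + (1 + max 1 0)) 0)
    (\<lambda>i y. (k (fst i) (snd i) y * (1 / (2 * fst i))) *
      ((1 / (2 * fst i)) * (z (fst i) (snd i) y \<bullet> (y - (X (snd i) - fst i *\<^sub>R V (snd i)))) - DIM('a)))"
    by (intro expdom_mult[OF expdom_mult[OF k_dom[OF t0] 1] expdom_diff[OF expdom_mult[OF 1 expdom_inner[OF 2 3]]
      expdom_bounded[where c="real DIM('a)"]]]) (use L_ge in auto)
  thus ?thesis by (simp add: kdot_def)
qed

text \<open>Differentiating \<open>q * q / p\<close> produces \<open>2 * \<psi> * kdot\<close>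
  averaged over the starting point. This has the form of the right side of \<open>J_parts\<close>
  with centre \<open>X - t V\<close>, so a single integration by parts brings in
  \<open>r\<close>.\<close>

lemma DERIV_F:
  assumes t: "0 < t" "t < T"
  shows "(F has_real_derivative J t (\<lambda>x y. (1 / t) * (r t y \<bullet> (y - (X x - t *\<^sub>R V x))))) (at t)"
proof -
  define t0 where "t0 = t / 2"
  \<comment> \<open>All times within \<open>e\<close> of \<open>t\<close> stay in
    \<open>[t / 2, T]\<close>, where the kernel bounds are uniform. Positivity of \<open>e\<close>
    uses the strict inequality \<open>t < T\<close>.\<close>
  define e where "e = min (t / 2) (T - t)"
  have t0: "0 < t0" and e: "0 < e" using t by (auto simp: t0_def e_def)
  have ball: "u \<in> {t0..T}" if "u \<in> ball t e" for u
    using that unfolding mem_ball dist_real_def t0_def e_def by (auto simp: min_def abs_if split: if_splits)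
  have ball': "0 < u" "u \<le> T" if "u \<in> ball t e" for u
    using ball[OF that] t0 by auto
  note t' = t(1) less_imp_le[OF t(2)]
  from kdot_dom[OF t0] obtain c where c: "0 \<le> c" "\<And>i y. i \<in> {t0..T} \<times> UNIV \<Longrightarrow>
      norm (kdot (fst i) (snd i) y) \<le> c * exp (- 28 * L * (norm y)\<^sup>2)"
    by (rule expdomE) blast
  have q_der: "((\<lambda>u. q u y) has_real_derivative qdot u y) (at u)" if u: "u \<in> ball t e" for u y
  proof -
    obtain d where d: "0 < d" "ball u d \<subseteq> ball t e"
      using open_contains_ball[of "ball t e"] u by (meson open_ball)
    have "GDERIV (\<lambda>u. \<integral>x. k u x y \<partial>M) u :> (\<integral>x. kdot u x y \<partial>M)"
    proof (rule GDERIV_integral[where w="\<lambda>_. c", OF d(1)])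
      fix v assume "v \<in> ball u d"
      hence v: "v \<in> ball t e" using d by auto
      show "integrable M (\<lambda>x. k v x y)" by (rule k_integrable[OF ball'[OF v]])
      fix x
      show "GDERIV (\<lambda>v. k v x y) v :> kdot v x y"
        unfolding k_def kdot_def z_def gderiv_deriv
        by (rule DERIV_gauss_density_time) (use ball'[OF v] in auto)
      have "c * exp (- 28 * L * (norm y)\<^sup>2) \<le> c * 1"
        using c(1) L_ge by (intro mult_left_mono) auto
      thus "norm (kdot v x y) \<le> c" using c(2)[of "(v, x)" y] ball[OF v] by simp
    qed auto
    thus ?thesis by (simp add: q_def qdot_def)
  qed
  have qdot_dom: "expdom L {t0..T} (-28) qdot"
    unfolding qdot_def[abs_def]
    using expdom_integral[OF expdom_reindex[OF kdot_dom[OF t0], of "{t0..T} \<times> space M" "\<lambda>i. i"]] by auto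
  have g_dom: "expdom L {t0..T} (2 + (- 30 + - 28) + 2) (\<lambda>u y. 2 * (q u y * qdot u y) * (1 / p y))"
    using expdom_mono[OF expdom_mult[OF expdom_cmult[OF expdom_mult[OF q_dom[OF t0] qdot_dom], of 2] inverse_p_dom]] L_ge by simp
  from g_dom obtain b where b: "0 \<le> b" "\<And>u y. u \<in> {t0..T} \<Longrightarrow>
      norm (2 * (q u y * qdot u y) * (1 / p y)) \<le> b * exp ((2 + (- 30 + - 28) + 2) * L * (norm y)\<^sup>2)"
    by (rule expdomE) blast
  have "GDERIV (\<lambda>u. \<integral>y. q u y * q u y * (1 / p y) \<partial>lborel) t :> (\<integral>y. 2 * (q t y * qdot t y) * (1 / p y) \<partial>lborel)"
  proof (rule GDERIV_integral[where w="\<lambda>y. b * exp ((2 + (- 30 + - 28) + 2) * L * (norm y)\<^sup>2)", OF e])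
    fix u assume u: "u \<in> ball t e"
    have "expdom L {()} (- 30 + - 30 + 2) (\<lambda>_ y. q u y * q u y * (1 / p y))"
      by (intro expdom_mult inverse_p_dom expdom_reindex[OF q_dom[OF t0]] ball[OF u])
    thus "integrable lborel (\<lambda>y. q u y * q u y * (1 / p y))"
      by (rule expdom_integrable) (use L_ge in auto)
    fix y :: 'a
    show "GDERIV (\<lambda>u. q u y * q u y * (1 / p y)) u :> 2 * (q u y * qdot u y) * (1 / p y)"
      unfolding gderiv_deriv
      by (rule DERIV_cong[OF DERIV_cmult_right[OF DERIV_mult[OF q_der[OF u] q_der[OF u]]]]) simp
    show "norm (2 * (q u y * qdot u y) * (1 / p y)) \<le> b * exp ((2 + (- 30 + - 28) + 2) * L * (norm y)\<^sup>2)"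
      by (rule b(2)[OF ball[OF u]])
  next
    have "integrable lborel (\<lambda>y::'a. b * exp (- (54 * L) * (norm y)\<^sup>2))"
      using L_ge by (intro integrable_mult_right integrable_exp_neg_norm_sq) auto
    thus "integrable lborel (\<lambda>y::'a. b * exp ((2 + (- 30 + - 28) + 2) * L * (norm y)\<^sup>2))" by simp
  qed auto
  hence D: "(F has_real_derivative (\<integral>y. 2 * (q t y * qdot t y) * (1 / p y) \<partial>lborel)) (at t)"
    by (simp add: F_def[abs_def])
  have adm1: "adm (\<lambda>x y. (1 / t) * ((1 / (2 * t)) * (z t x y \<bullet> (y - (X x - t *\<^sub>R V x))) - DIM('a)))"
    by (intro adms t)
  have "2 * (q t y * qdot t y) * (1 / p y) = (\<integral>x. \<rho> t x y * ((1 / t) * ((1 / (2 * t)) * (z t x y \<bullet> (y - (X x - t *\<^sub>R V x))) - DIM('a))) \<partial>M)" for y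
  proof -
    have "\<rho> t x y * ((1 / t) * ((1 / (2 * t)) * (z t x y \<bullet> (y - (X x - t *\<^sub>R V x))) - DIM('a))) = 2 * \<psi> t y * kdot t x y" for x
      unfolding kdot_def \<rho>_def using t by (simp add: field_simps)
    thus ?thesis by (simp add: qdot_def \<psi>_def)
  qed
  hence "(\<integral>y. 2 * (q t y * qdot t y) * (1 / p y) \<partial>lborel)
      = J t (\<lambda>x y. (1 / t) * ((1 / (2 * t)) * (z t x y \<bullet> (y - (X x - t *\<^sub>R V x))) - DIM('a)))"
    by (subst J_snd[OF t' adm1]) simp
  \<comment> \<open>Parts about \<open>X - t V\<close> removes the quadratic term and the dimension
    together.\<close>
  also have "\<dots> = J t (\<lambda>x y. (1 / t) * (r t y \<bullet> (y - (X x - t *\<^sub>R V x))))"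
    unfolding J_cmult by (subst J_parts[OF t']) (auto intro!: adms)
  finally have "(\<integral>y. 2 * (q t y * qdot t y) * (1 / p y) \<partial>lborel) = J t (\<lambda>x y. (1 / t) * (r t y \<bullet> (y - (X x - t *\<^sub>R V x))))" .
  from DERIV_cong[OF D this] show ?thesis .
qed

text \<open>The gradient of \<open>\<psi>\<close> is \<open>\<psi> * r\<close> and the weight is
  \<open>q * q / p = p * \<psi>^2\<close>, so this is the Dirichlet energy of \<open>\<psi>\<close>
  under \<open>p\<close>.\<close>

definition D where "D t = J t (\<lambda>x y. (norm (r t y))\<^sup>2)"

lemma D_nonneg: assumes t: "0 < t" "t \<le> T" shows "0 \<le> D t"
  using J_mono[OF t adm_const[of 0] adm_norm_sq[OF vadm_r[OF t]]] J_cmult[of t 0 "\<lambda>x y. 1"]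
  unfolding D_def by simp

section \<open>Energy bounds for the Gaussian increment and the score\<close>

lemma young: "2 * (a \<bullet> b) \<le> c * (norm a)\<^sup>2 + (1 / c) * (norm b)\<^sup>2" if "0 < c" for a b :: 'a
proof -
  have "0 \<le> (1 / c) * (norm (c *\<^sub>R a - b))\<^sup>2" using that by simp
  also have "(norm (c *\<^sub>R a - b))\<^sup>2 = c\<^sup>2 * (norm a)\<^sup>2 - 2 * c * (a \<bullet> b) + (norm b)\<^sup>2"
    unfolding power2_norm_eq_inner by (simp add: inner_diff_left inner_diff_right inner_commute power2_eq_square)
  finally show ?thesis using that by (simp add: field_simps power2_eq_square)
qed

text \<open>With centre \<open>X + t V\<close> the radial field is \<open>z\<close> itself, and
  parts gives \<open>J (r \<bullet> z) = J |z|^2 / (2 * t) - d * F\<close>. Young's inequality with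
  weight \<open>2 * t\<close> bounds twice the left side while using up only half of the resulting
  \<open>J |z|^2 / t\<close>.\<close>

lemma displacement_energy:
  assumes t: "0 < t" "t \<le> T"
  shows "J t (\<lambda>x y. (norm (z t x y))\<^sup>2) \<le> 4 * t * DIM('a) * F t + 4 * t\<^sup>2 * D t"
proof -
  let ?A = "J t (\<lambda>x y. (norm (z t x y))\<^sup>2)"
  let ?B = "J t (\<lambda>x y. r t y \<bullet> z t x y)"
  have c: "vadm (\<lambda>x y. X x + t *\<^sub>R V x)" by (intro adms)
  have "?B = J t (\<lambda>x y. (1 / (2 * t)) * (norm (z t x y))\<^sup>2 - real DIM('a) * 1)"
    using J_parts[OF t c] by (simp add: z_def[symmetric] power2_norm_eq_inner)
  also have "\<dots> = (1 / (2 * t)) * ?A - DIM('a) * F t"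
    unfolding F_eq_J[OF t] by (subst J_diff[OF t]) (auto intro!: adms simp only: J_cmult)
  finally have B: "?B = (1 / (2 * t)) * ?A - DIM('a) * F t" .
  have "2 * ?B = J t (\<lambda>x y. 2 * (r t y \<bullet> z t x y))" by (rule J_cmult[symmetric])
  also have "\<dots> \<le> J t (\<lambda>x y. (2 * t) * (norm (r t y))\<^sup>2 + (1 / (2 * t)) * (norm (z t x y))\<^sup>2)"
    by (rule J_mono[OF t]) (use t young[of "2 * t"] in \<open>auto intro!: adms simp del: times_divide_eq_left\<close>)
  also have "\<dots> = (2 * t) * D t + (1 / (2 * t)) * ?A"
    unfolding D_def by (subst J_add[OF t]) (auto intro!: adms t simp only: J_cmult)
  finally have le: "2 * ((1 / (2 * t)) * ?A - DIM('a) * F t) \<le> (2 * t) * D t + (1 / (2 * t)) * ?A" unfolding B .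
  have "b \<le> 2 * u + v" if "2 * (b - u) \<le> v + b" for b u v :: real using that by (simp add: algebra_simps)
  from this[OF le] have "(1 / (2 * t)) * ?A \<le> 2 * (DIM('a) * F t) + (2 * t) * D t" .
  hence "(2 * t) * ((1 / (2 * t)) * ?A) \<le> (2 * t) * (2 * (DIM('a) * F t) + (2 * t) * D t)"
    using t by (intro mult_left_mono) auto
  thus ?thesis using t by (simp add: algebra_simps power2_eq_square)
qed

text \<open>Testing the conditional mean identity with \<open>gp\<close> itself expresses
  \<open>J |gp|^2\<close> through inner products of \<open>gp\<close> with
  \<open>z / (2 * t)\<close> and \<open>r\<close>; Young's inequality then absorbs one copy of
  \<open>J |gp|^2\<close>. The singular factor \<open>1 / t^2\<close> is harmless, because this
  energy is used only after multiplication by \<open>t^2\<close>.\<close>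

lemma score_energy:
  assumes t: "0 < t" "t \<le> T"
  shows "J t (\<lambda>x y. (norm (gp y))\<^sup>2) \<le> 1 / (2 * t\<^sup>2) * J t (\<lambda>x y. (norm (z t x y))\<^sup>2) + 2 * D t"
proof -
  let ?A = "J t (\<lambda>x y. (norm (z t x y))\<^sup>2)"
  let ?G = "J t (\<lambda>x y. (norm (gp y))\<^sup>2)"
  define a where "a = 1 / (2 * t)"
  have "0 = J t (\<lambda>x y. gp y \<bullet> (a *\<^sub>R z t x y + (gp y + r t y)))"
    unfolding a_def by (rule J_conditional_mean[OF t vadm_gp, symmetric])
  also have "\<dots> = J t (\<lambda>x y. (norm (gp y))\<^sup>2 + gp y \<bullet> (a *\<^sub>R z t x y + r t y))"
    unfolding power2_norm_eq_inner by (simp add: inner_add_right algebra_simps)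
  also have "\<dots> = ?G + J t (\<lambda>x y. gp y \<bullet> (a *\<^sub>R z t x y + r t y))"
    by (rule J_add[OF t]) (intro adms t)+
  finally have G: "?G = (- 1) * J t (\<lambda>x y. gp y \<bullet> (a *\<^sub>R z t x y + r t y))" by simp
  have "2 * ?G = J t (\<lambda>x y. (- 2) * (gp y \<bullet> (a *\<^sub>R z t x y + r t y)))"
    unfolding G J_cmult by simp
  also have "\<dots> \<le> J t (\<lambda>x y. (norm (gp y))\<^sup>2 + ((2 * a\<^sup>2) * (norm (z t x y))\<^sup>2 + 2 * (norm (r t y))\<^sup>2))"
  proof (rule J_mono[OF t])
    fix x y
    have 1: "(- 2) * (gp y \<bullet> (a *\<^sub>R z t x y + r t y)) \<le> (norm (gp y))\<^sup>2 + (norm (a *\<^sub>R z t x y + r t y))\<^sup>2"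
      using young[of 1 "gp y" "- (a *\<^sub>R z t x y + r t y)"] unfolding norm_minus_cancel inner_minus_right by simp
    have "(norm (a *\<^sub>R z t x y + r t y))\<^sup>2 \<le> (norm (a *\<^sub>R z t x y) + norm (r t y))\<^sup>2"
      by (intro power_mono norm_triangle_ineq) auto
    also have "\<dots> \<le> 2 * (norm (a *\<^sub>R z t x y))\<^sup>2 + 2 * (norm (r t y))\<^sup>2"
      using sum_squares_bound[of "norm (a *\<^sub>R z t x y)" "norm (r t y)"] by (simp add: power2_sum)
    finally show "(- 2) * (gp y \<bullet> (a *\<^sub>R z t x y + r t y)) \<le> (norm (gp y))\<^sup>2 + ((2 * a\<^sup>2) * (norm (z t x y))\<^sup>2 + 2 * (norm (r t y))\<^sup>2)"
      using 1 by (simp add: power_mult_distrib)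
  qed (intro adms t)+
  also have "\<dots> = ?G + J t (\<lambda>x y. (2 * a\<^sup>2) * (norm (z t x y))\<^sup>2 + 2 * (norm (r t y))\<^sup>2)"
    by (rule J_add[OF t]) (intro adms t)+
  also have "J t (\<lambda>x y. (2 * a\<^sup>2) * (norm (z t x y))\<^sup>2 + 2 * (norm (r t y))\<^sup>2) = 2 * a\<^sup>2 * ?A + 2 * D t"
    unfolding D_def J_cmult[symmetric] by (rule J_add[OF t]) (intro adms t)+
  finally have "?G \<le> 2 * a\<^sup>2 * ?A + 2 * D t" by linarith
  thus ?thesis using t by (simp add: a_def power_divide power_mult_distrib)
qed

end

subsection \<open>Poincare inequality and Gronwall argument\<close>

text \<open>The left side is the third-order Taylor polynomial at 1 of the right side. The
  derivative \<open>g\<close> of the difference has derivative \<open>(u - 1)^2 / u\<close> and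
  vanishes at 1, so the difference has its minimum, zero, there. The cubic term makes the bound
  global, and it becomes negligible in the linearisation of the log-Sobolev inequality.\<close>

lemma entropy_lower_bound:
  fixes u :: real
  assumes u: "0 < u"
  shows "(u - 1)\<^sup>2 / 2 - (u - 1) ^ 3 / 6 \<le> u * ln u - u + 1"
proof -
  define g where "g = (\<lambda>u::real. ln u - (u - 1) + (u - 1)\<^sup>2 / 2)"
  define f where "f = (\<lambda>u::real. u * ln u - u + 1 - (u - 1)\<^sup>2 / 2 + (u - 1) ^ 3 / 6)"
  have dg: "\<exists>y. (g has_real_derivative y) (at x) \<and> 0 \<le> y" if "0 < x" for x
  proof (intro exI conjI)
    show "(g has_real_derivative (1 / x - 1 + (x - 1))) (at x)"
      unfolding g_def using that by (auto intro!: derivative_eq_intros simp: field_simps power2_eq_square)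
    have "1 / x - 1 + (x - 1) = (x - 1)\<^sup>2 / x" using that by (simp add: field_simps power2_eq_square)
    thus "0 \<le> 1 / x - 1 + (x - 1)" using that by simp
  qed
  have df: "(f has_real_derivative g x) (at x)" if "0 < x" for x
    unfolding f_def g_def using that by (auto intro!: derivative_eq_intros simp: field_simps power2_eq_square)
  have f1: "f 1 = 0" and g1: "g 1 = 0" by (simp_all add: f_def g_def)
  have "0 \<le> f u"
  proof (cases "1 \<le> u")
    case True
    have "0 \<le> g x" if "1 \<le> x" for x
      using DERIV_nonneg_imp_nondecreasing[OF that, of g] dg g1 by simp
    hence "\<exists>y. (f has_real_derivative y) (at x) \<and> 0 \<le> y" if "1 \<le> x" for x
      using df[of x] that by (intro exI[of _ "g x"]) auto
    thus ?thesis using DERIV_nonneg_imp_nondecreasing[OF True, of f] f1 by simp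
  next
    case False
    hence u1: "u \<le> 1" by simp
    have "g x \<le> 0" if "0 < x" "x \<le> 1" for x
      using DERIV_nonneg_imp_nondecreasing[OF that(2), of g] dg g1 that(1) by simp
    hence "\<exists>y. (f has_real_derivative y) (at x) \<and> y \<le> 0" if "u \<le> x" "x \<le> 1" for x
      using df[of x] that u by (intro exI[of _ "g x"]) auto
    thus ?thesis using DERIV_nonpos_imp_nonincreasing[OF u1, of f] f1 by simp
  qed
  thus ?thesis by (simp add: f_def)
qed

section \<open>Dissipation of the second moment\<close>

context lmc_interp
begin

text \<open>The displacement is \<open>z + t V\<close>, and \<open>V\<close> is compared with the
  score at the current point, where \<open>score_energy\<close> applies. The error to be bounded
  thus reappears on the right with the factor \<open>L * t \<le> 1 / 4392\<close> and is
  absorbed.\<close>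

lemma drift_error_energy:
  assumes err: "\<And>x. norm (gp (X x) - V x) \<le> \<epsilon>" and t: "0 < t" "t \<le> T" and Lt: "4392 * L * t \<le> 1"
  shows "J t (\<lambda>x y. (norm (V x - gp y))\<^sup>2)
    \<le> 5 / 2 * \<epsilon>\<^sup>2 * F t + 5 * L\<^sup>2 * J t (\<lambda>x y. (norm (z t x y))\<^sup>2) + 5 * L\<^sup>2 * t\<^sup>2 * J t (\<lambda>x y. (norm (gp y))\<^sup>2)"
proof -
  have pt: "(norm (V x - gp y))\<^sup>2 \<le> 5 / 2 * \<epsilon>\<^sup>2 * 1 + (5 * L\<^sup>2 * (norm (z t x y))\<^sup>2 + 5 * L\<^sup>2 * t\<^sup>2 * (norm (gp y))\<^sup>2)" for x y
  proof -
    define d where "d = norm (V x - gp y)"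
    define g where "g = norm (gp y)"
    define n where "n = norm (z t x y)"
    have "d \<le> norm (V x - gp (X x)) + norm (gp (X x) - gp y)"
      unfolding d_def using norm_triangle_ineq[of "V x - gp (X x)" "gp (X x) - gp y"] by simp
    also have "\<dots> \<le> \<epsilon> + L * norm (X x - y)"
      using err[of x] lip[of "X x" y] by (simp add: norm_minus_commute)
    finally have d: "d \<le> \<epsilon> + L * norm (X x - y)" .
    have "X x - y = - z t x y - t *\<^sub>R V x" by (simp add: z_def)
    hence "norm (X x - y) \<le> n + t * norm (V x)"
      using norm_triangle_ineq4[of "- z t x y" "t *\<^sub>R V x"] t by (simp add: n_def)
    also have "norm (V x) \<le> d + g"
      unfolding d_def g_def using norm_triangle_ineq[of "V x - gp y" "gp y"] by simp
    hence "n + t * norm (V x) \<le> n + t * (d + g)" using t by simp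
    finally have "L * norm (X x - y) \<le> L * (n + t * (d + g))" using L_ge by (intro mult_left_mono) auto
    with d have d2: "d \<le> \<epsilon> + L * n + L * t * g + L * t * d" by (simp add: algebra_simps)
    have "L * t * d \<le> 1 / 4392 * d" using Lt by (intro mult_right_mono) (auto simp: d_def)
    with d2 have d3: "d \<le> 4392 / 4391 * (\<epsilon> + (L * n + L * t * g))" by (simp add: field_simps)
    have sq: "(a + b)\<^sup>2 \<le> 2 * a\<^sup>2 + 2 * b\<^sup>2" for a b :: real
      using sum_squares_bound[of a b] by (simp add: power2_sum)
    have "d\<^sup>2 \<le> (4392 / 4391 * (\<epsilon> + (L * n + L * t * g)))\<^sup>2"
      using d3 by (intro power_mono) (auto simp: d_def)
    also have "\<dots> = (4392 / 4391)\<^sup>2 * (\<epsilon> + (L * n + L * t * g))\<^sup>2" by (rule power_mult_distrib)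
    \<comment> \<open>The value 5/4 is a round bound for the square of 4392/4391; splitting the
      three-term square in two rounds then yields the coefficients 5/2, 5 and 5.\<close>
    also have "\<dots> \<le> 5 / 4 * (\<epsilon> + (L * n + L * t * g))\<^sup>2"
      by (intro mult_right_mono) (auto simp: power2_eq_square)
    also have "\<dots> \<le> 5 / 4 * (2 * \<epsilon>\<^sup>2 + 2 * (2 * (L * n)\<^sup>2 + 2 * (L * t * g)\<^sup>2))"
      using sq[of \<epsilon> "L * n + L * t * g"] sq[of "L * n" "L * t * g"] by (intro mult_left_mono) auto
    finally show ?thesis by (simp add: d_def n_def g_def power_mult_distrib algebra_simps)
  qed
  have "J t (\<lambda>x y. (norm (V x - gp y))\<^sup>2)
    \<le> J t (\<lambda>x y. 5 / 2 * \<epsilon>\<^sup>2 * 1 + (5 * L\<^sup>2 * (norm (z t x y))\<^sup>2 + 5 * L\<^sup>2 * t\<^sup>2 * (norm (gp y))\<^sup>2))"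
    by (rule J_mono[OF t _ _ pt]) (intro adms t)+
  also have "\<dots> = J t (\<lambda>x y. 5 / 2 * \<epsilon>\<^sup>2 * 1) + J t (\<lambda>x y. 5 * L\<^sup>2 * (norm (z t x y))\<^sup>2 + 5 * L\<^sup>2 * t\<^sup>2 * (norm (gp y))\<^sup>2)"
    by (rule J_add[OF t]) (intro adms t)+
  also have "J t (\<lambda>x y. 5 * L\<^sup>2 * (norm (z t x y))\<^sup>2 + 5 * L\<^sup>2 * t\<^sup>2 * (norm (gp y))\<^sup>2)
     = J t (\<lambda>x y. 5 * L\<^sup>2 * (norm (z t x y))\<^sup>2) + J t (\<lambda>x y. 5 * L\<^sup>2 * t\<^sup>2 * (norm (gp y))\<^sup>2)"
    by (rule J_add[OF t]) (intro adms t)+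
  finally show ?thesis unfolding J_cmult F_eq_J[OF t] by simp
qed

lemma F_nonneg: "0 < t \<Longrightarrow> t \<le> T \<Longrightarrow> 0 \<le> F t"
  unfolding F_def 
  by (intro Bochner_Integration.integral_nonneg) (simp add: less_imp_le p_pos q_pos)

text \<open>Twice the conditional mean identity tested with \<open>r\<close> is zero and may be
  subtracted. Since \<open>y - (X - t V) = z + 2 t V\<close>, this cancels \<open>z\<close>
  pointwise and leaves \<open>2 * (r \<bullet> (V - gp)) - 2 * |r|^2\<close>, to which Young's
  inequality applies.\<close>

lemma energy_dissipation:
  assumes err: "\<And>x. norm (gp (X x) - V x) \<le> \<epsilon>" and t: "0 < t" "t \<le> T" and Lt: "4392 * L * t \<le> 1"
  shows "J t (\<lambda>x y. (1 / t) * (r t y \<bullet> (y - (X x - t *\<^sub>R V x))))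
     \<le> - (99 / 100) * D t + (5 / 2 * \<epsilon>\<^sup>2 + 30 * L\<^sup>2 * t * DIM('a)) * F t"
proof -
  let ?E = "J t (\<lambda>x y. (norm (V x - gp y))\<^sup>2)"
  let ?A = "J t (\<lambda>x y. (norm (z t x y))\<^sup>2)"
  let ?G = "J t (\<lambda>x y. (norm (gp y))\<^sup>2)"
  have "J t (\<lambda>x y. (1 / t) * (r t y \<bullet> (y - (X x - t *\<^sub>R V x))))
     = J t (\<lambda>x y. (1 / t) * (r t y \<bullet> (y - (X x - t *\<^sub>R V x))))
       - 2 * J t (\<lambda>x y. r t y \<bullet> ((1 / (2 * t)) *\<^sub>R z t x y + (gp y + r t y)))"
    using J_conditional_mean[OF t vadm_r[OF t]] by simp
  also have "\<dots> = J t (\<lambda>x y. (1 / t) * (r t y \<bullet> (y - (X x - t *\<^sub>R V x)))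
       - 2 * (r t y \<bullet> ((1 / (2 * t)) *\<^sub>R z t x y + (gp y + r t y))))"
    unfolding J_cmult[where c=2, symmetric] by (rule J_diff[OF t, symmetric]) (intro adms t)+
  also have "\<dots> \<le> J t (\<lambda>x y. (norm (V x - gp y))\<^sup>2 - (norm (r t y))\<^sup>2)"
  proof (rule J_mono[OF t])
    fix x y
    have "y - (X x - t *\<^sub>R V x) = z t x y + (2 * t) *\<^sub>R V x"
      by (simp add: z_def algebra_simps scaleR_2[symmetric])
    hence "(1 / t) * (r t y \<bullet> (y - (X x - t *\<^sub>R V x))) - 2 * (r t y \<bullet> ((1 / (2 * t)) *\<^sub>R z t x y + (gp y + r t y)))
      = 2 * (r t y \<bullet> (V x - gp y)) - 2 * (norm (r t y))\<^sup>2"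
      unfolding power2_norm_eq_inner using t
      by (simp add: inner_add_right inner_diff_right algebra_simps)
    thus "(1 / t) * (r t y \<bullet> (y - (X x - t *\<^sub>R V x))) - 2 * (r t y \<bullet> ((1 / (2 * t)) *\<^sub>R z t x y + (gp y + r t y)))
      \<le> (norm (V x - gp y))\<^sup>2 - (norm (r t y))\<^sup>2"
      using young[of 1 "r t y" "V x - gp y"] by simp
  qed (intro adms t)+
  also have "\<dots> = ?E - D t"
    unfolding D_def by (rule J_diff[OF t]) (intro adms t)+
  \<comment> \<open>The score energy raises the coefficient of \<open>J |z|^2\<close> from 5 to
    15/2, and \<open>displacement_energy\<close> multiplies this by 4, which is the origin of 30.
    The multiples 10 and 30 of \<open>(L * t)^2 * D\<close> add up to 40, less than 1/100 after the
    bound on \<open>L * t\<close>.\<close>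
  also have "?E \<le> 5 / 2 * \<epsilon>\<^sup>2 * F t + 30 * L\<^sup>2 * t * DIM('a) * F t + 40 * (L * t)\<^sup>2 * D t"
  proof -
    have "5 * L\<^sup>2 * t\<^sup>2 * ?G \<le> 5 * L\<^sup>2 * t\<^sup>2 * (1 / (2 * t\<^sup>2) * ?A + 2 * D t)"
      by (intro mult_left_mono score_energy[OF t]) auto
    also have "\<dots> = 5 / 2 * L\<^sup>2 * ?A + 10 * (L * t)\<^sup>2 * D t"
      using t by (simp add: power_mult_distrib field_simps)
    finally have 1: "5 * L\<^sup>2 * t\<^sup>2 * ?G \<le> 5 / 2 * L\<^sup>2 * ?A + 10 * (L * t)\<^sup>2 * D t" .
    have "15 / 2 * L\<^sup>2 * ?A \<le> 15 / 2 * L\<^sup>2 * (4 * t * DIM('a) * F t + 4 * t\<^sup>2 * D t)"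
      by (intro mult_left_mono displacement_energy[OF t]) auto
    also have "\<dots> = 30 * L\<^sup>2 * t * DIM('a) * F t + 30 * (L * t)\<^sup>2 * D t"
      by (simp add: power_mult_distrib algebra_simps)
    finally have 2: "15 / 2 * L\<^sup>2 * ?A \<le> 30 * L\<^sup>2 * t * DIM('a) * F t + 30 * (L * t)\<^sup>2 * D t" .
    show ?thesis
      using 1 2 drift_error_energy[OF err t Lt] by (simp add: algebra_simps)
  qed
  finally have main: "J t (\<lambda>x y. (1 / t) * (r t y \<bullet> (y - (X x - t *\<^sub>R V x))))
    \<le> 5 / 2 * \<epsilon>\<^sup>2 * F t + 30 * L\<^sup>2 * t * DIM('a) * F t + 40 * (L * t)\<^sup>2 * D t - D t" by simp
  have "(L * t)\<^sup>2 \<le> (1 / 4392)\<^sup>2" using Lt L_ge t by (intro power_mono) auto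
  hence "40 * (L * t)\<^sup>2 \<le> 1 / 100" by (simp add: power2_eq_square)
  hence "40 * (L * t)\<^sup>2 * D t \<le> 1 / 100 * D t" using D_nonneg[OF t] by (intro mult_right_mono) auto
  with main show ?thesis by (simp add: algebra_simps)
qed

section \<open>Mass and moments of the interpolated law\<close>

lemma integrable_q: assumes t: "0 < t" "t \<le> T" shows "integrable lborel (q t)"
  by (rule expdom_integrable[OF expdom_reindex[OF q_dom[OF t(1)]]]) (use t L_ge in auto)

lemma integral_q: assumes t: "0 < t" "t \<le> T" shows "(\<integral>y. q t y \<partial>lborel) = 1"
proof -
  have k_pair: "integrable (M \<Otimes>\<^sub>M lborel) (\<lambda>(x, y). k t x y)"
    by (rule expdom_integrable_pair[OF expdom_reindex[OF k_dom[OF t(1)], of "space M" "\<lambda>x. (t, x)", simplified]])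
      (use t L_ge in \<open>auto simp: split_beta\<close>)
  have [measurable]: "gauss_density m v \<in> borel_measurable borel" for m :: 'a and v
    by measurable
  have k1: "(\<integral>y. k t x y \<partial>lborel) = 1" for x
    unfolding k_def using nn_integral_gauss_density[of "2 * t" "X x + t *\<^sub>R V x"] t
    by (subst integral_eq_nn_integral) (auto simp: gauss_density_nonneg)
  have "(\<integral>y. q t y \<partial>lborel) = (\<integral>x. (\<integral>y. k t x y \<partial>lborel) \<partial>M)"
    unfolding q_def using P.integral_fst[OF k_pair] P.integral_snd[OF k_pair] by simp
  thus ?thesis using k1 by (simp add: prob_space)
qed

lemma integrable_p: "integrable lborel p" and integral_p: "(\<integral>y. p y \<partial>lborel) = 1"
  using p_dens by (auto simp: prob_density_def)

lemma integrable_F: assumes t: "0 < t" "t \<le> T" shows "integrable lborel (\<lambda>y. q t y * q t y * (1 / p y))"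
proof -
  have "expdom L {()} (- 30 + - 30 + 2) (\<lambda>_ y. q t y * q t y * (1 / p y))"
    using t by (intro expdom_mult inverse_p_dom expdom_reindex[OF q_dom[OF t(1)]]) auto
  thus ?thesis by (rule expdom_integrable) (use L_ge in auto)
qed

lemma D_eq:
  assumes t: "0 < t" "t \<le> T"
  shows "D t = (\<integral>y. q t y * q t y * (1 / p y) * (norm (r t y))\<^sup>2 \<partial>lborel)"
  unfolding D_def by (rule J_weight[OF t]) (intro adms t)

lemma integrable_D: assumes t: "0 < t" "t \<le> T"
  shows "integrable lborel (\<lambda>y. q t y * q t y * (1 / p y) * (norm (r t y))\<^sup>2)"
proof -
  have "expdom L {()} (- 30 + - 30 + 2 + (1 + 1)) (\<lambda>_ y. q t y * q t y * (1 / p y) * (norm (r t y))\<^sup>2)"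
    using t by (intro expdom_mult inverse_p_dom expdom_reindex[OF q_dom[OF t(1)]] expdom_norm_sq r_dom) auto
  thus ?thesis by (rule expdom_integrable) (use L_ge in auto)
qed

lemma F_minus_one:
  assumes t: "0 < t" "t \<le> T"
  shows "has_bochner_integral lborel (\<lambda>y. p y * (\<psi> t y - 1)\<^sup>2) (F t - 1)"
proof -
  have "has_bochner_integral lborel (\<lambda>y. q t y * q t y * (1 / p y) - 2 * q t y + p y) (F t - 2 * 1 + 1)"
    using integrable_F[OF t] integrable_q[OF t] integrable_p integral_q[OF t] integral_p
    by (intro has_bochner_integral_add has_bochner_integral_diff has_bochner_integral_mult_right)
       (simp_all add: has_bochner_integral_iff F_def)
  moreover have "q t y * q t y * (1 / p y) - 2 * q t y + p y = p y * (\<psi> t y - 1)\<^sup>2" for y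
    unfolding \<psi>_def using p_pos[of y] by (simp add: field_simps power2_eq_square)
  ultimately show ?thesis by simp
qed

text \<open>The Poincare inequality is the linearisation of the log-Sobolev inequality at \<open>p\<close>, along the
  densities \<open>p * (1 + \<delta> * (\<psi> - 1))\<close> as \<open>\<delta>\<close> tends to zero.\<close>
lemma poincare:
  fixes C :: real
  assumes LSI: "log_sobolev C p gp" and C: "0 \<le> C" and t: "0 < t" "t \<le> T"
  shows "F t - 1 \<le> C * D t"
proof -
  define B where "B = (\<integral>y. p y * (\<psi> t y - 1) ^ 3 \<partial>lborel)"
  have int3: "integrable lborel (\<lambda>y. p y * (\<psi> t y - 1) ^ 3)"
  proof -
    have "expdom L {()} (- 30 + - 30 + - 30 + 2 + 2) (\<lambda>_ y. q t y * q t y * q t y * (1 / p y) * (1 / p y))"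
      using t by (intro expdom_mult inverse_p_dom expdom_reindex[OF q_dom[OF t(1)]]) auto
    hence "integrable lborel (\<lambda>y. q t y * q t y * q t y * (1 / p y) * (1 / p y))"
      by (rule expdom_integrable) (use L_ge in auto)
    hence "integrable lborel (\<lambda>y. q t y * q t y * q t y * (1 / p y) * (1 / p y) - 3 * (q t y * q t y * (1 / p y)) + 3 * q t y - p y)"
      by (intro Bochner_Integration.integrable_add Bochner_Integration.integrable_diff integrable_mult_right
        integrable_F[OF t] integrable_q[OF t] integrable_p)
    moreover have "q t y * q t y * q t y * (1 / p y) * (1 / p y) - 3 * (q t y * q t y * (1 / p y)) + 3 * q t y - p y = p y * (\<psi> t y - 1) ^ 3" for y
      unfolding \<psi>_def using p_pos[of y] by (simp add: field_simps power3_eq_cube)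
    ultimately show ?thesis by simp
  qed
  note F1 = F_minus_one[OF t, unfolded has_bochner_integral_iff]
  \<comment> \<open>Both sides of the log-Sobolev inequality for the perturbed density are of order
    \<open>\<delta>^2\<close>; this is the inequality after division by it, with the cubic Taylor
    term surviving as \<open>\<delta> * B / 6\<close>.\<close>
  have key: "(F t - 1) / 2 - \<delta> * B / 6 \<le> C / 2 * D t / (1 - \<delta>)" if \<delta>: "0 < \<delta>" "\<delta> < 1" for \<delta>
  proof -
    define u where "u = (\<lambda>y. 1 + \<delta> * (\<psi> t y - 1))"
    define w where "w = (\<lambda>y. (1 - \<delta>) * p y + \<delta> * q t y)"
    have wu: "w y = p y * u y" for y
      unfolding w_def u_def \<psi>_def using p_pos[of y] by (simp add: field_simps)
    have u_pos: "1 - \<delta> \<le> u y" for y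
      unfolding u_def using \<psi>_pos[OF t, of y] \<delta> by (simp add: algebra_simps)
    have w_pos: "0 < w y" for y
      unfolding w_def using \<delta> p_pos[of y] q_pos[OF t, of y] by (simp add: add_pos_pos)
    have w_int: "integrable lborel w" "(\<integral>y. w y \<partial>lborel) = 1"
      unfolding w_def using integrable_p integrable_q[OF t] integral_p integral_q[OF t] by auto
    define gw where "gw = (\<lambda>y. (1 / w y) *\<^sub>R ((1 - \<delta>) *\<^sub>R (p y *\<^sub>R gp y) + \<delta> *\<^sub>R dq t y))"
    have w_der: "GDERIV w y :> (1 - \<delta>) *\<^sub>R (p y *\<^sub>R gp y) + \<delta> *\<^sub>R dq t y" for y
      unfolding w_def
      using GDERIV_add[OF GDERIV_mult[OF GDERIV_const[of "1 - \<delta>"] GDERIV_p] GDERIV_mult[OF GDERIV_const[of \<delta>] GDERIV_q[OF t]], of y]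
      by simp
    have lnw: "GDERIV (\<lambda>y. ln (w y)) y :> gw y" for y
      unfolding gw_def using GDERIV_DERIV_compose[OF w_der DERIV_ln[OF w_pos]] by (simp add: inverse_eq_divide)
    have gw_diff: "gw y - gp y = (\<delta> * q t y / w y) *\<^sub>R r t y" for y
    proof -
      have "(1 - \<delta>) *\<^sub>R (p y *\<^sub>R gp y) + \<delta> *\<^sub>R dq t y = w y *\<^sub>R gp y + (\<delta> * q t y) *\<^sub>R r t y"
        unfolding r_def w_def using q_pos[OF t, of y] by (simp add: algebra_simps)
      thus ?thesis unfolding gw_def using w_pos[of y] by (simp add: scaleR_add_right)
    qed
    \<comment> \<open>The mixture \<open>w\<close> is at least \<open>(1 - \<delta>) * p\<close>, so
      its relative Fisher information is dominated by a multiple of the integrand of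
      \<open>D\<close>. This also supplies the finiteness demanded by
      \<open>log_sobolev\<close>.\<close>
    have fisher_le: "w y * (norm (gw y - gp y))\<^sup>2 \<le> \<delta>\<^sup>2 / (1 - \<delta>) * (q t y * q t y * (1 / p y) * (norm (r t y))\<^sup>2)" for y
    proof -
      have "w y * (norm (gw y - gp y))\<^sup>2 = (\<delta>\<^sup>2 * (q t y)\<^sup>2 * (norm (r t y))\<^sup>2) * (1 / w y)"
        unfolding gw_diff using w_pos[of y] by (simp add: power_mult_distrib power_divide power2_eq_square)
      also have "\<dots> \<le> (\<delta>\<^sup>2 * (q t y)\<^sup>2 * (norm (r t y))\<^sup>2) * (1 / ((1 - \<delta>) * p y))"
      proof (intro mult_left_mono divide_left_mono)
        show "(1 - \<delta>) * p y \<le> w y" unfolding w_def using q_pos[OF t, of y] \<delta> by simp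
      qed (use w_pos[of y] p_pos[of y] \<delta> in auto)
      finally show ?thesis by (simp add: power2_eq_square mult_ac)
    qed
    have gw_meas: "(\<lambda>y. w y * (norm (gw y - gp y))\<^sup>2) \<in> borel_measurable lborel"
      unfolding gw_diff w_def by measurable
    have fisher_int: "integrable lborel (\<lambda>y. w y * (norm (gw y - gp y))\<^sup>2)"
    proof (rule Bochner_Integration.integrable_bound[OF integrable_mult_right[OF integrable_D[OF t], of "\<delta>\<^sup>2 / (1 - \<delta>)"] gw_meas], rule AE_I2)
      fix y
      have "norm (w y * (norm (gw y - gp y))\<^sup>2) = w y * (norm (gw y - gp y))\<^sup>2"
        using w_pos[of y] by simp
      also note fisher_le[of y]
      finally show "norm (w y * (norm (gw y - gp y))\<^sup>2) \<le> norm (\<delta>\<^sup>2 / (1 - \<delta>) * (q t y * q t y * (1 / p y) * (norm (r t y))\<^sup>2))"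
        unfolding real_norm_def by linarith
    qed
    have "(\<integral>\<^sup>+ y. ennreal (w y * (norm (gw y - gp y))\<^sup>2) \<partial>lborel) < \<infinity>"
      using fisher_int w_pos by (subst nn_integral_eq_integral) (auto simp: less_imp_le)
    moreover have "prob_density w"
      unfolding prob_density_def using w_int w_pos by (auto simp: less_imp_le w_def)
    ultimately have LS: "integrable lborel (\<lambda>y. w y * ln (w y / p y))"
      "(\<integral>y. w y * ln (w y / p y) \<partial>lborel) \<le> C / 2 * (\<integral>y. w y * (norm (gw y - gp y))\<^sup>2 \<partial>lborel)"
      using LSI w_pos lnw unfolding log_sobolev_def by blast+
    have KL: "w y * ln (w y / p y) = p y * (u y * ln (u y))" for y
      unfolding wu using p_pos[of y] by simp
    have "\<delta>\<^sup>2 / 2 * (F t - 1) - \<delta> ^ 3 / 6 * B = (\<integral>y. \<delta>\<^sup>2 / 2 * (p y * (\<psi> t y - 1)\<^sup>2) - \<delta> ^ 3 / 6 * (p y * (\<psi> t y - 1) ^ 3) \<partial>lborel)"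
      unfolding B_def using F1 int3 by simp
    \<comment> \<open>\<open>w\<close> and \<open>p\<close> have equal mass, so adding
      \<open>- w + p\<close> leaves the integral unchanged and makes the integrand
      \<open>p * (u * ln u - u + 1)\<close>, to which the Taylor bound applies pointwise.\<close>
    also have "\<dots> \<le> (\<integral>y. p y * (u y * ln (u y)) - w y + p y \<partial>lborel)"
    proof (rule integral_mono)
      show "integrable lborel (\<lambda>y. \<delta>\<^sup>2 / 2 * (p y * (\<psi> t y - 1)\<^sup>2) - \<delta> ^ 3 / 6 * (p y * (\<psi> t y - 1) ^ 3))"
        using F1 int3 by simp
      show "integrable lborel (\<lambda>y. p y * (u y * ln (u y)) - w y + p y)"
        using LS(1) w_int integrable_p unfolding KL by simp
      fix y :: 'a
      have "(u y - 1)\<^sup>2 / 2 - (u y - 1) ^ 3 / 6 \<le> u y * ln (u y) - u y + 1"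
        by (rule entropy_lower_bound) (use u_pos[of y] \<delta> in linarith)
      moreover have um: "u y - 1 = \<delta> * (\<psi> t y - 1)" by (simp add: u_def)
      ultimately have "p y * ((u y - 1)\<^sup>2 / 2 - (u y - 1) ^ 3 / 6) \<le> p y * (u y * ln (u y) - u y + 1)"
        using p_pos[of y] by (intro mult_left_mono) auto
      thus "\<delta>\<^sup>2 / 2 * (p y * (\<psi> t y - 1)\<^sup>2) - \<delta> ^ 3 / 6 * (p y * (\<psi> t y - 1) ^ 3) \<le> p y * (u y * ln (u y)) - w y + p y"
        unfolding wu um power_mult_distrib by (simp add: algebra_simps)
    qed
    also have "\<dots> = (\<integral>y. w y * ln (w y / p y) \<partial>lborel)"
      using LS(1) w_int integrable_p integral_p unfolding KL by simp
    also have "\<dots> \<le> C / 2 * (\<integral>y. w y * (norm (gw y - gp y))\<^sup>2 \<partial>lborel)" by (rule LS(2))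
    also have "\<dots> \<le> C / 2 * (\<integral>y. \<delta>\<^sup>2 / (1 - \<delta>) * (q t y * q t y * (1 / p y) * (norm (r t y))\<^sup>2) \<partial>lborel)"
      using C fisher_le by (intro mult_left_mono integral_mono fisher_int integrable_mult_right integrable_D t) auto
    also have "\<dots> = C / 2 * (\<delta>\<^sup>2 / (1 - \<delta>) * D t)" unfolding D_eq[OF t] by (simp only: integral_mult_right_zero)
    finally have "\<delta>\<^sup>2 * ((F t - 1) / 2 - \<delta> * B / 6) \<le> \<delta>\<^sup>2 * (C / 2 * D t / (1 - \<delta>))"
      by (simp add: algebra_simps power2_eq_square power3_eq_cube)
    thus ?thesis using \<delta> by (simp only: mult_le_cancel_left_pos zero_less_power)
  qed
  have "(F t - 1) / 2 - 0 * B / 6 \<le> C / 2 * D t / (1 - 0)"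
  proof (rule tendsto_le)
    show "((\<lambda>\<delta>. (F t - 1) / 2 - \<delta> * B / 6) \<longlongrightarrow> (F t - 1) / 2 - 0 * B / 6) (at_right 0)"
      by (intro tendsto_intros) auto
    show "((\<lambda>\<delta>. C / 2 * D t / (1 - \<delta>)) \<longlongrightarrow> C / 2 * D t / (1 - 0)) (at_right 0)"
      by (intro tendsto_intros) auto
    have "\<forall>\<^sub>F \<delta> in at_right 0. \<delta> \<in> {0<..<1::real}" by (rule eventually_at_right_real) simp
    thus "\<forall>\<^sub>F \<delta> in at_right 0. (F t - 1) / 2 - \<delta> * B / 6 \<le> C / 2 * D t / (1 - \<delta>)"
      by eventually_elim (use key in auto)
  qed simp
  thus ?thesis by simp
qed

text \<open>Writing \<open>K * F = K * (F - 1) + K\<close>, the first summand is absorbed by the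
  Poincare term because \<open>K * C\<close> is small: the rate drops from \<open>0.99 / C\<close>
  to \<open>0.93 / C\<close>, still well above the claimed \<open>1 / (4 * C)\<close>. The start
  \<open>t0\<close> is positive since the kernel degenerates at time zero.\<close>

lemma chi_square_gronwall:
  fixes C \<epsilon> h t0 :: real
  assumes err: "\<And>x. norm (gp (X x) - V x) \<le> \<epsilon>" and LSI: "log_sobolev C p gp" and C: "1 \<le> C"
    and eps: "48 * C * \<epsilon>\<^sup>2 \<le> 1" and h: "4392 * real DIM('a) * C * L\<^sup>2 * h \<le> 1" and th: "0 < t0" "t0 \<le> h" "h < T"
  shows "F h - 1 \<le> exp (- (h - t0) / (4 * C)) * (F t0 - 1) + (5 / 2 * \<epsilon>\<^sup>2 + 30 * L\<^sup>2 * h * DIM('a)) * h"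
proof -
  define K where "K = 5 / 2 * \<epsilon>\<^sup>2 + 30 * L\<^sup>2 * h * DIM('a)"
  have K0: "0 \<le> K" unfolding K_def using th by simp
  have DIM1: "1 \<le> real DIM('a)" using DIM_positive[where 'a='a] by linarith
  \<comment> \<open>The two smallness hypotheses contribute 5/96 and 30/4392, together just below
    6/100.\<close>
  have KC: "K * C \<le> 6 / 100"
  proof -
    have "K * C = 5 / 96 * (48 * C * \<epsilon>\<^sup>2) + 30 / 4392 * (4392 * real DIM('a) * C * L\<^sup>2 * h)"
      by (simp add: K_def algebra_simps)
    thus ?thesis using eps h by linarith
  qed
  have Lh: "4392 * L * h \<le> 1"
  proof -
    have "1 * 1 * L \<le> DIM('a) * C * L\<^sup>2"
      using DIM1 C L_ge by (intro mult_mono) (auto simp: power2_eq_square)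
    from mult_left_mono[OF this, of "4392 * h"] have "4392 * h * (1 * 1 * L) \<le> 4392 * h * (DIM('a) * C * L\<^sup>2)"
      using th by simp
    also have "\<dots> \<le> 1" using h by (simp add: mult_ac)
    finally show ?thesis by (simp add: mult_ac)
  qed
  define F' where "F' = (\<lambda>t. J t (\<lambda>x y. (1 / t) * (r t y \<bullet> (y - (X x - t *\<^sub>R V x)))))"
  have F'_le: "(F t - 1) / (4 * C) + F' t \<le> K" if t: "0 < t" "t \<le> h" for t
  proof -
    have tT: "t \<le> T" using t th by simp
    have "L * t \<le> L * h" using t L_ge by (intro mult_left_mono) auto
    hence "4392 * L * t \<le> 1" using Lh by linarith
    from energy_dissipation[OF err t(1) tT this]
    have 1: "F' t \<le> - (99 / 100) * D t + (5 / 2 * \<epsilon>\<^sup>2 + 30 * L\<^sup>2 * t * DIM('a)) * F t" unfolding F'_def .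
    have "30 * L\<^sup>2 * t * DIM('a) \<le> 30 * L\<^sup>2 * h * DIM('a)" using t by (intro mult_right_mono mult_left_mono) auto
    hence "(5 / 2 * \<epsilon>\<^sup>2 + 30 * L\<^sup>2 * t * DIM('a)) * F t \<le> K * F t"
      using F_nonneg[OF t(1) tT] unfolding K_def by (intro mult_right_mono) auto
    with 1 have 2: "F' t \<le> - (99 / 100) * D t + K * F t" by simp
    have F1: "0 \<le> F t - 1"
    proof -
      have "0 \<le> (\<integral>y. p y * (\<psi> t y - 1)\<^sup>2 \<partial>lborel)"
        by (intro Bochner_Integration.integral_nonneg) (simp add: less_imp_le p_pos)
      thus ?thesis using F_minus_one[OF t(1) tT] by (simp add: has_bochner_integral_iff)
    qed
    have "(F t - 1) / C \<le> D t" using poincare[OF LSI _ t(1) tT] C by (simp add: field_simps)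
    moreover have "K * F t = K * (F t - 1) + K" by (simp add: algebra_simps)
    ultimately have 3: "F' t \<le> - (99 / 100) * ((F t - 1) / C) + K * (F t - 1) + K" using 2 by linarith
    have "K \<le> 6 / 100 / C" using KC C by (simp add: field_simps)
    hence "K * (F t - 1) \<le> 6 / 100 / C * (F t - 1)" using F1 by (intro mult_right_mono) auto
    also have "\<dots> = 6 / 100 * ((F t - 1) / C)" by simp
    finally have "F' t \<le> - (93 / 100) * ((F t - 1) / C) + K" using 3 by linarith
    moreover have "0 \<le> (F t - 1) / C" using F1 C by simp
    ultimately have "F' t \<le> - (1 / 4) * ((F t - 1) / C) + K" by linarith
    moreover have "(F t - 1) / (4 * C) = 1 / 4 * ((F t - 1) / C)" by simp
    ultimately show ?thesis by linarith
  qed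
  \<comment> \<open>The integrating factor times \<open>F - 1\<close>, minus a linear majorant of
    the accumulated error: \<open>exp (t / (4 * C))\<close> is replaced there by its value at the
    endpoint \<open>h\<close>, which cancels at the end.\<close>
  define b where "b = (\<lambda>t. exp (t / (4 * C)) * (F t - 1) - K * exp (h / (4 * C)) * t)"
  have "b h \<le> b t0"
  proof (rule DERIV_nonpos_imp_nonincreasing[OF th(2)])
    fix t assume t: "t0 \<le> t" "t \<le> h"
    have t0: "0 < t" and tT: "t < T" using t th by auto
    have dF: "(F has_real_derivative F' t) (at t)" unfolding F'_def by (rule DERIV_F[OF t0 tT])
    have "(b has_real_derivative (exp (t / (4 * C)) * ((F t - 1) / (4 * C) + F' t) - K * exp (h / (4 * C)))) (at t)"
      unfolding b_def
      by (rule DERIV_cong[OF DERIV_diff[OF DERIV_mult[OF DERIV_fun_exp[OF DERIV_cdivide[OF DERIV_ident]]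
            DERIV_diff[OF dF DERIV_const]] DERIV_cmult[OF DERIV_ident]]])
         (simp add: distrib_left mult.commute)
    moreover have "exp (t / (4 * C)) * ((F t - 1) / (4 * C) + F' t) - K * exp (h / (4 * C)) \<le> 0"
    proof -
      have "exp (t / (4 * C)) * ((F t - 1) / (4 * C) + F' t) \<le> exp (t / (4 * C)) * K"
        using F'_le[OF t0 t(2)] by (intro mult_left_mono) auto
      also have "\<dots> \<le> exp (h / (4 * C)) * K"
        using K0 t C by (intro mult_right_mono) (auto intro!: divide_right_mono)
      finally show ?thesis by (simp add: mult.commute)
    qed
    ultimately show "\<exists>y. (b has_real_derivative y) (at t) \<and> y \<le> 0" by blast
  qed
  hence "exp (h / (4 * C)) * (F h - 1) \<le> exp (t0 / (4 * C)) * (F t0 - 1) + exp (h / (4 * C)) * (K * (h - t0))"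
    by (simp add: b_def algebra_simps)
  hence "exp (- h / (4 * C)) * (exp (h / (4 * C)) * (F h - 1))
     \<le> exp (- h / (4 * C)) * (exp (t0 / (4 * C)) * (F t0 - 1) + exp (h / (4 * C)) * (K * (h - t0)))"
    by (intro mult_left_mono) auto
  moreover have "exp (- h / (4 * C)) * exp (h / (4 * C)) = 1" by (simp add: exp_add[symmetric])
  moreover have "exp (- h / (4 * C)) * exp (t0 / (4 * C)) = exp (- (h - t0) / (4 * C))"
    unfolding exp_add[symmetric] by (simp add: diff_divide_distrib)
  ultimately have "F h - 1 \<le> exp (- (h - t0) / (4 * C)) * (F t0 - 1) + K * (h - t0)"
    by (simp add: distrib_left mult.assoc[symmetric])
  moreover have "K * (h - t0) \<le> K * h" using K0 th by (intro mult_left_mono) auto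
  ultimately show ?thesis unfolding K_def by linarith
qed

end

subsection \<open>Behaviour at small times\<close>

text \<open>Tilting by \<open>exp (a * |w|^2)\<close> gives an unnormalised Gaussian of variance
  \<open>v / (1 - 2 * v * a)\<close>; the value is the ratio of the normalising constants.\<close>

lemma nn_integral_gauss_exp_norm_sq:
  assumes v: "0 < v" and c: "2 * v * a < 1"
  shows "(\<integral>\<^sup>+w. ennreal (gauss_density (0::'a::euclidean_space) v w * exp (a * (norm w)\<^sup>2)) \<partial>lborel)
    = ennreal ((1 / (1 - 2 * v * a)) powr (real DIM('a) / 2))"
proof -
  define c where "c = 1 - 2 * v * a"
  have c: "0 < c" using c by (simp add: c_def)
  have eq: "gauss_density (0::'a) v w * exp (a * (norm w)\<^sup>2) = (1 / c) powr (real DIM('a) / 2) * gauss_density 0 (v / c) w" for w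
  proof -
    have 1: "(1 / c) powr (real DIM('a) / 2) * (1 / (2 * pi * (v / c))) powr (real DIM('a) / 2) = (1 / (2 * pi * v)) powr (real DIM('a) / 2)"
      using v c by (subst powr_mult[symmetric]) auto
    have "- (norm w)\<^sup>2 / (2 * v) + a * (norm w)\<^sup>2 = - (norm w)\<^sup>2 / (2 * (v / c))"
      using v c by (simp add: field_simps) (simp add: c_def algebra_simps)
    hence 2: "exp (- (norm w)\<^sup>2 / (2 * v)) * exp (a * (norm w)\<^sup>2) = exp (- (norm w)\<^sup>2 / (2 * (v / c)))"
      by (simp only: exp_add[symmetric])
    show ?thesis unfolding gauss_density_def diff_zero mult.assoc 2 by (simp only: mult.assoc[symmetric] 1)
  qed
  have "(\<integral>\<^sup>+w. ennreal (gauss_density (0::'a) v w * exp (a * (norm w)\<^sup>2)) \<partial>lborel)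
    = (\<integral>\<^sup>+w. ennreal ((1 / c) powr (real DIM('a) / 2)) * ennreal (gauss_density (0::'a) (v / c) w) \<partial>lborel)"
    unfolding eq by (simp add: ennreal_mult gauss_density_nonneg)
  also have "\<dots> = ennreal ((1 / c) powr (real DIM('a) / 2)) * (\<integral>\<^sup>+w. ennreal (gauss_density (0::'a) (v / c) w) \<partial>lborel)"
    by (rule nn_integral_cmult) measurable
  also have "\<dots> = ennreal ((1 / c) powr (real DIM('a) / 2))"
    using nn_integral_gauss_density[of "v / c" "0::'a"] v c by simp
  finally show ?thesis unfolding c_def .
qed

lemma nn_integral_lborel_translate:
  fixes v :: "'a::euclidean_space \<Rightarrow> ennreal"
  assumes [measurable]: "v \<in> borel_measurable borel"
  shows "(\<integral>\<^sup>+y. v (y - x) \<partial>lborel) = (\<integral>\<^sup>+y. v y \<partial>lborel)"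
  using nn_integral_lborel_scale[of "\<lambda>y. v (y - x)" 1 x] by simp

context lip_score
begin

text \<open>This bounds the mass of a centred Gaussian of variance \<open>2 * \<tau>^2\<close>
  tilted by \<open>exp (2 * S * |w| + L * |w|^2)\<close>, obtained from
  \<open>2 * S * |w| \<le> \<tau> + S^2 / \<tau> * |w|^2\<close>. Time is written as
  \<open>\<tau>^2\<close> so that both the constant \<open>\<tau>\<close> and the quadratic
  coefficient times \<open>\<tau>^2\<close> tend to zero.\<close>

definition smear :: "real \<Rightarrow> real \<Rightarrow> real" where
  "smear S \<tau> = exp \<tau> * (1 / (1 - 4 * \<tau>\<^sup>2 * L - 4 * S\<^sup>2 * \<tau>)) powr (real DIM('a) / 2)"

text \<open>Cauchy--Schwarz against the kernel. The drift is only measurable, so the densities need not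
  converge pointwise at time zero, but this bound still controls the second moment there.\<close>
lemma short_time_bound:
  fixes f :: "'a \<Rightarrow> ennreal" and s :: "'a \<Rightarrow> 'a"
  assumes [measurable]: "f \<in> borel_measurable borel" "s \<in> borel_measurable borel"
    and f0: "\<And>x. R < norm x \<Longrightarrow> f x = 0"
    and s_bd: "\<And>x. norm x \<le> R \<Longrightarrow> norm (s x) \<le> S" and gp_bd: "\<And>x. norm x \<le> R \<Longrightarrow> norm (gp x) \<le> S"
    and \<tau>: "0 < \<tau>" and small: "4 * \<tau>\<^sup>2 * L + 4 * S\<^sup>2 * \<tau> < 1"
  shows "(\<integral>\<^sup>+y. (\<integral>\<^sup>+x. f x * ennreal (gauss_density (x + \<tau>\<^sup>2 *\<^sub>R s x) (2 * \<tau>\<^sup>2) y) \<partial>lborel)\<^sup>2 * ennreal (1 / p y) \<partial>lborel)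
    \<le> ennreal ((smear S \<tau>)\<^sup>2) * (\<integral>\<^sup>+x. (f x)\<^sup>2 * ennreal (1 / p x) \<partial>lborel)"
proof (cases "\<exists>x::'a. norm x \<le> R")
  \<comment> \<open>The ball is empty only for negative \<open>R\<close>. Then nothing forces
    \<open>S\<close> to be nonnegative, but \<open>f\<close> vanishes identically.\<close>
  case False
  have "f x = 0" for x using f0[of x] False by (meson not_le)
  thus ?thesis by simp
next
  case True
  hence S0: "0 \<le> S" using s_bd norm_ge_zero order_trans by blast
  define t where "t = \<tau>\<^sup>2"
  have t: "0 < t" using \<tau> by (simp add: t_def)
  \<comment> \<open>\<open>\<kappa>\<close> majorises the transition kernel by a function of
    \<open>y - x\<close>, paying \<open>exp (S * norm w)\<close> for the unknown drift. It depends
    on the norm only, so it has the same mass in either variable. \<open>\<kappa>'\<close> also pays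
    for moving the weight \<open>1 / p\<close> from \<open>y\<close> to \<open>x\<close>.\<close>
  define \<kappa> where "\<kappa> = (\<lambda>w::'a. gauss_density 0 (2 * t) w * exp (S * norm w))"
  define \<kappa>' where "\<kappa>' = (\<lambda>w::'a. gauss_density 0 (2 * t) w * exp (2 * S * norm w + L * (norm w)\<^sup>2))"
  have [measurable]: "\<kappa> \<in> borel_measurable borel" "\<kappa>' \<in> borel_measurable borel"
    unfolding \<kappa>_def \<kappa>'_def by measurable
  have \<kappa>_nn: "0 \<le> \<kappa> w" and \<kappa>'_nn: "0 \<le> \<kappa>' w" for w by (simp_all add: \<kappa>_def \<kappa>'_def gauss_density_nonneg)
  have \<kappa>_le: "\<kappa> w \<le> \<kappa>' w" for w
    unfolding \<kappa>_def \<kappa>'_def using S0 L_ge by (intro mult_left_mono gauss_density_nonneg) auto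
  have W: "(\<integral>\<^sup>+w. ennreal (\<kappa>' w) \<partial>lborel) \<le> ennreal (smear S \<tau>)"
  proof -
    define a where "a = L + S\<^sup>2 / \<tau>"
    have ta: "2 * (2 * t) * a = 4 * \<tau>\<^sup>2 * L + 4 * S\<^sup>2 * \<tau>"
      using \<tau> by (simp add: a_def t_def power2_eq_square field_simps)
    have le: "\<kappa>' w \<le> exp \<tau> * (gauss_density 0 (2 * t) w * exp (a * (norm w)\<^sup>2))" for w
    proof -
      have "0 \<le> (\<tau> - S * norm w)\<^sup>2 / \<tau>" using \<tau> by simp
      also have "\<dots> = \<tau> - 2 * S * norm w + S\<^sup>2 / \<tau> * (norm w)\<^sup>2"
        using \<tau> by (simp add: power2_eq_square field_simps)
      finally have "2 * S * norm w + L * (norm w)\<^sup>2 \<le> \<tau> + a * (norm w)\<^sup>2"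
        by (simp add: a_def algebra_simps)
      hence "exp (2 * S * norm w + L * (norm w)\<^sup>2) \<le> exp \<tau> * exp (a * (norm w)\<^sup>2)"
        unfolding exp_add[symmetric] by simp
      from mult_left_mono[OF this gauss_density_nonneg[of 0 "2 * t" w]]
      show ?thesis unfolding \<kappa>'_def by (simp add: mult_ac)
    qed
    have "(\<integral>\<^sup>+w. ennreal (\<kappa>' w) \<partial>lborel) \<le> (\<integral>\<^sup>+w. ennreal (exp \<tau>) * ennreal (gauss_density (0::'a) (2 * t) w * exp (a * (norm w)\<^sup>2)) \<partial>lborel)"
      using le by (intro nn_integral_mono) (simp add: ennreal_mult'[symmetric] ennreal_leI)
    also have "\<dots> = ennreal (exp \<tau>) * (\<integral>\<^sup>+w. ennreal (gauss_density (0::'a) (2 * t) w * exp (a * (norm w)\<^sup>2)) \<partial>lborel)"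
      by (rule nn_integral_cmult) measurable
    also have "\<dots> = ennreal (smear S \<tau>)"
      using small t nn_integral_gauss_exp_norm_sq[where 'a='a, of "2 * t" a]
      unfolding ta smear_def by (simp add: ennreal_mult'[symmetric] diff_diff_eq)
    finally show ?thesis .
  qed
  have K_le: "f x * ennreal (gauss_density (x + t *\<^sub>R s x) (2 * t) y) \<le> f x * ennreal (\<kappa> (y - x))" for x y
  proof (cases "norm x \<le> R")
    case True
    have "(norm (y - (x + t *\<^sub>R s x)))\<^sup>2 = (norm (y - x))\<^sup>2 - 2 * t * ((y - x) \<bullet> s x) + t\<^sup>2 * (norm (s x))\<^sup>2"
      unfolding power2_norm_eq_inner power2_eq_square[of t]
      by (simp add: inner_diff_left inner_diff_right inner_add_left inner_add_right inner_commute algebra_simps)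
    moreover have c: "(y - x) \<bullet> s x \<le> norm (y - x) * S"
      using norm_cauchy_schwarz[of "y - x" "s x"] mult_left_mono[OF s_bd[OF True] norm_ge_zero[of "y - x"]] by linarith
    ultimately have "(norm (y - x))\<^sup>2 - 2 * t * (norm (y - x) * S) \<le> (norm (y - (x + t *\<^sub>R s x)))\<^sup>2"
      using mult_left_mono[OF c, of "2 * t"] t zero_le_power2[of "t * norm (s x)"]
      unfolding power_mult_distrib by linarith
    hence "- (norm (y - (x + t *\<^sub>R s x)))\<^sup>2 / (2 * (2 * t)) \<le> - ((norm (y - x))\<^sup>2 - 2 * t * (norm (y - x) * S)) / (2 * (2 * t))"
      using t by (intro divide_right_mono) auto
    also have "\<dots> = - (norm (y - x))\<^sup>2 / (2 * (2 * t)) + S * norm (y - x) / 2"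
      using t by (simp add: field_simps)
    also have "\<dots> \<le> - (norm (y - x))\<^sup>2 / (2 * (2 * t)) + S * norm (y - x)"
      using S0 by simp
    finally have "exp (- (norm (y - (x + t *\<^sub>R s x)))\<^sup>2 / (2 * (2 * t))) \<le> exp (- (norm (y - x))\<^sup>2 / (2 * (2 * t))) * exp (S * norm (y - x))"
      unfolding exp_add[symmetric] by simp
    hence "gauss_density (x + t *\<^sub>R s x) (2 * t) y \<le> \<kappa> (y - x)"
      unfolding gauss_density_def \<kappa>_def diff_zero mult.assoc by (intro mult_left_mono) auto
    thus ?thesis by (intro mult_left_mono ennreal_leI) auto
  qed (simp add: f0)
  have sq: "(\<integral>\<^sup>+x. f x * ennreal (gauss_density (x + t *\<^sub>R s x) (2 * t) y) \<partial>lborel)\<^sup>2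
      \<le> ennreal (smear S \<tau>) * (\<integral>\<^sup>+x. (f x)\<^sup>2 * ennreal (\<kappa> (y - x)) \<partial>lborel)" for y
  proof -
    \<comment> \<open>Cauchy--Schwarz is applied to \<open>f\<close> and the constant 1 under this
      measure. Its total mass gives one factor \<open>smear\<close>; the other arises below when
      \<open>y\<close> is integrated out.\<close>
    define \<nu> where "\<nu> = density lborel (\<lambda>x. ennreal (\<kappa> (y - x)))"
    have [simp, measurable_cong]: "sets \<nu> = sets borel" by (simp add: \<nu>_def)
    have "(\<integral>\<^sup>+x. f x * ennreal (gauss_density (x + t *\<^sub>R s x) (2 * t) y) \<partial>lborel) \<le> (\<integral>\<^sup>+x. f x * ennreal (\<kappa> (y - x)) \<partial>lborel)"
      by (intro nn_integral_mono K_le)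
    also have "\<dots> = (\<integral>\<^sup>+x. f x * 1 \<partial>\<nu>)"
      unfolding \<nu>_def by (subst nn_integral_density) (auto simp: mult.commute)
    finally have le1: "(\<integral>\<^sup>+x. f x * ennreal (gauss_density (x + t *\<^sub>R s x) (2 * t) y) \<partial>lborel)\<^sup>2 \<le> (\<integral>\<^sup>+x. f x * 1 \<partial>\<nu>)\<^sup>2"
      by (intro power_mono) auto
    have le2: "(\<integral>\<^sup>+x. f x * 1 \<partial>\<nu>)\<^sup>2 \<le> (\<integral>\<^sup>+x. (f x)\<^sup>2 \<partial>\<nu>) * (\<integral>\<^sup>+x. 1\<^sup>2 \<partial>\<nu>)"
      by (rule Cauchy_Schwarz_nn_integral) auto
    have "(\<integral>\<^sup>+x. 1\<^sup>2 \<partial>\<nu>) = (\<integral>\<^sup>+x. ennreal (\<kappa> (y - x)) \<partial>lborel)"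
      unfolding \<nu>_def by (subst nn_integral_density) auto
    also have "\<dots> = (\<integral>\<^sup>+x. ennreal (\<kappa> (x - y)) \<partial>lborel)"
      by (simp add: \<kappa>_def gauss_density_def norm_minus_commute)
    also have "\<dots> = (\<integral>\<^sup>+x. ennreal (\<kappa> x) \<partial>lborel)"
      by (rule nn_integral_lborel_translate) measurable
    also have "\<dots> \<le> (\<integral>\<^sup>+x. ennreal (\<kappa>' x) \<partial>lborel)"
      by (intro nn_integral_mono ennreal_leI \<kappa>_le)
    also note W
    finally have le3: "(\<integral>\<^sup>+x. (f x)\<^sup>2 \<partial>\<nu>) * (\<integral>\<^sup>+x. 1\<^sup>2 \<partial>\<nu>) \<le> (\<integral>\<^sup>+x. (f x)\<^sup>2 \<partial>\<nu>) * ennreal (smear S \<tau>)"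
      by (intro mult_left_mono) auto
    have "(\<integral>\<^sup>+x. (f x)\<^sup>2 \<partial>\<nu>) = (\<integral>\<^sup>+x. (f x)\<^sup>2 * ennreal (\<kappa> (y - x)) \<partial>lborel)"
      unfolding \<nu>_def by (subst nn_integral_density) (auto simp: mult.commute)
    with order_trans[OF le1 order_trans[OF le2 le3]] show ?thesis by (simp only: mult.commute)
  qed
  have inner: "(\<integral>\<^sup>+y. (f x)\<^sup>2 * ennreal (\<kappa> (y - x)) * ennreal (1 / p y) \<partial>lborel)
      \<le> ennreal (smear S \<tau>) * ((f x)\<^sup>2 * ennreal (1 / p x))" for x
  proof (cases "norm x \<le> R")
    case True
    have pt: "\<kappa> (y - x) * (1 / p y) \<le> 1 / p x * \<kappa>' (y - x)" for y
    proof -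
      have "norm (gp x) * norm (y - x) \<le> S * norm (y - x)" using gp_bd[OF True] by (intro mult_right_mono) auto
      hence "1 / p x * exp (norm (gp x) * norm (y - x) + L * (norm (y - x))\<^sup>2) \<le> 1 / p x * exp (S * norm (y - x) + L * (norm (y - x))\<^sup>2)"
        using p_pos[of x] by (intro mult_left_mono) auto
      with inverse_p_le[of y x] have "1 / p y \<le> 1 / p x * exp (S * norm (y - x) + L * (norm (y - x))\<^sup>2)" by linarith
      hence "\<kappa> (y - x) * (1 / p y) \<le> \<kappa> (y - x) * (1 / p x * exp (S * norm (y - x) + L * (norm (y - x))\<^sup>2))"
        using \<kappa>_nn by (rule mult_left_mono)
      also have "\<dots> = 1 / p x * \<kappa>' (y - x)"
      proof -
        have "exp (S * norm (y - x)) * exp (S * norm (y - x) + L * (norm (y - x))\<^sup>2) = exp (2 * S * norm (y - x) + L * (norm (y - x))\<^sup>2)"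
          unfolding exp_add[symmetric] by (simp add: algebra_simps)
        thus ?thesis unfolding \<kappa>_def \<kappa>'_def by (simp add: mult_ac)
      qed
      finally show ?thesis .
    qed
    have "(\<integral>\<^sup>+y. (f x)\<^sup>2 * ennreal (\<kappa> (y - x)) * ennreal (1 / p y) \<partial>lborel)
        \<le> (\<integral>\<^sup>+y. ((f x)\<^sup>2 * ennreal (1 / p x)) * ennreal (\<kappa>' (y - x)) \<partial>lborel)"
    proof (intro nn_integral_mono)
      fix y :: 'a
      have "ennreal (\<kappa> (y - x)) * ennreal (1 / p y) \<le> ennreal (1 / p x) * ennreal (\<kappa>' (y - x))"
        using pt[of y] p_pos[of x] p_pos[of y] \<kappa>_nn[of "y - x"]
        by (simp add: ennreal_mult'[symmetric] ennreal_leI less_imp_le ennreal_mult''[symmetric])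
      thus "(f x)\<^sup>2 * ennreal (\<kappa> (y - x)) * ennreal (1 / p y) \<le> ((f x)\<^sup>2 * ennreal (1 / p x)) * ennreal (\<kappa>' (y - x))"
        unfolding mult.assoc by (intro mult_left_mono) auto
    qed
    also have "\<dots> = ((f x)\<^sup>2 * ennreal (1 / p x)) * (\<integral>\<^sup>+y. ennreal (\<kappa>' (y - x)) \<partial>lborel)"
      by (rule nn_integral_cmult) measurable
    also have "(\<integral>\<^sup>+y. ennreal (\<kappa>' (y - x)) \<partial>lborel) = (\<integral>\<^sup>+y. ennreal (\<kappa>' y) \<partial>lborel)"
      by (rule nn_integral_lborel_translate) measurable
    also have "((f x)\<^sup>2 * ennreal (1 / p x)) * (\<integral>\<^sup>+y. ennreal (\<kappa>' y) \<partial>lborel) \<le> ((f x)\<^sup>2 * ennreal (1 / p x)) * ennreal (smear S \<tau>)"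
      by (intro mult_left_mono W) auto
    finally show ?thesis by (simp add: mult.commute)
  qed (simp add: f0)
  have smear0: "0 \<le> smear S \<tau>" by (simp add: smear_def)
  have "(\<integral>\<^sup>+y. (\<integral>\<^sup>+x. f x * ennreal (gauss_density (x + t *\<^sub>R s x) (2 * t) y) \<partial>lborel)\<^sup>2 * ennreal (1 / p y) \<partial>lborel)
    \<le> (\<integral>\<^sup>+y. (ennreal (smear S \<tau>) * (\<integral>\<^sup>+x. (f x)\<^sup>2 * ennreal (\<kappa> (y - x)) \<partial>lborel)) * ennreal (1 / p y) \<partial>lborel)"
    by (intro nn_integral_mono mult_right_mono sq) auto
  also have "\<dots> = (\<integral>\<^sup>+y. ennreal (smear S \<tau>) * (\<integral>\<^sup>+x. (f x)\<^sup>2 * ennreal (\<kappa> (y - x)) * ennreal (1 / p y) \<partial>lborel) \<partial>lborel)"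
    by (intro nn_integral_cong) (subst nn_integral_multc, auto simp: mult.assoc)
  also have "\<dots> = ennreal (smear S \<tau>) * (\<integral>\<^sup>+y. (\<integral>\<^sup>+x. (f x)\<^sup>2 * ennreal (\<kappa> (y - x)) * ennreal (1 / p y) \<partial>lborel) \<partial>lborel)"
    by (rule nn_integral_cmult) measurable
  also have "\<dots> \<le> ennreal (smear S \<tau>) * (ennreal (smear S \<tau>) * (\<integral>\<^sup>+x. (f x)\<^sup>2 * ennreal (1 / p x) \<partial>lborel))"
  proof (rule mult_left_mono)
    have "(\<integral>\<^sup>+y. (\<integral>\<^sup>+x. (f x)\<^sup>2 * ennreal (\<kappa> (y - x)) * ennreal (1 / p y) \<partial>lborel) \<partial>lborel)
      = (\<integral>\<^sup>+x. (\<integral>\<^sup>+y. (f x)\<^sup>2 * ennreal (\<kappa> (y - x)) * ennreal (1 / p y) \<partial>lborel) \<partial>lborel)"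
      by (rule lborel_pair.Fubini') measurable
    also have "\<dots> \<le> (\<integral>\<^sup>+x. ennreal (smear S \<tau>) * ((f x)\<^sup>2 * ennreal (1 / p x)) \<partial>lborel)"
      by (intro nn_integral_mono inner)
    also have "\<dots> = ennreal (smear S \<tau>) * (\<integral>\<^sup>+x. (f x)\<^sup>2 * ennreal (1 / p x) \<partial>lborel)"
      by (rule nn_integral_cmult) measurable
    finally show "(\<integral>\<^sup>+y. (\<integral>\<^sup>+x. (f x)\<^sup>2 * ennreal (\<kappa> (y - x)) * ennreal (1 / p y) \<partial>lborel) \<partial>lborel)
      \<le> ennreal (smear S \<tau>) * (\<integral>\<^sup>+x. (f x)\<^sup>2 * ennreal (1 / p x) \<partial>lborel)" .
  qed simp
  finally show ?thesis
    using smear0 by (simp add: t_def ennreal_mult' power2_eq_square mult.assoc)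
qed

lemma smear_tendsto: "((smear S) \<longlongrightarrow> 1) (at_right 0)"
proof -
  have "((\<lambda>\<tau>. exp \<tau> * (1 / (1 - 4 * \<tau>\<^sup>2 * L - 4 * S\<^sup>2 * \<tau>)) powr (real DIM('a) / 2))
      \<longlongrightarrow> exp 0 * (1 / (1 - 4 * 0\<^sup>2 * L - 4 * S\<^sup>2 * 0)) powr (real DIM('a) / 2)) (at_right 0)"
    by (intro tendsto_intros) auto
  thus ?thesis by (simp add: smear_def[abs_def])
qed

end

subsection \<open>One step from an arbitrary initial law\<close>

context lip_score
begin

text \<open>Gronwall's argument is started at time \<open>\<tau>^2\<close>, where
  \<open>short_time_bound\<close> controls the second moment, and \<open>\<tau>\<close> is then sent
  to zero; \<open>smear\<close> tends to 1, so nothing is lost.\<close>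

lemma one_step_compact_support:
  fixes f :: "'a \<Rightarrow> ennreal" and s :: "'a \<Rightarrow> 'a" and C \<epsilon> h R B :: real
  assumes f_meas [measurable]: "f \<in> borel_measurable borel" and s_meas [measurable]: "s \<in> borel_measurable borel"
    and f0: "\<And>x. R < norm x \<Longrightarrow> f x = 0" and R: "0 \<le> R"
    and prob: "prob_space (density lborel f)"
    and err: "\<And>x. norm (gp x - s x) \<le> \<epsilon>" and LSI: "log_sobolev C p gp" and C: "1 \<le> C"
    and eps: "48 * C * \<epsilon>\<^sup>2 \<le> 1" and h0: "0 < h" and h: "4392 * real DIM('a) * C * L\<^sup>2 * h \<le> 1"
    and B: "(\<integral>\<^sup>+x. (f x)\<^sup>2 * ennreal (1 / p x) \<partial>lborel) \<le> ennreal B" "0 \<le> B"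
  shows "(\<integral>\<^sup>+y. (\<integral>\<^sup>+x. f x * ennreal (gauss_density (x + h *\<^sub>R s x) (2 * h) y) \<partial>lborel)\<^sup>2 * ennreal (1 / p y) \<partial>lborel)
    \<le> ennreal (1 + exp (- h / (4 * C)) * (B - 1) + (5 / 2 * \<epsilon>\<^sup>2 + 30 * L\<^sup>2 * h * DIM('a)) * h)"
proof -
  have DIM1: "1 \<le> real DIM('a)" using DIM_positive[where 'a='a] by linarith
  have Lh: "4392 * (L * h) \<le> 1"
  proof -
    have "1 * 1 * L \<le> DIM('a) * C * L\<^sup>2"
      using DIM1 C L_ge by (intro mult_mono) (auto simp: power2_eq_square)
    from mult_left_mono[OF this, of "4392 * h"] have "4392 * h * (1 * 1 * L) \<le> 4392 * h * (DIM('a) * C * L\<^sup>2)"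
      using h0 by simp
    also have "\<dots> \<le> 1" using h by (simp add: mult_ac)
    finally show ?thesis by (simp add: mult_ac)
  qed
  have h1: "4392 * h \<le> 1" using Lh mult_right_mono[OF L_ge less_imp_le[OF h0]] by simp
  have \<epsilon>0: "0 \<le> \<epsilon>" using err[of 0] norm_ge_zero order_trans by blast
  define S where "S = \<epsilon> + (norm (gp 0) + L * R) + R"
  have gp_le: "norm (gp x) \<le> norm (gp 0) + L * R" if "norm x \<le> R" for x
  proof -
    have "L * norm x \<le> L * R" using that L_ge by (intro mult_left_mono) auto
    thus ?thesis using lip[of x 0] norm_triangle_ineq[of "gp x - gp 0" "gp 0"] by simp
  qed
  have gp_bd: "norm (gp x) \<le> S" if "norm x \<le> R" for x
    unfolding S_def using gp_le[OF that] \<epsilon>0 R by linarith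
  have s_bd: "norm (s x) \<le> S" if "norm x \<le> R" for x
  proof -
    have "norm (s x) \<le> norm (gp x) + norm (gp x - s x)"
      using norm_triangle_ineq4[of "gp x" "gp x - s x"] by simp
    thus ?thesis unfolding S_def using gp_le[OF that] err[of x] R by linarith
  qed
  have RS: "R \<le> S" unfolding S_def using \<epsilon>0 R L_ge by (simp add: add_nonneg_nonneg)
  \<comment> \<open>The interpolation requires position and drift to be bounded everywhere.
    Projecting the complement of the ball to the origin achieves this and changes nothing where
    \<open>f\<close> is nonzero.\<close>
  define X where "X = (\<lambda>x::'a. if norm x \<le> R then x else 0)"
  have X_le: "norm (X x) \<le> R" for x using R by (simp add: X_def)
  have [measurable]: "X \<in> borel_measurable borel" unfolding X_def by measurable
  define M where "M = density lborel f"
  have [simp, measurable_cong]: "sets M = sets borel" by (simp add: M_def)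
  interpret M: prob_space M using prob by (simp add: M_def)
  \<comment> \<open>The horizon is \<open>2 * h\<close> so that \<open>h\<close> is an interior
    time, where the two-sided derivative of \<open>F\<close> exists; the step-size bound leaves
    ample room for the doubling.\<close>
  interpret I: lmc_interp p gp L M X "\<lambda>x. s (X x)" S "2 * h"
  proof unfold_locales
    show "norm (X x) \<le> S" for x using X_le[of x] RS by linarith
    show "norm (s (X x)) \<le> S" for x by (rule s_bd[OF X_le])
    show "240 * L * (2 * h) \<le> 1" using Lh L_ge h0 by simp
  qed (use h0 h1 in auto)
  define \<Phi> where "\<Phi> = (\<lambda>t y. \<integral>\<^sup>+x. f x * ennreal (gauss_density (x + t *\<^sub>R s x) (2 * t) y) \<partial>lborel)"
  have q_eq: "ennreal (I.q t y) = \<Phi> t y" if t: "0 < t" "t \<le> 2 * h" for t y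
  proof -
    have "ennreal (I.q t y) = (\<integral>\<^sup>+x. ennreal (I.k t x y) \<partial>M)"
      unfolding I.q_def by (rule nn_integral_eq_integral[symmetric, OF I.k_integrable[OF t]]) (simp add: I.k_nonneg)
    also have "\<dots> = (\<integral>\<^sup>+x. f x * ennreal (I.k t x y) \<partial>lborel)"
      unfolding M_def by (rule nn_integral_density) (auto simp: I.k_def)
    also have "\<dots> = \<Phi> t y"
      unfolding \<Phi>_def
    proof (rule nn_integral_cong)
      fix x
      show "f x * ennreal (I.k t x y) = f x * ennreal (gauss_density (x + t *\<^sub>R s x) (2 * t) y)"
        unfolding I.k_def using f0[of x] by (cases "norm x \<le> R") (auto simp: X_def)
    qed
    finally show ?thesis .
  qed
  have F_eq: "ennreal (I.F t) = (\<integral>\<^sup>+y. (\<Phi> t y)\<^sup>2 * ennreal (1 / p y) \<partial>lborel)" if t: "0 < t" "t \<le> 2 * h" for t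
  proof -
    have "ennreal (I.F t) = (\<integral>\<^sup>+y. ennreal (I.q t y * I.q t y * (1 / p y)) \<partial>lborel)"
      unfolding I.F_def
      by (rule nn_integral_eq_integral[symmetric, OF I.integrable_F[OF t]]) (simp add: less_imp_le I.q_pos[OF t] p_pos)
    also have "\<dots> = (\<integral>\<^sup>+y. (\<Phi> t y)\<^sup>2 * ennreal (1 / p y) \<partial>lborel)"
    proof (intro nn_integral_cong)
      fix y
      have "0 \<le> I.q t y" "0 \<le> 1 / p y" using I.q_pos[OF t, of y] p_pos[of y] by auto
      thus "ennreal (I.q t y * I.q t y * (1 / p y)) = (\<Phi> t y)\<^sup>2 * ennreal (1 / p y)"
        unfolding q_eq[OF t, symmetric] power2_eq_square by (simp only: ennreal_mult mult_nonneg_nonneg)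
    qed
    finally show ?thesis .
  qed
  define K where "K = (5 / 2 * \<epsilon>\<^sup>2 + 30 * L\<^sup>2 * h * DIM('a)) * h"
  have step: "I.F h \<le> 1 + exp (- (h - \<tau>\<^sup>2) / (4 * C)) * ((smear S \<tau>)\<^sup>2 * B - 1) + K"
    if \<tau>: "0 < \<tau>" "\<tau>\<^sup>2 < h" "4 * \<tau>\<^sup>2 * L + 4 * S\<^sup>2 * \<tau> < 1" for \<tau>
  proof -
    have "ennreal (I.F (\<tau>\<^sup>2)) \<le> ennreal ((smear S \<tau>)\<^sup>2) * (\<integral>\<^sup>+x. (f x)\<^sup>2 * ennreal (1 / p x) \<partial>lborel)"
      using short_time_bound[OF f_meas s_meas f0 s_bd gp_bd \<tau>(1) \<tau>(3)] F_eq[of "\<tau>\<^sup>2"] \<tau> h0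
      unfolding \<Phi>_def by simp
    also have "\<dots> \<le> ennreal ((smear S \<tau>)\<^sup>2) * ennreal B" by (intro mult_left_mono B) auto
    also have "\<dots> = ennreal ((smear S \<tau>)\<^sup>2 * B)" by (simp add: ennreal_mult')
    finally have "I.F (\<tau>\<^sup>2) \<le> (smear S \<tau>)\<^sup>2 * B" using B(2) by (subst (asm) ennreal_le_iff) auto
    hence "exp (- (h - \<tau>\<^sup>2) / (4 * C)) * (I.F (\<tau>\<^sup>2) - 1) \<le> exp (- (h - \<tau>\<^sup>2) / (4 * C)) * ((smear S \<tau>)\<^sup>2 * B - 1)"
      by (intro mult_left_mono) auto
    moreover have "I.F h - 1 \<le> exp (- (h - \<tau>\<^sup>2) / (4 * C)) * (I.F (\<tau>\<^sup>2) - 1) + K"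
      unfolding K_def by (rule I.chi_square_gronwall[OF err LSI C eps h]) (use \<tau> h0 in auto)
    ultimately show ?thesis by linarith
  qed
  have "I.F h \<le> 1 + exp (- (h - 0\<^sup>2) / (4 * C)) * (1\<^sup>2 * B - 1) + K"
  proof (rule tendsto_le[OF _ _ tendsto_const])
    show "((\<lambda>\<tau>. 1 + exp (- (h - \<tau>\<^sup>2) / (4 * C)) * ((smear S \<tau>)\<^sup>2 * B - 1) + K)
        \<longlongrightarrow> 1 + exp (- (h - 0\<^sup>2) / (4 * C)) * (1\<^sup>2 * B - 1) + K) (at_right 0)"
      using C by (intro tendsto_intros smear_tendsto) auto
    have 1: "\<forall>\<^sub>F \<tau>::real in at_right 0. 0 < \<tau>" by (simp add: eventually_at_right_less)
    have "((\<lambda>\<tau>::real. \<tau>\<^sup>2) \<longlongrightarrow> 0\<^sup>2) (at_right 0)" by (intro tendsto_intros)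
    hence 2: "\<forall>\<^sub>F \<tau>::real in at_right 0. \<tau>\<^sup>2 < h" by (rule order_tendstoD) (use h0 in simp)
    have "((\<lambda>\<tau>. 4 * \<tau>\<^sup>2 * L + 4 * S\<^sup>2 * \<tau>) \<longlongrightarrow> 4 * 0\<^sup>2 * L + 4 * S\<^sup>2 * 0) (at_right 0)" by (intro tendsto_intros)
    hence 3: "\<forall>\<^sub>F \<tau> in at_right 0. 4 * \<tau>\<^sup>2 * L + 4 * S\<^sup>2 * \<tau> < 1" by (rule order_tendstoD) simp
    show "\<forall>\<^sub>F \<tau> in at_right 0. I.F h \<le> 1 + exp (- (h - \<tau>\<^sup>2) / (4 * C)) * ((smear S \<tau>)\<^sup>2 * B - 1) + K"
      using 1 2 3 by eventually_elim (rule step)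
  qed simp
  hence "I.F h \<le> 1 + exp (- h / (4 * C)) * (B - 1) + K" by simp
  hence "ennreal (I.F h) \<le> ennreal (1 + exp (- h / (4 * C)) * (B - 1) + K)" by (rule ennreal_leI)
  thus ?thesis using F_eq[of h] h0 unfolding \<Phi>_def K_def by simp
qed

text \<open>The density is cut to balls and renormalised by the remaining mass \<open>m\<close>.
  Both sides are quadratic in the density, so the compact case scales back by \<open>m^2\<close>,
  giving a bound uniform in the radius, and monotone convergence applies.\<close>

lemma one_step:
  fixes f :: "'a \<Rightarrow> ennreal" and s :: "'a \<Rightarrow> 'a" and C \<epsilon> h B :: real
  assumes f_meas [measurable]: "f \<in> borel_measurable borel" and s_meas [measurable]: "s \<in> borel_measurable borel"
    and prob: "prob_space (density lborel f)"
    and err: "\<And>x. norm (gp x - s x) \<le> \<epsilon>" and LSI: "log_sobolev C p gp" and C: "1 \<le> C"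
    and eps: "48 * C * \<epsilon>\<^sup>2 \<le> 1" and h0: "0 < h" and h: "4392 * real DIM('a) * C * L\<^sup>2 * h \<le> 1"
    and B: "(\<integral>\<^sup>+x. (f x)\<^sup>2 * ennreal (1 / p x) \<partial>lborel) \<le> ennreal B" "0 \<le> B"
  shows "(\<integral>\<^sup>+y. (\<integral>\<^sup>+x. f x * ennreal (gauss_density (x + h *\<^sub>R s x) (2 * h) y) \<partial>lborel)\<^sup>2 * ennreal (1 / p y) \<partial>lborel)
    \<le> ennreal (1 + exp (- h / (4 * C)) * (B - 1) + (5 / 2 * \<epsilon>\<^sup>2 + 30 * L\<^sup>2 * h * DIM('a)) * h)"
proof -
  define K where "K = (5 / 2 * \<epsilon>\<^sup>2 + 30 * L\<^sup>2 * h * DIM('a)) * h"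
  have K0: "0 \<le> K" unfolding K_def using h0 by simp
  define e where "e = exp (- h / (4 * C))"
  have e: "0 < e" "e \<le> 1" unfolding e_def using h0 C by auto
  define k where "k = (\<lambda>x y. ennreal (gauss_density (x + h *\<^sub>R s x) (2 * h) y))"
  have [measurable]: "(\<lambda>(x, y). k x y) \<in> borel_measurable (borel \<Otimes>\<^sub>M borel)" unfolding k_def by measurable
  define f' where "f' = (\<lambda>(n::nat) x. f x * indicator (cball 0 (real n)) x)"
  have [measurable]: "f' n \<in> borel_measurable borel" for n
  proof -
    have [measurable]: "cball (0::'a) (real n) \<in> sets borel" by simp
    show ?thesis unfolding f'_def by measurable
  qed
  have total: "(\<integral>\<^sup>+x. f x \<partial>lborel) = 1"
    using prob_space.emeasure_space_1[OF prob] by (simp add: emeasure_density)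
  have trunc: "(\<integral>\<^sup>+y. (\<integral>\<^sup>+x. f' n x * k x y \<partial>lborel)\<^sup>2 * ennreal (1 / p y) \<partial>lborel) \<le> ennreal (1 + e * (B - 1) + K)" for n
  proof -
    have "(\<integral>\<^sup>+x. f' n x \<partial>lborel) \<le> (\<integral>\<^sup>+x. f x \<partial>lborel)"
      unfolding f'_def by (intro nn_integral_mono) (auto simp: indicator_def)
    hence le1: "(\<integral>\<^sup>+x. f' n x \<partial>lborel) \<le> 1" using total by simp
    then obtain m where m: "(\<integral>\<^sup>+x. f' n x \<partial>lborel) = ennreal m" "0 \<le> m"
      by (cases "\<integral>\<^sup>+x. f' n x \<partial>lborel") (auto simp: top_unique)
    have m1: "m \<le> 1" using le1 m by simp
    show ?thesis
    proof (cases "m = 0")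
      case True
      hence ae: "AE x in lborel. f' n x = 0" using m by (simp add: nn_integral_0_iff_AE)
      have "(\<integral>\<^sup>+x. f' n x * k x y \<partial>lborel) = 0" for y
      proof -
        have "(\<integral>\<^sup>+x. f' n x * k x y \<partial>lborel) = (\<integral>\<^sup>+(x::'a). 0 \<partial>lborel)"
          by (rule nn_integral_cong_AE) (use ae in \<open>auto elim!: eventually_mono\<close>)
        thus ?thesis by simp
      qed
      thus ?thesis by simp
    next
      case False
      hence m0: "0 < m" using m(2) by simp
      define g where "g = (\<lambda>x. ennreal (1 / m) * f' n x)"
      have g_meas [measurable]: "g \<in> borel_measurable borel" unfolding g_def by measurable
      have g_prob: "prob_space (density lborel g)"
      proof
        have "(\<integral>\<^sup>+x. g x \<partial>lborel) = ennreal (1 / m) * ennreal m"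
          unfolding g_def m(1)[symmetric] by (rule nn_integral_cmult) measurable
        also have "\<dots> = 1" using m0 by (simp add: ennreal_mult'[symmetric])
        finally show "emeasure (density lborel g) (space (density lborel g)) = 1"
          by (simp add: emeasure_density)
      qed
      have "(\<integral>\<^sup>+x. (g x)\<^sup>2 * ennreal (1 / p x) \<partial>lborel)
          \<le> (\<integral>\<^sup>+x. ennreal (1 / m\<^sup>2) * ((f x)\<^sup>2 * ennreal (1 / p x)) \<partial>lborel)"
      proof (intro nn_integral_mono)
        fix x
        have "(g x)\<^sup>2 = ennreal (1 / m\<^sup>2) * (f' n x)\<^sup>2"
          unfolding g_def power_mult_distrib using m0 by (simp add: ennreal_power power_one_over)
        also have "\<dots> \<le> ennreal (1 / m\<^sup>2) * (f x)\<^sup>2"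
          by (intro mult_left_mono power_mono) (auto simp: f'_def indicator_def)
        finally show "(g x)\<^sup>2 * ennreal (1 / p x) \<le> ennreal (1 / m\<^sup>2) * ((f x)\<^sup>2 * ennreal (1 / p x))"
          unfolding mult.assoc[symmetric] by (intro mult_right_mono) auto
      qed
      also have "\<dots> = ennreal (1 / m\<^sup>2) * (\<integral>\<^sup>+x. (f x)\<^sup>2 * ennreal (1 / p x) \<partial>lborel)"
        by (rule nn_integral_cmult) measurable
      also have "\<dots> \<le> ennreal (1 / m\<^sup>2) * ennreal B" by (intro mult_left_mono B) auto
      also have "\<dots> = ennreal (1 / m\<^sup>2 * B)" by (rule ennreal_mult'[symmetric]) simp
      finally have gB: "(\<integral>\<^sup>+x. (g x)\<^sup>2 * ennreal (1 / p x) \<partial>lborel) \<le> ennreal (1 / m\<^sup>2 * B)" .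
      have g_step: "(\<integral>\<^sup>+y. (\<integral>\<^sup>+x. g x * k x y \<partial>lborel)\<^sup>2 * ennreal (1 / p y) \<partial>lborel) \<le> ennreal (1 + e * (1 / m\<^sup>2 * B - 1) + K)"
        unfolding k_def e_def K_def
        by (rule one_step_compact_support[OF g_meas s_meas, where R="real n", OF _ _ g_prob err LSI C eps h0 h gB])
           (use B in \<open>auto simp: g_def f'_def\<close>)
      have "(\<integral>\<^sup>+x. f' n x * k x y \<partial>lborel) = ennreal m * (\<integral>\<^sup>+x. g x * k x y \<partial>lborel)" for y
      proof -
        have "(\<integral>\<^sup>+x. f' n x * k x y \<partial>lborel) = (\<integral>\<^sup>+x. ennreal m * (g x * k x y) \<partial>lborel)"
          unfolding g_def using m0 by (simp add: mult.assoc[symmetric] ennreal_mult'[symmetric])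
        also have "\<dots> = ennreal m * (\<integral>\<^sup>+x. g x * k x y \<partial>lborel)" by (rule nn_integral_cmult) measurable
        finally show ?thesis .
      qed
      hence "(\<integral>\<^sup>+y. (\<integral>\<^sup>+x. f' n x * k x y \<partial>lborel)\<^sup>2 * ennreal (1 / p y) \<partial>lborel)
          = (\<integral>\<^sup>+y. ennreal (m\<^sup>2) * ((\<integral>\<^sup>+x. g x * k x y \<partial>lborel)\<^sup>2 * ennreal (1 / p y)) \<partial>lborel)"
        using m0 by (simp add: power_mult_distrib ennreal_power mult.assoc)
      also have "\<dots> = ennreal (m\<^sup>2) * (\<integral>\<^sup>+y. (\<integral>\<^sup>+x. g x * k x y \<partial>lborel)\<^sup>2 * ennreal (1 / p y) \<partial>lborel)"
        by (rule nn_integral_cmult) measurable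
      also have "\<dots> \<le> ennreal (m\<^sup>2) * ennreal (1 + e * (1 / m\<^sup>2 * B - 1) + K)"
        by (intro mult_left_mono g_step) simp
      also have "\<dots> = ennreal (m\<^sup>2 * (1 + e * (1 / m\<^sup>2 * B - 1) + K))" by (simp add: ennreal_mult')
      also have "\<dots> \<le> ennreal (1 + e * (B - 1) + K)"
      proof (rule ennreal_leI)
        \<comment> \<open>After scaling back, \<open>m\<close> multiplies only the nonnegative
          quantity \<open>1 - e + K\<close>, so the bound is largest at
          \<open>m = 1\<close>.\<close>
        have "m\<^sup>2 * (1 + e * (1 / m\<^sup>2 * B - 1) + K) = m\<^sup>2 * (1 - e + K) + e * B"
          using m0 by (simp add: field_simps)
        also have "m\<^sup>2 * (1 - e + K) \<le> 1 * (1 - e + K)"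
          using m0 m1 e K0 by (intro mult_right_mono) (auto simp: power_le_one)
        finally show "m\<^sup>2 * (1 + e * (1 / m\<^sup>2 * B - 1) + K) \<le> 1 + e * (B - 1) + K" by (simp add: algebra_simps)
      qed
      finally show ?thesis .
    qed
  qed
  have f'_mono: "f' n x \<le> f' (Suc n) x" for n x
    unfolding f'_def by (auto simp: indicator_def)
  have sup: "(\<integral>\<^sup>+x. f x * k x y \<partial>lborel) = (SUP n. \<integral>\<^sup>+x. f' n x * k x y \<partial>lborel)" for y
  proof -
    have "f x * k x y = (SUP n. f' n x * k x y)" for x
    proof (rule antisym)
      obtain n :: nat where "norm x \<le> real n" using real_arch_simple by blast
      hence "f x * k x y = f' n x * k x y" by (simp add: f'_def)
      thus "f x * k x y \<le> (SUP n. f' n x * k x y)" by (metis SUP_upper UNIV_I)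
      show "(SUP n. f' n x * k x y) \<le> f x * k x y"
        by (intro SUP_least mult_right_mono) (auto simp: f'_def indicator_def)
    qed
    hence "(\<integral>\<^sup>+x. f x * k x y \<partial>lborel) = (\<integral>\<^sup>+x. (SUP n. f' n x * k x y) \<partial>lborel)" by simp
    also have "\<dots> = (SUP n. \<integral>\<^sup>+x. f' n x * k x y \<partial>lborel)"
      by (rule nn_integral_monotone_convergence_SUP)
         (auto intro!: incseq_SucI le_funI mult_right_mono f'_mono)
    finally show ?thesis .
  qed
  have mono: "(\<integral>\<^sup>+x. f' n x * k x y \<partial>lborel) \<le> (\<integral>\<^sup>+x. f' (Suc n) x * k x y \<partial>lborel)" for n y
    by (intro nn_integral_mono mult_right_mono f'_mono) auto
  have "(\<integral>\<^sup>+y. (\<integral>\<^sup>+x. f x * k x y \<partial>lborel)\<^sup>2 * ennreal (1 / p y) \<partial>lborel)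
      = (\<integral>\<^sup>+y. (SUP n. (\<integral>\<^sup>+x. f' n x * k x y \<partial>lborel)\<^sup>2 * ennreal (1 / p y)) \<partial>lborel)"
  proof (intro nn_integral_cong)
    fix y
    have inc: "incseq (\<lambda>n. \<integral>\<^sup>+x. f' n x * k x y \<partial>lborel)" by (intro incseq_SucI mono)
    have "(\<lambda>n. \<integral>\<^sup>+x. f' n x * k x y \<partial>lborel) \<longlonglongrightarrow> (\<integral>\<^sup>+x. f x * k x y \<partial>lborel)"
      unfolding sup by (rule LIMSEQ_SUP[OF inc])
    hence "(\<lambda>n. (\<integral>\<^sup>+x. f' n x * k x y \<partial>lborel)\<^sup>2 * ennreal (1 / p y)) \<longlonglongrightarrow> (\<integral>\<^sup>+x. f x * k x y \<partial>lborel)\<^sup>2 * ennreal (1 / p y)"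
      unfolding power2_eq_square
      by (intro tendsto_mult_ennreal tendsto_const)
         (use p_pos[of y] in \<open>auto simp: ennreal_eq_0_iff not_le\<close>)
    moreover have "(\<lambda>n. (\<integral>\<^sup>+x. f' n x * k x y \<partial>lborel)\<^sup>2 * ennreal (1 / p y)) \<longlonglongrightarrow> (SUP n. (\<integral>\<^sup>+x. f' n x * k x y \<partial>lborel)\<^sup>2 * ennreal (1 / p y))"
      by (intro LIMSEQ_SUP incseq_SucI mult_right_mono power_mono mono) auto
    ultimately show "(\<integral>\<^sup>+x. f x * k x y \<partial>lborel)\<^sup>2 * ennreal (1 / p y) = (SUP n. (\<integral>\<^sup>+x. f' n x * k x y \<partial>lborel)\<^sup>2 * ennreal (1 / p y))"
      by (rule LIMSEQ_unique)
  qed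
  also have "\<dots> = (SUP n. \<integral>\<^sup>+y. (\<integral>\<^sup>+x. f' n x * k x y \<partial>lborel)\<^sup>2 * ennreal (1 / p y) \<partial>lborel)"
    by (rule nn_integral_monotone_convergence_SUP)
       (auto intro!: incseq_SucI le_funI mult_right_mono power_mono mono)
  also have "\<dots> \<le> ennreal (1 + e * (B - 1) + K)"
    by (intro SUP_least trunc)
  finally show ?thesis unfolding k_def e_def K_def .
qed

end

subsection \<open>Iterating the step\<close>

lemma prob_space_lmc_kernel:
  assumes "0 < h" shows "prob_space (lmc_kernel s h x)"
  using nn_integral_gauss_density[of "2 * h" "x + h *\<^sub>R s x"] assms
  by (intro prob_spaceI) (simp add: lmc_kernel_def emeasure_density)

lemma sets_lmc_kernel [simp]: "sets (lmc_kernel s h x) = sets borel"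
  by (simp add: lmc_kernel_def)

lemma lmc_kernel_measurable:
  assumes h: "0 < h" and [measurable]: "s \<in> borel_measurable borel" and \<mu>: "sets \<mu> = sets borel"
  shows "lmc_kernel s h \<in> \<mu> \<rightarrow>\<^sub>M subprob_algebra borel"
proof (rule measurable_subprob_algebra)
  note [measurable_cong] = \<mu>
  show "subprob_space (lmc_kernel s h x)" for x
    by (rule prob_space_imp_subprob_space[OF prob_space_lmc_kernel[OF h]])
  fix A :: "'a set" assume [measurable]: "A \<in> sets borel"
  show "(\<lambda>x. emeasure (lmc_kernel s h x) A) \<in> borel_measurable \<mu>"
    unfolding lmc_kernel_def by (subst emeasure_density) (auto simp: measurable_lborel1)
qed simp

text \<open>Tonelli's theorem. The new law is absolutely continuous whatever \<open>\<mu>\<close>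
  is, so after a step \<open>chi_sq\<close> is never infinite merely by its default value.\<close>

lemma bind_lmc_kernel_density:
  assumes h: "0 < h" and s [measurable]: "s \<in> borel_measurable borel" and \<mu>: "sets \<mu> = sets borel" and prob: "prob_space \<mu>"
  shows "bind \<mu> (lmc_kernel s h) = density lborel (\<lambda>y. \<integral>\<^sup>+x. ennreal (gauss_density (x + h *\<^sub>R s x) (2 * h) y) \<partial>\<mu>)"
proof (rule measure_eqI)
  interpret \<mu>: prob_space \<mu> by (rule prob)
  interpret P: pair_sigma_finite \<mu> "lborel :: 'a measure" ..
  note [measurable_cong] = \<mu>
  have sets_bind: "sets (bind \<mu> (lmc_kernel s h)) = sets borel"
    by (rule sets_bind) (use \<mu>.not_empty in auto)
  thus "sets (bind \<mu> (lmc_kernel s h)) = sets (density lborel (\<lambda>y. \<integral>\<^sup>+x. ennreal (gauss_density (x + h *\<^sub>R s x) (2 * h) y) \<partial>\<mu>))"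
    by simp
  fix A assume "A \<in> sets (bind \<mu> (lmc_kernel s h))"
  hence [measurable]: "A \<in> sets borel" by (simp add: sets_bind)
  have "emeasure (bind \<mu> (lmc_kernel s h)) A = (\<integral>\<^sup>+x. emeasure (lmc_kernel s h x) A \<partial>\<mu>)"
    by (rule emeasure_bind[OF \<mu>.not_empty lmc_kernel_measurable[OF h s \<mu>]]) simp
  also have "\<dots> = (\<integral>\<^sup>+x. \<integral>\<^sup>+y. ennreal (gauss_density (x + h *\<^sub>R s x) (2 * h) y) * indicator A y \<partial>lborel \<partial>\<mu>)"
    unfolding lmc_kernel_def by (intro nn_integral_cong emeasure_density) auto
  also have "\<dots> = (\<integral>\<^sup>+y. \<integral>\<^sup>+x. ennreal (gauss_density (x + h *\<^sub>R s x) (2 * h) y) * indicator A y \<partial>\<mu> \<partial>lborel)"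
    by (rule P.Fubini'[symmetric]) measurable
  also have "\<dots> = (\<integral>\<^sup>+y. (\<integral>\<^sup>+x. ennreal (gauss_density (x + h *\<^sub>R s x) (2 * h) y) \<partial>\<mu>) * indicator A y \<partial>lborel)"
    by (intro nn_integral_cong nn_integral_multc) measurable
  also have "\<dots> = emeasure (density lborel (\<lambda>y. \<integral>\<^sup>+x. ennreal (gauss_density (x + h *\<^sub>R s x) (2 * h) y) \<partial>\<mu>)) A"
    by (rule emeasure_density[symmetric]) auto
  finally show "emeasure (bind \<mu> (lmc_kernel s h)) A = \<dots>" .
qed

lemma prob_space_bind_lmc_kernel:
  assumes h: "0 < h" and s: "s \<in> borel_measurable borel" and \<mu>: "sets \<mu> = sets borel" and prob: "prob_space \<mu>"
  shows "prob_space (bind \<mu> (lmc_kernel s h))"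
  by (rule prob_space.prob_space_bind[OF prob _ lmc_kernel_measurable[OF h s \<mu>]])
     (simp add: prob_space_lmc_kernel[OF h])

lemma lmc_law_prob_sets:
  assumes h: "0 < h" and s: "s \<in> borel_measurable borel" and q0: "prob_space q0" "sets q0 = sets borel"
  shows "prob_space (lmc_law q0 s h n) \<and> sets (lmc_law q0 s h n) = sets borel"
proof (induction n)
  case (Suc n)
  thus ?case
    using prob_space_bind_lmc_kernel[OF h s] bind_lmc_kernel_density[OF h s] by simp
qed (use q0 in simp)

text \<open>The Radon--Nikodym derivative agrees almost everywhere with any given density, so
  explicit densities can be used to compute \<open>chi_sq\<close>.\<close>

lemma chi_sq_density:
  fixes p :: "'a::euclidean_space \<Rightarrow> real"
  assumes p: "\<And>x. 0 < p x" and [measurable]: "g \<in> borel_measurable borel"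
  shows "chi_sq (density lborel g) p = (\<integral>\<^sup>+x. (g x)\<^sup>2 * ennreal (1 / p x) \<partial>lborel) - 1"
proof -
  have ac: "absolutely_continuous lborel (density lborel g)"
    by (rule absolutely_continuousI_density) simp
  have "AE x in lborel. g x = RN_deriv lborel (density lborel g) x"
    by (rule sigma_finite_measure.RN_deriv_unique[OF sigma_finite_lborel]) auto
  hence "(\<integral>\<^sup>+x. (RN_deriv lborel (density lborel g) x)\<^sup>2 / ennreal (p x) \<partial>lborel) = (\<integral>\<^sup>+x. (g x)\<^sup>2 * ennreal (1 / p x) \<partial>lborel)"
    by (intro nn_integral_cong_AE) (auto elim!: eventually_mono simp: divide_ennreal_def inverse_ennreal[OF p] inverse_eq_divide)
  thus ?thesis using ac by (simp add: chi_sq_def)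
qed

lemma (in lip_score) chi_sq_step:
  fixes s :: "'a \<Rightarrow> 'a" and C \<epsilon> h :: real
  assumes s [measurable]: "s \<in> borel_measurable borel"
    and err: "\<And>x. norm (gp x - s x) \<le> \<epsilon>" and LSI: "log_sobolev C p gp" and C: "1 \<le> C"
    and eps: "48 * C * \<epsilon>\<^sup>2 \<le> 1" and h0: "0 < h" and h: "4392 * real DIM('a) * C * L\<^sup>2 * h \<le> 1"
    and \<mu>: "sets \<mu> = sets borel" and prob: "prob_space \<mu>"
  shows "chi_sq (bind \<mu> (lmc_kernel s h)) p
    \<le> ennreal (exp (- h / (4 * C))) * chi_sq \<mu> p + ennreal ((5 / 2 * \<epsilon>\<^sup>2 + 30 * L\<^sup>2 * h * DIM('a)) * h)"
proof (cases "chi_sq \<mu> p = \<infinity>")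
  \<comment> \<open>The exponential factor is positive, so the right side is infinite as
    well.\<close>
  case True
  thus ?thesis by (simp add: ennreal_mult_top)
next
  case False
  note [measurable_cong] = \<mu>
  define K where "K = (5 / 2 * \<epsilon>\<^sup>2 + 30 * L\<^sup>2 * h * DIM('a)) * h"
  have K0: "0 \<le> K" unfolding K_def using h0 by simp
  define f where "f = RN_deriv lborel \<mu>"
  have f_meas [measurable]: "f \<in> borel_measurable borel" unfolding f_def by measurable
  have "absolutely_continuous lborel \<mu>" using False by (auto simp: chi_sq_def split: if_splits)
  hence dens: "density lborel f = \<mu>"
    unfolding f_def by (rule sigma_finite_measure.density_RN_deriv[OF sigma_finite_lborel]) (simp add: \<mu>)
  have chi: "chi_sq \<mu> p = (\<integral>\<^sup>+x. (f x)\<^sup>2 * ennreal (1 / p x) \<partial>lborel) - 1"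
    using chi_sq_density[OF p_pos f_meas] dens by simp
  obtain B where B: "(\<integral>\<^sup>+x. (f x)\<^sup>2 * ennreal (1 / p x) \<partial>lborel) = ennreal B" "0 \<le> B"
    using False unfolding chi by (cases "\<integral>\<^sup>+x. (f x)\<^sup>2 * ennreal (1 / p x) \<partial>lborel") auto
  have chi_B: "chi_sq \<mu> p = ennreal (B - 1)"
    unfolding chi B using ennreal_minus[of 1 B] by simp
  have \<mu>_int: "(\<integral>\<^sup>+x. ennreal (gauss_density (x + h *\<^sub>R s x) (2 * h) y) \<partial>\<mu>) = (\<integral>\<^sup>+x. f x * ennreal (gauss_density (x + h *\<^sub>R s x) (2 * h) y) \<partial>lborel)" for y
    unfolding dens[symmetric] by (rule nn_integral_density) auto
  have "chi_sq (bind \<mu> (lmc_kernel s h)) p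
      = (\<integral>\<^sup>+y. (\<integral>\<^sup>+x. f x * ennreal (gauss_density (x + h *\<^sub>R s x) (2 * h) y) \<partial>lborel)\<^sup>2 * ennreal (1 / p y) \<partial>lborel) - 1"
    unfolding bind_lmc_kernel_density[OF h0 s \<mu> prob] \<mu>_int by (rule chi_sq_density[OF p_pos]) measurable
  also have "\<dots> \<le> ennreal (1 + exp (- h / (4 * C)) * (B - 1) + K) - 1"
    unfolding K_def
    by (intro ennreal_minus_mono one_step[OF f_meas s _ err LSI C eps h0 h]) (use B prob dens in auto)
  also have "\<dots> = ennreal (exp (- h / (4 * C)) * (B - 1) + K)"
    using ennreal_minus[of 1 "1 + exp (- h / (4 * C)) * (B - 1) + K"] by simp
  also have "\<dots> \<le> ennreal (exp (- h / (4 * C))) * ennreal (B - 1) + ennreal K"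
  proof (cases "1 \<le> B")
    case True
    hence "ennreal (exp (- h / (4 * C)) * (B - 1) + K) = ennreal (exp (- h / (4 * C)) * (B - 1)) + ennreal K"
      using K0 by (intro ennreal_plus) auto
    also have "ennreal (exp (- h / (4 * C)) * (B - 1)) = ennreal (exp (- h / (4 * C))) * ennreal (B - 1)"
      by (rule ennreal_mult') simp
    finally show ?thesis by simp
  next
    \<comment> \<open>For \<open>B < 1\<close> the real product is nonpositive while
      \<open>ennreal (B - 1)\<close> is truncated to zero, so \<open>K\<close> alone bounds the left
      side.\<close>
    case False
    hence "exp (- h / (4 * C)) * (B - 1) \<le> 0" by (simp add: mult_le_0_iff)
    hence "ennreal (exp (- h / (4 * C)) * (B - 1) + K) \<le> ennreal K" by (intro ennreal_leI) simp
    also have "\<dots> \<le> ennreal (exp (- h / (4 * C))) * ennreal (B - 1) + ennreal K" by (rule add_increasing) auto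
    finally show ?thesis .
  qed
  finally show ?thesis unfolding chi_B K_def .
qed

text \<open>The value \<open>2 * b / x\<close> is carried along unchanged by the recursion:
  \<open>exp (- x) \<le> 1 / (1 + x) \<le> 1 - x / 2\<close> for \<open>x \<le> 1\<close>, so one
  step removes at least \<open>b\<close> from it before \<open>b\<close> is added again.\<close>

lemma geometric_recursion_ennreal:
  fixes a :: "nat \<Rightarrow> ennreal" and x b :: real
  assumes step: "\<And>k. a (Suc k) \<le> ennreal (exp (- x)) * a k + ennreal b"
    and x: "0 < x" "x \<le> 1" and b: "0 \<le> b"
  shows "a n \<le> ennreal (exp (- real n * x)) * a 0 + ennreal (2 * b / x)"
proof (induction n)
  case 0
  show ?case by simp
next
  case (Suc n)
  have "exp (- x) \<le> 1 / (1 + x)"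
    using exp_ge_add_one_self[of x] x by (simp add: exp_minus field_simps)
  also have "\<dots> \<le> 1 - x / 2"
    using x by (simp add: field_simps power2_eq_square)
  finally have "exp (- x) * (2 * b / x) \<le> (1 - x / 2) * (2 * b / x)"
    using x b by (intro mult_right_mono) auto
  moreover have "(1 - x / 2) * (2 * b / x) = 2 * b / x - b" using x by (simp add: field_simps)
  ultimately have le: "exp (- x) * (2 * b / x) + b \<le> 2 * b / x" by linarith
  have "a (Suc n) \<le> ennreal (exp (- x)) * (ennreal (exp (- real n * x)) * a 0 + ennreal (2 * b / x)) + ennreal b"
    by (intro order_trans[OF step] add_right_mono mult_left_mono Suc.IH) simp
  also have "\<dots> = ennreal (exp (- x) * exp (- real n * x)) * a 0 + ennreal (exp (- x) * (2 * b / x) + b)"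
  proof -
    have "ennreal (exp (- x)) * (ennreal (exp (- real n * x)) * a 0 + ennreal w) + ennreal b
        = ennreal (exp (- x) * exp (- real n * x)) * a 0 + ennreal (exp (- x) * w + b)" if "0 \<le> w" for w
      using that b by (simp add: distrib_left mult.assoc ennreal_mult add.assoc)
    thus ?thesis using x b by simp
  qed
  also have "\<dots> \<le> ennreal (exp (- x) * exp (- real n * x)) * a 0 + ennreal (2 * b / x)"
    by (intro add_left_mono ennreal_leI le)
  also have "exp (- x) * exp (- real n * x) = exp (- real (Suc n) * x)"
    unfolding exp_add[symmetric] by (simp add: algebra_simps)
  finally show ?case .
qed

theorem theorem6:
  fixes p :: "'a::euclidean_space \<Rightarrow> real"
    and gp s :: "'a \<Rightarrow> 'a"
    and q0 :: "'a measure"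
    and L C\<^sub>L\<^sub>S \<epsilon>\<^sub>1 h :: real
    and N :: nat
  assumes p_dens: "prob_density p"
    and p_pos: "\<forall>x. 0 < p x"
    and score: "\<forall>x. GDERIV (\<lambda>y. ln (p y)) x :> gp x"
    and score_cont: "continuous_on UNIV gp"
    and lip: "\<forall>x y. norm (gp x - gp y) \<le> L * norm (x - y)"
    and L_ge: "1 \<le> L"
    and LSI: "log_sobolev C\<^sub>L\<^sub>S p gp"
    and C_ge: "1 \<le> C\<^sub>L\<^sub>S"
    and eps_le: "\<epsilon>\<^sub>1 \<le> sqrt (1 / (48 * C\<^sub>L\<^sub>S))"
    and s_meas: "s \<in> borel_measurable borel"
    and s_err: "\<forall>x. norm (gp x - s x) \<le> \<epsilon>\<^sub>1"
    and h_pos: "0 < h"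
    and h_le: "h \<le> 1 / (4392 * real DIM('a) * C\<^sub>L\<^sub>S * L\<^sup>2)"
    and q0_prob: "prob_space q0"
    and q0_sets: "sets q0 = sets borel"
  shows "(\<forall>k. chi_sq (lmc_law q0 s h (Suc k)) p
              \<le> ennreal (exp (- h / (4 * C\<^sub>L\<^sub>S))) * chi_sq (lmc_law q0 s h k) p
                 + ennreal (170 * real DIM('a) * L\<^sup>2 * h\<^sup>2 + 5 * \<epsilon>\<^sub>1\<^sup>2 * h))
       \<and> chi_sq (lmc_law q0 s h N) p
           \<le> ennreal (exp (- real N * h / (4 * C\<^sub>L\<^sub>S))) * chi_sq q0 p
              + ennreal (680 * real DIM('a) * L\<^sup>2 * h * C\<^sub>L\<^sub>S + 20 * \<epsilon>\<^sub>1\<^sup>2 * C\<^sub>L\<^sub>S)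
       \<and> ennreal (exp (- real N * h / (4 * C\<^sub>L\<^sub>S))) * chi_sq q0 p
              + ennreal (680 * real DIM('a) * L\<^sup>2 * h * C\<^sub>L\<^sub>S + 20 * \<epsilon>\<^sub>1\<^sup>2 * C\<^sub>L\<^sub>S)
           \<le> ennreal (exp (- real N * h / (4 * C\<^sub>L\<^sub>S))) * chi_sq q0 p + 1"
proof -
  interpret lip_score p gp L
    using p_dens p_pos score lip L_ge by unfold_locales auto
  let ?d = "real DIM('a)"
  have DIM1: "1 \<le> ?d" using DIM_positive[where 'a='a] by linarith
  have \<epsilon>0: "0 \<le> \<epsilon>\<^sub>1" using s_err norm_ge_zero order_trans by blast
  have "\<epsilon>\<^sub>1\<^sup>2 \<le> (sqrt (1 / (48 * C\<^sub>L\<^sub>S)))\<^sup>2" using eps_le \<epsilon>0 by (rule power_mono)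
  hence "\<epsilon>\<^sub>1\<^sup>2 \<le> 1 / (48 * C\<^sub>L\<^sub>S)" using C_ge by simp
  hence eps: "48 * C\<^sub>L\<^sub>S * \<epsilon>\<^sub>1\<^sup>2 \<le> 1" using C_ge by (simp add: field_simps)
  have "0 < 4392 * ?d * C\<^sub>L\<^sub>S * L\<^sup>2" using DIM1 C_ge L_ge by simp
  hence hC: "4392 * ?d * C\<^sub>L\<^sub>S * L\<^sup>2 * h \<le> 1" using h_le by (simp add: field_simps)
  \<comment> \<open>This is the error actually proved for one step. Its coefficient 5/2 is half of
    the stated 5, which pays for the factor 2 lost in the geometric recursion.\<close>
  define b where "b = (5 / 2 * \<epsilon>\<^sub>1\<^sup>2 + 30 * L\<^sup>2 * h * ?d) * h"
  define x where "x = h / (4 * C\<^sub>L\<^sub>S)"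
  have b0: "0 \<le> b" unfolding b_def using h_pos by simp
  have x0: "0 < x" unfolding x_def using h_pos C_ge by simp
  have x1: "x \<le> 1"
  proof -
    have "1 * 1 * 1 \<le> ?d * C\<^sub>L\<^sub>S * L\<^sup>2"
      using DIM1 C_ge L_ge by (intro mult_mono) (auto simp: one_le_power)
    from mult_right_mono[OF this, of h] have "h \<le> ?d * C\<^sub>L\<^sub>S * L\<^sup>2 * h" using h_pos by simp
    moreover have "4392 * (?d * C\<^sub>L\<^sub>S * L\<^sup>2 * h) \<le> 1" using hC by (simp add: mult.assoc)
    ultimately have "h \<le> 1" using h_pos by linarith
    thus ?thesis unfolding x_def using C_ge by (simp add: field_simps)
  qed
  have law: "prob_space (lmc_law q0 s h n)" "sets (lmc_law q0 s h n) = sets borel" for n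
    using lmc_law_prob_sets[OF h_pos s_meas q0_prob q0_sets] by auto
  have step: "chi_sq (lmc_law q0 s h (Suc k)) p \<le> ennreal (exp (- x)) * chi_sq (lmc_law q0 s h k) p + ennreal b" for k
    using chi_sq_step[OF s_meas _ LSI C_ge eps h_pos hC law(2) law(1), of k] s_err
    unfolding x_def b_def by simp
  have b_le: "b \<le> 170 * ?d * L\<^sup>2 * h\<^sup>2 + 5 * \<epsilon>\<^sub>1\<^sup>2 * h"
  proof -
    have "b = 30 * (?d * L\<^sup>2 * h\<^sup>2) + 5 / 2 * (\<epsilon>\<^sub>1\<^sup>2 * h)"
      by (simp add: b_def power2_eq_square algebra_simps)
    moreover have "0 \<le> ?d * L\<^sup>2 * h\<^sup>2" "0 \<le> \<epsilon>\<^sub>1\<^sup>2 * h" using h_pos by auto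
    moreover have "170 * ?d * L\<^sup>2 * h\<^sup>2 + 5 * \<epsilon>\<^sub>1\<^sup>2 * h = 170 * (?d * L\<^sup>2 * h\<^sup>2) + 5 * (\<epsilon>\<^sub>1\<^sup>2 * h)"
      by (simp add: mult.assoc)
    ultimately show ?thesis by linarith
  qed
  have 1: "chi_sq (lmc_law q0 s h (Suc k)) p
      \<le> ennreal (exp (- h / (4 * C\<^sub>L\<^sub>S))) * chi_sq (lmc_law q0 s h k) p
         + ennreal (170 * ?d * L\<^sup>2 * h\<^sup>2 + 5 * \<epsilon>\<^sub>1\<^sup>2 * h)" for k
    using order_trans[OF step add_left_mono[OF ennreal_leI[OF b_le]]] by (simp add: x_def)
  \<comment> \<open>Dividing by \<open>x\<close> turns the step error into
    \<open>8 * C\<^sub>L\<^sub>S\<close> times its rate per unit time: 5/2 becomes exactly the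
    stated 20, and 30 becomes 240, below 680.\<close>
  have "2 * b / x = 240 * (?d * L\<^sup>2 * h * C\<^sub>L\<^sub>S) + 20 * (\<epsilon>\<^sub>1\<^sup>2 * C\<^sub>L\<^sub>S)"
    using h_pos C_ge by (simp add: b_def x_def field_simps)
  moreover have "0 \<le> ?d * L\<^sup>2 * h * C\<^sub>L\<^sub>S" using h_pos C_ge by simp
  moreover have "680 * ?d * L\<^sup>2 * h * C\<^sub>L\<^sub>S + 20 * \<epsilon>\<^sub>1\<^sup>2 * C\<^sub>L\<^sub>S = 680 * (?d * L\<^sup>2 * h * C\<^sub>L\<^sub>S) + 20 * (\<epsilon>\<^sub>1\<^sup>2 * C\<^sub>L\<^sub>S)"
    by (simp add: mult.assoc)
  ultimately have sum_le: "2 * b / x \<le> 680 * ?d * L\<^sup>2 * h * C\<^sub>L\<^sub>S + 20 * \<epsilon>\<^sub>1\<^sup>2 * C\<^sub>L\<^sub>S" by linarith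
  have 2: "chi_sq (lmc_law q0 s h N) p
      \<le> ennreal (exp (- real N * h / (4 * C\<^sub>L\<^sub>S))) * chi_sq q0 p
         + ennreal (680 * ?d * L\<^sup>2 * h * C\<^sub>L\<^sub>S + 20 * \<epsilon>\<^sub>1\<^sup>2 * C\<^sub>L\<^sub>S)"
    using order_trans[OF geometric_recursion_ennreal[of "\<lambda>k. chi_sq (lmc_law q0 s h k) p", OF step x0 x1 b0, of N]
      add_left_mono[OF ennreal_leI[OF sum_le]]] by (simp add: x_def)
  \<comment> \<open>The hypotheses on \<open>h\<close> and \<open>\<epsilon>\<^sub>1\<close> bound
    the two terms by 680/4392 and 20/48, whose sum is below 1.\<close>
  have "680 * ?d * L\<^sup>2 * h * C\<^sub>L\<^sub>S + 20 * \<epsilon>\<^sub>1\<^sup>2 * C\<^sub>L\<^sub>S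
      = 680 / 4392 * (4392 * ?d * C\<^sub>L\<^sub>S * L\<^sup>2 * h) + 20 / 48 * (48 * C\<^sub>L\<^sub>S * \<epsilon>\<^sub>1\<^sup>2)"
    by (simp add: algebra_simps)
  also have "\<dots> \<le> 1" using eps hC by linarith
  finally have "ennreal (680 * ?d * L\<^sup>2 * h * C\<^sub>L\<^sub>S + 20 * \<epsilon>\<^sub>1\<^sup>2 * C\<^sub>L\<^sub>S) \<le> 1"
    using ennreal_leI[of _ 1] by simp
  with 1 2 show ?thesis by (auto intro: add_left_mono)
qed

end
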